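(* Let $R$ be a non-local finite commutative ring with unity. Then the genus of the upper ideal relation graph $\Gamma_U(R)$ is $1$ if and only if $R$ is isomorphic to one of the following $8$ rings: $\mathbb{Z}_2 \times \mathbb{Z}_7$, $\mathbb{Z}_3 \times \mathbb{Z}_7$, $\mathbb{F}_4 \times \mathbb{Z}_7$, $\mathbb{Z}_2 \times \mathbb{Z}_5$, $\mathbb{Z}_3 \times \mathbb{Z}_5$, $\mathbb{F}_4 \times \mathbb{Z}_5$, $\mathbb{Z}_3 \times \mathbb{Z}_4$, $\mathbb{Z}_3 \times \frac{\mathbb{Z}_2[x]}{(x^2)}$.
   Context: Rings have a unity. A ring is local if it has a unique maximal ideal; a non-local finite commutative ring is (up to isomorphism) a direct product $R_1\times\cdots\times R_n$ of finite commutative local rings with $n\ge 2$. For $x\in R$, $(x)$ is the ideal generated by $x$. The upper ideal relation graph $\Gamma_U(R)$ is the simple undirected graph whose vertex set is the set of all non-unit elements of $R$ (including $0$), where two distinct vertices $x,y$ are adjacent if and only if there exists a non-unit $z\in R$ with $(x)\subseteq (z)$ and $(y)\subseteq (z)$. $\mathbb{F}_q$ denotes the field with $q$ elements. The genus of a graph is the minimum non-negative integer $g$ such that the graph can be embedded (drawn without edge crossings) in the orientable surface $\mathbb{S}_g$ with $g$ handles. *)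

theory Defs
  imports
    "HOL-Analysis.Path_Connected"
    "HOL-Library.Extended_Nat"
    "HOL-Algebra.Chinese_Remainder"
    "HOL-Algebra.Polynomial_Divisibility"
    "HOL-Number_Theory.Residues"
begin

(* A simple undirected graph: its vertex set and its edge set, the edges being two-element
   sets of vertices. *)
type_synonym 'a ugraph = "'a set \<times> 'a set set"

abbreviation verts :: "'a ugraph \<Rightarrow> 'a set" where "verts \<equiv> fst"

abbreviation edges :: "'a ugraph \<Rightarrow> 'a set set" where "edges \<equiv> snd"

(* A drawing without crossings: p places the vertices, and c e is the arc drawn for the edge e.
   An arc meets the placed vertices only in its end points, and two arcs meet only in
   common end points. *)
definition embeds_in :: "'a ugraph \<Rightarrow> 'b::topological_space set \<Rightarrow> bool" where
  "embeds_in G S \<longleftrightarrow>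
    (\<exists>(p :: 'a \<Rightarrow> 'b) (c :: 'a set \<Rightarrow> real \<Rightarrow> 'b).
       inj_on p (verts G) \<and> p ` verts G \<subseteq> S \<and>
       (\<forall>e\<in>edges G. arc (c e) \<and> path_image (c e) \<subseteq> S \<and>
          {pathstart (c e), pathfinish (c e)} = p ` e \<and>
          path_image (c e) \<inter> p ` verts G \<subseteq> p ` e) \<and>
       (\<forall>e\<in>edges G. \<forall>f\<in>edges G. e \<noteq> f \<longrightarrow>
          path_image (c e) \<inter> path_image (c f) \<subseteq> p ` (e \<inter> f)))"

(* A solid box with g disjoint square tunnels drilled through it from bottom to top, i.e. a
   handlebody with g handles. For g = 0 it is the box itself. *)
definition handlebody :: "nat \<Rightarrow> (real \<times> real \<times> real) set" where
  "handlebody g =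
     {0 .. 2 * real g + 1} \<times> {0..3} \<times> {0..1} -
     (\<Union>i<g. {2 * real i + 1 <..< 2 * real i + 2} \<times> {1<..<2} \<times> UNIV)"

(* The closed orientable surface with g handles is the boundary surface of the handlebody:
   a sphere for g = 0, a torus for g = 1. *)
definition orientable_surface :: "nat \<Rightarrow> (real \<times> real \<times> real) set" where
  "orientable_surface g = frontier (handlebody g)"

(* The infimum of a nonempty set of extended naturals is its minimum; the value is infinite
   exactly for a graph that embeds in none of the surfaces. *)
definition graph_genus :: "'a ugraph \<Rightarrow> enat" where
  "graph_genus G = Inf (enat ` {g. embeds_in G (orientable_surface g)})"

definition local_ring :: "('a, 'b) ring_scheme \<Rightarrow> bool" where
  "local_ring R \<longleftrightarrow> (\<exists>!M. maximalideal M R)"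

definition nonunits :: "('a, 'b) ring_scheme \<Rightarrow> 'a set" where
  "nonunits R = carrier R - Units R"

definition upper_ideal_relation_graph :: "('a, 'b) ring_scheme \<Rightarrow> 'a ugraph" where
  "upper_ideal_relation_graph R =
     (nonunits R,
      {{x, y} | x y. x \<in> nonunits R \<and> y \<in> nonunits R \<and> x \<noteq> y \<and>
         (\<exists>z\<in>nonunits R. Idl\<^bsub>R\<^esub> {x} \<subseteq> Idl\<^bsub>R\<^esub> {z} \<and> Idl\<^bsub>R\<^esub> {y} \<subseteq> Idl\<^bsub>R\<^esub> {z})})"

abbreviation Zmod :: "int \<Rightarrow> int ring" where "Zmod \<equiv> residue_ring"

(* The ring Z_2[x]/(x^2). *)
definition Z2_dual_numbers :: "int list set ring" where
  "Z2_dual_numbers =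
     (let P = poly_ring (Zmod 2) in P Quot (Idl\<^bsub>P\<^esub> {X\<^bsub>Zmod 2\<^esub> [^]\<^bsub>P\<^esub> (2::nat)}))"

(* Fields with q elements are unique up to isomorphism, and each one has a copy whose
   elements are natural numbers, so F can be restricted to that carrier type. *)
definition is_GF :: "nat \<Rightarrow> nat ring \<Rightarrow> bool" where
  "is_GF q F \<longleftrightarrow> field F \<and> finite (carrier F) \<and> card (carrier F) = q"

end

theory Submission
  imports
    Defs
    "HOL-Analysis.Further_Topology"
    "HOL-Algebra.Sylow"
    "HOL-Library.Z2"
begin

text \<open>
  Write \<open>y e\<close> for the homology class mod 2 that an edge \<open>e\<close> of a graph drawn on the torus acquires
  relative to fixed lifts of the vertices to the plane, and \<open>\<omega>\<close> for the intersection form. If \<open>e\<close>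
  and \<open>f\<close> are disjoint, a function with simple zeros at the int_lattice points has no zero at the
  differences of their lifts, so it has a logarithm on the square of parameters, and its total change
  around the boundary vanishes. This expresses \<open>\<omega> (y e) (y f)\<close> by the crossings of \<open>e\<close> and \<open>f\<close> in
  a convex drawing, up to terms that cancel in suitable sums: over the 15 pairs of disjoint edges
  of a \<open>K\<^sub>5\<close> the form sums to 1, as in van Kampen's proof that \<open>K\<^sub>5\<close> is not planar, and
  disjoint triangles are orthogonal. Hence a triangle disjoint from some \<open>K\<^sub>5\<close> is null, and no
  toroidal graph contains a \<open>K\<^sub>5\<close> with a vertex \<open>v\<close> such that every triangle avoiding \<open>v\<close> is
  disjoint from another \<open>K\<^sub>5\<close>. This excludes \<open>K\<^sub>8\<close>, two \<open>K\<^sub>5\<close> sharing a vertex, and two \<open>K\<^sub>6\<close>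
  sharing a triangle.

  A finite ring that is not local has a nontrivial idempotent and splits as \<open>A \<times> B\<close>. Each nonunit \<open>b\<close>
  of \<open>B\<close> gives a clique \<open>A \<times> (b)\<close>, and likewise for \<open>A\<close>; the excluded graphs leave only the eight
  rings and rings whose graph is planar, while each edge lies in one of two cliques that, for the
  eight rings, fit into a straight-line drawing of \<open>K\<^sub>7\<close> on the torus with additional vertices in
  one triangle.
\<close>

section \<open>Intersection parities on the torus\<close>

text \<open>The arcs of a drawing are merely continuous, so neither faces nor crossing counts nor
  general position are at hand. All that a drawing supplies is disjointness, and the logarithm of
  \<open>qp\<close> on the parameter square is how disjointness is turned into arithmetic: comparing
  its four sides with logarithms fixed once for every ordered pair of vertices leaves integers, and
  their parities obey one relation for each pair of disjoint edges. Since \<open>qp\<close> is odd,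
  the two orders of a pair of vertices contribute opposite parities. This is the rule of a convex
  drawing, where exactly one of the three perfect matchings of four points crosses; the five
  quadruples in a \<open>K\<^sub>5\<close> make its total odd. With all displacements zero the same
  relation excludes \<open>K\<^sub>5\<close> from the plane, so one argument serves the sphere and
  the torus. On the torus \<open>K\<^sub>7\<close> can be drawn, so a single
  \<open>K\<^sub>5\<close> gives no contradiction there; further cliques are needed to force the
  classes of triangles to vanish.\<close>

definition log_change :: "(real \<Rightarrow> complex) \<Rightarrow> complex" where
  "log_change g = (SOME d. \<exists>L. continuous_on {0..1} L \<and> (\<forall>s\<in>{0..1}. g s = exp (L s)) \<and> d = L 1 - L 0)"

text \<open>Two continuous logarithms of the same function differ by a continuous function whose
  values are multiples of \<open>2 * pi * \<i>\<close>, hence by a constant. So the choice made in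
  \<open>log_change\<close> does not matter.\<close>

lemma log_change_eqI:
  assumes L: "continuous_on {0..1} L" "\<And>s. s \<in> {0..1} \<Longrightarrow> g s = exp (L s)"
  shows "log_change g = L 1 - L 0"
proof -
  have uniq: "M 1 - M 0 = L 1 - L 0"
    if M: "continuous_on {0..1} M" "\<forall>s\<in>{0..1}. g s = exp (M s)" for M
  proof -
    have "(\<lambda>s. M s - L s) constant_on {0..1::real}"
    proof (rule continuous_discrete_range_constant)
      show "continuous_on {0..1} (\<lambda>s. M s - L s)"
        using L(1) M(1) by (intro continuous_intros)
      fix s :: real assume s: "s \<in> {0..1}"
      show "\<exists>e>0. \<forall>y. y \<in> {0..1} \<and> M y - L y \<noteq> M s - L s \<longrightarrow> e \<le> cmod (M y - L y - (M s - L s))"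
      proof (intro exI[of _ "2*pi"] conjI allI impI)
        fix y assume y: "y \<in> {0..1} \<and> M y - L y \<noteq> M s - L s"
        have 1: "exp (M y - L y) = 1" "exp (M s - L s) = 1"
          using L(2)[of y] L(2)[of s] M(2) y s by (auto simp: exp_diff)
        then have "exp ((M y - L y) - (M s - L s)) = 1" by (simp add: exp_diff)
        then obtain n :: int where n: "Re (M y - L y - (M s - L s)) = 0"
            "Im (M y - L y - (M s - L s)) = of_int (2*n) * pi"
          using exp_eq_1 by metis
        have "n \<noteq> 0" using n y by (auto simp: complex_eq_iff)
        then have "1 \<le> \<bar>real_of_int n\<bar>" by linarith
        have "2*pi \<le> \<bar>Im (M y - L y - (M s - L s))\<bar>"
          using \<open>1 \<le> \<bar>real_of_int n\<bar>\<close> unfolding n by (simp add: abs_mult)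
        also have "\<dots> \<le> cmod (M y - L y - (M s - L s))" by (rule abs_Im_le_cmod)
        finally show "2*pi \<le> cmod (M y - L y - (M s - L s))" .
      qed auto
    qed auto
    then obtain c where "\<And>s. s \<in> {0..1} \<Longrightarrow> M s - L s = c" by (auto simp: constant_on_def)
    from this[of 0] this[of 1] have "M 0 - L 0 = M 1 - L 1" by simp
    then show ?thesis by (simp add: algebra_simps)
  qed
  show ?thesis
    unfolding log_change_def
    by (rule some_equality) (use L uniq in \<open>blast+\<close>)
qed

lemma obtain_log:
  fixes g :: "real \<Rightarrow> complex"
  assumes "continuous_on {0..1} g" "\<And>s. s \<in> {0..1} \<Longrightarrow> g s \<noteq> 0"
  obtains L where "continuous_on {0..1} L" "\<And>s. s \<in> {0..1} \<Longrightarrow> g s = exp (L s)"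
  by (rule continuous_logarithm_on_contractible[of "{0..1}" g])
     (use assms convex_imp_contractible[of "{0..1::real}"] in auto)

lemma exp_log_change:
  assumes "continuous_on {0..1} g" "\<And>s. s \<in> {0..1} \<Longrightarrow> g s \<noteq> 0"
  shows "exp (log_change g) = g 1 / g 0"
proof -
  obtain L where L: "continuous_on {0..1} L" "\<And>s. s \<in> {0..1} \<Longrightarrow> g s = exp (L s)"
    using obtain_log assms by metis
  then show ?thesis using log_change_eqI[OF L] by (simp add: exp_diff)
qed

lemma log_change_mult_exp:
  assumes g: "continuous_on {0..1} g" "\<And>s. s \<in> {0..1} \<Longrightarrow> g s \<noteq> 0"
    and h: "continuous_on {0..1} h" "\<And>s. s \<in> {0..1} \<Longrightarrow> g' s = c * exp (h s) * g s" "c \<noteq> 0"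
  shows "log_change g' = log_change g + h 1 - h 0"
proof -
  obtain L where L: "continuous_on {0..1} L" "\<And>s. s \<in> {0..1} \<Longrightarrow> g s = exp (L s)"
    using obtain_log g by metis
  have "log_change g' = (Ln c + h 1 + L 1) - (Ln c + h 0 + L 0)"
    by (rule log_change_eqI) (use L h in \<open>auto intro!: continuous_intros simp: exp_add\<close>)
  then show ?thesis using log_change_eqI[OF L] by simp
qed

text \<open>The square is contractible, so one logarithm serves all four sides, and both sides of
  the equation are its change from the corner (0,0) to the corner (1,1).\<close>

lemma log_change_square:
  fixes F :: "real \<Rightarrow> real \<Rightarrow> complex"
  assumes "continuous_on ({0..1} \<times> {0..1}) (\<lambda>(s,t). F s t)"
    and "\<And>s t. s \<in> {0..1} \<Longrightarrow> t \<in> {0..1} \<Longrightarrow> F s t \<noteq> 0"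
  shows "log_change (\<lambda>s. F s 0) + log_change (F 1) = log_change (F 0) + log_change (\<lambda>s. F s 1)"
proof -
  have "convex ({0..1::real} \<times> {0..1::real})" by (intro convex_Times) auto
  then obtain L where L: "continuous_on ({0..1::real} \<times> {0..1}) L"
      "\<And>x. x \<in> {0..1} \<times> {0..1} \<Longrightarrow> (case x of (s,t) \<Rightarrow> F s t) = exp (L x)"
    by (rule continuous_logarithm_on_contractible[OF assms(1) convex_imp_contractible]) (use assms(2) in
      auto)
  have *: "continuous_on {0..1} (\<lambda>s. L (s, c))" "continuous_on {0..1} (\<lambda>s. L (c, s))"
    if "c \<in> {0..1}" for c
    by (rule continuous_on_compose2[OF L(1)], use that in \<open>auto intro!: continuous_intros\<close>)+
  have "log_change (\<lambda>s. F s 0) = L (1,0) - L (0,0)" "log_change (\<lambda>s. F s 1) = L (1,1) - L (0,1)"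
    "log_change (F 0) = L (0,1) - L (0,0)" "log_change (F 1) = L (1,1) - L (1,0)"
    by (rule log_change_eqI; use * L(2) in auto)+
  then show ?thesis by simp
qed

section \<open>A quasi-periodic function that vanishes exactly on the integer lattice\<close>

abbreviation int_lattice :: "complex set" where "int_lattice \<equiv> {z. Re z \<in> \<int> \<and> Im z \<in> \<int>}"

text \<open>An elementary substitute for the theta function of the square lattice: odd, with zeros exactly at
  the lattice points, and multiplied by \<open>- exp (2 \<pi> \<i> y)\<close> when \<open>x\<close> grows by 1.\<close>

definition qp_strip :: "complex \<Rightarrow> complex" where
  "qp_strip z = Complex (2 * Re z * cos (pi * Im z)) (sin (pi * Im z))"

definition qp :: "complex \<Rightarrow> complex" where
  "qp z = (let n = real_of_int (round (Re z)) in cis (pi * n + 2 * pi * n * Im z) * qp_strip (z -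
    of_real n))"

text \<open>The gluing condition between neighbouring strips. On the lines with real part
  \<open>1/2\<close> and \<open>-1/2\<close> the values run on the unit circle, as
  \<open>cis (pi * y)\<close> and \<open>- cis (- (pi * y))\<close>, and their quotient is the
  factor of \<open>qp\<close> for a unit step.\<close>

lemma qp_strip_edge:
  assumes "Re z = 1/2"
  shows "qp_strip z = cis (pi + 2 * pi * Im z) * qp_strip (z - 1)"
proof -
  have a: "qp_strip z = cis (pi * Im z)" using assms by (simp add: qp_strip_def cis.ctr)
  have "qp_strip (z - 1) = - cis (- (pi * Im z))"
    using assms by (simp add: qp_strip_def complex_eq_iff left_diff_distrib)
  also have "\<dots> = cis (pi - pi * Im z)" by (simp add: complex_eq_iff sin_diff cos_diff)
  finally show ?thesis unfolding a by (simp add: cis_mult) (simp add: complex_eq_iff cos_add sin_add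
    cos_diff sin_diff algebra_simps)
qed

text \<open>At half-integers \<open>round\<close> decides for the upper neighbour; by
  \<open>qp_strip_edge\<close> the lower one gives the same value. This freedom is what the later
  proofs need.\<close>

lemma qp_eq:
  assumes "\<bar>Re z - of_int n\<bar> \<le> 1/2"
  shows "qp z = cis (pi * of_int n + 2 * pi * of_int n * Im z) * qp_strip (z - of_int n)"
proof (cases "n = round (Re z)")
  case True
  then show ?thesis by (simp add: qp_def Let_def)
next
  case False
  have "n = round (Re z) - 1 \<and> Re z - of_int n = 1/2"
    using assms False unfolding round_def by linarith
  then have r: "round (Re z) = n + 1" and h: "Re (z - of_int n) = 1/2" by auto
  have "cis (pi * of_int (n + 1) + 2 * pi * of_int (n + 1) * Im z) =
      cis (pi * of_int n + 2 * pi * of_int n * Im z) * cis (pi + 2 * pi * Im z)"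
    by (simp add: cis_mult algebra_simps)
  then show ?thesis
    using qp_strip_edge[OF h] by (simp add: qp_def Let_def r diff_diff_eq)
qed

lemma cis_pi_int: "cis (pi * of_int j) = (-1) powi j"
  using cis_power_int[of pi j] by (simp add: mult.commute)

lemma sin_pi_int [simp]: "sin (pi * of_int j) = 0"
  using arg_cong[OF cis_pi_int[of j], of Im] by (cases "even j") (simp_all add: power_int_minus_left)

lemma qp_strip_shift: "qp_strip (w + Complex 0 (of_int n)) = (-1) powi n * qp_strip w"
  unfolding cis_pi_int[symmetric]
  by (simp add: qp_strip_def complex_eq_iff cos_add sin_add distrib_left)

text \<open>A vertical period costs only a sign, a horizontal one also a phase linear in
  \<open>Im z\<close>. Along an edge with vertical displacement \<open>n\<close> this phase produces
  products of an \<open>m\<close> and an \<open>n\<close>, from which the intersection form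
  arises.\<close>

lemma qp_shift:
  "qp (z + Complex (of_int m) (of_int n)) = (-1) powi (m + n) * exp (2 * pi * \<i> * of_int m * Im z) * qp z"
proof -
  let ?k = "round (Re z)"
  have k: "\<bar>Re z - of_int ?k\<bar> \<le> 1/2" using of_int_round_abs_le[of "Re z"] by (simp add: abs_minus_commute)
  have e: "exp (2 * pi * \<i> * of_int m * Im z) = cis (2 * pi * of_int m * Im z)"
    by (simp add: cis_conv_exp algebra_simps)
  have "qp (z + Complex (of_int m) (of_int n)) =
     cis (pi * of_int (?k + m) + 2 * pi * of_int (?k + m) * (Im z + of_int n))
      * qp_strip (z - of_int ?k + Complex 0 (of_int n))"
    using k by (subst qp_eq[of _ "?k + m"]) (simp_all add: complex_eq_iff Complex_eq algebra_simps)
  also have "cis (pi * of_int (?k + m) + 2 * pi * of_int (?k + m) * (Im z + of_int n)) =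
     cis (pi * of_int m) * cis (2 * pi * of_int m * Im z) * cis (pi * of_int ?k + 2 * pi * of_int ?k * Im z)
     * cis (2 * pi * of_int ((?k + m) * n))"
    by (simp add: cis_mult algebra_simps)
  also have "cis (2 * pi * of_int ((?k + m) * n)) = 1"
    by (metis cis_multiple_2pi Ints_of_int)
  finally show ?thesis
    unfolding e using qp_eq[OF k] by (simp add: qp_strip_shift cis_pi_int power_int_add)
qed

lemma qp_uminus: "qp (- z) = - qp z"
proof -
  let ?k = "round (Re z)"
  have k: "\<bar>Re z - of_int ?k\<bar> \<le> 1/2" using of_int_round_abs_le[of "Re z"] by (simp add: abs_minus_commute)
  have s: "qp_strip (- w) = - qp_strip w" for w by (simp add: qp_strip_def complex_eq_iff)
  have c: "cis (- (pi * of_int ?k)) = cis (pi * of_int ?k)"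
    by (simp add: complex_eq_iff)
  have "qp (- z) = cis (- (pi * of_int ?k) + 2 * pi * of_int ?k * Im z) * qp_strip (- (z - of_int ?k))"
    using k by (subst qp_eq[of _ "- ?k"]) (simp_all add: abs_minus_commute)
  also have "\<dots> = - (cis (pi * of_int ?k + 2 * pi * of_int ?k * Im z) * qp_strip (z - of_int ?k))"
    unfolding s cis_mult[symmetric] c by simp
  also have "\<dots> = - qp z" using qp_eq[OF k] by simp
  finally show ?thesis .
qed

lemma qp_eq_0_iff: "qp z = 0 \<longleftrightarrow> z \<in> int_lattice"
proof -
  let ?k = "round (Re z)"
  have k: "\<bar>Re z - of_int ?k\<bar> \<le> 1/2" using of_int_round_abs_le[of "Re z"] by (simp add: abs_minus_commute)
  have "qp z = 0 \<longleftrightarrow> qp_strip (z - of_int ?k) = 0" by (simp add: qp_eq[OF k])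
  also have "\<dots> \<longleftrightarrow> Re z = of_int ?k \<and> sin (pi * Im z) = 0"
    using sin_zero_norm_cos_one[of "pi * Im z"] by (auto simp: qp_strip_def complex_eq_iff)
  also have "sin (pi * Im z) = 0 \<longleftrightarrow> Im z \<in> \<int>"
    by (auto simp: sin_zero_iff_int2 Ints_def)
  also have "Re z = of_int ?k \<longleftrightarrow> Re z \<in> \<int>"
    by (metis Ints_cases Ints_of_int round_of_int)
  finally show ?thesis by simp
qed

text \<open>Because of \<open>round\<close>, continuity is first shown on an open strip around
  \<open>0 \<le> Re z \<le> 1\<close>, which contains a single gluing line, and then carried to
  every point by \<open>qp_shift\<close>.\<close>

lemma isCont_qp: "isCont qp z"
proof -
  define f where "f z = (if Re z \<le> 1/2 then qp_strip z else cis (pi + 2 * pi * Im z) * qp_strip (z -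
    1))" for z
  define S where "S = {z. -1/2 < Re z \<and> Re z < 3/2}"
  have c: "continuous_on A qp_strip" for A
    unfolding qp_strip_def by (intro continuous_intros)
  have "continuous_on UNIV f"
    unfolding f_def
    by (rule continuous_on_cases_le)
       (auto intro!: continuous_intros continuous_on_compose2[OF c] simp: qp_strip_edge)
  moreover have "f z = qp z" if "z \<in> S" for z
    using that qp_eq[of z 0] qp_eq[of z 1] by (auto simp: f_def S_def abs_if split: if_splits)
  ultimately have "continuous_on S qp"
    by (metis (no_types, lifting) continuous_on_cong continuous_on_subset subset_UNIV)
  moreover have "open S"
    unfolding S_def by (intro open_Collect_conj open_halfspace_Re_gt open_halfspace_Re_lt)
  ultimately have ctS: "isCont qp w" if "w \<in> S" for w
    using that continuous_on_eq_continuous_at by blast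
  define m where "m = \<lfloor>Re z\<rfloor>"
  define w where "w = z - of_int m"
  have "isCont qp w" by (rule ctS) (simp add: S_def w_def m_def, linarith)
  then have "isCont (\<lambda>z. qp (z - of_int m)) z"
    unfolding w_def by (intro isCont_o2[of z "\<lambda>z. z - of_int m" qp]) (simp_all add: isCont_diff)
  moreover have "continuous_on UNIV (\<lambda>z. (-1) powi m * exp (2 * pi * \<i> * of_int m * Im (z - of_int m)))"
    by (intro continuous_intros)
  then have "isCont (\<lambda>z. (-1) powi m * exp (2 * pi * \<i> * of_int m * Im (z - of_int m))) z"
    using continuous_on_eq_continuous_at open_UNIV UNIV_I by blast
  ultimately have "isCont (\<lambda>z. (-1) powi m * exp (2 * pi * \<i> * of_int m * Im (z - of_int m)) * qp (z -
    of_int m)) z"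
    by (rule isCont_mult[rotated])
  moreover have "(-1) powi m * exp (2 * pi * \<i> * of_int m * Im (w - of_int m)) * qp (w - of_int m) = qp
    w" for w
  proof -
    have "w - of_int m + Complex (of_int m) (of_int 0) = w" by (simp add: complex_eq_iff)
    then show ?thesis using qp_shift[of "w - of_int m" m 0] by (simp only: add_0_right)
  qed
  ultimately show ?thesis by (simp only:)
qed

text \<open>The plane covers the torus with deck group \<open>int_lattice\<close>; \<open>\<gamma> e\<close> is a lift of the edge \<open>e\<close>, and
  \<open>(m e, n e)\<close> is its displacement relative to the lifts \<open>P\<close> of the vertices.\<close>

locale lifted_drawing =
  fixes V :: "'a set" and E :: "'a set set"
    and P :: "'a \<Rightarrow> complex" and \<gamma> :: "'a set \<Rightarrow> real \<Rightarrow> complex"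
    and src tgt :: "'a set \<Rightarrow> 'a" and m n :: "'a set \<Rightarrow> int"
  assumes ends: "e \<in> E \<Longrightarrow> e = {src e, tgt e}" "e \<in> E \<Longrightarrow> src e \<noteq> tgt e"
    and sub: "e \<in> E \<Longrightarrow> e \<subseteq> V"
    and cont: "e \<in> E \<Longrightarrow> continuous_on {0..1} (\<gamma> e)"
    and start: "e \<in> E \<Longrightarrow> \<gamma> e 0 = P (src e)"
    and finish: "e \<in> E \<Longrightarrow> \<gamma> e 1 = P (tgt e) + Complex (of_int (m e)) (of_int (n e))"
    and verts_apart: "u \<in> V \<Longrightarrow> v \<in> V \<Longrightarrow> u \<noteq> v \<Longrightarrow> P u - P v \<notin> int_lattice"
    and off_edge: "e \<in> E \<Longrightarrow> v \<in> V \<Longrightarrow> v \<notin> e \<Longrightarrow> s \<in> {0..1} \<Longrightarrow> \<gamma> e s - P v \<notin> int_lattice"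
    and edges_apart: "e \<in> E \<Longrightarrow> f \<in> E \<Longrightarrow> e \<inter> f = {} \<Longrightarrow> s \<in> {0..1} \<Longrightarrow> t \<in> {0..1}
        \<Longrightarrow> \<gamma> e s - \<gamma> f t \<notin> int_lattice"
begin

text \<open>An analogue, for an open path, of the winding number around all lifts of
  \<open>v\<close> at once, since \<open>qp\<close> vanishes at each of them.\<close>

definition turn :: "'a set \<Rightarrow> 'a \<Rightarrow> complex" where
  "turn e v = log_change (\<lambda>s. qp (\<gamma> e s - P v))"

lemma continuous_on_qp [continuous_intros]: "continuous_on S g \<Longrightarrow> continuous_on S (\<lambda>s. qp (g s))"
  using continuous_on_compose2[of UNIV qp S g] isCont_qp continuous_at_imp_continuous_on by blast

lemma ends_mem: "e \<in> E \<Longrightarrow> src e \<in> V" "e \<in> E \<Longrightarrow> tgt e \<in> V" "e \<in> E \<Longrightarrow> src e \<in> e" "e \<in> E \<Longrightarrow> tgt e \<in> e"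
  using ends(1) sub by blast+

text \<open>Passing to another lift of \<open>v\<close> multiplies \<open>qp\<close> by a constant
  and a phase linear in the imaginary part, so the correction is proportional to the vertical
  displacement of the edge. Exchanging the two arguments costs a sign only, \<open>qp\<close> being
  odd.\<close>

lemma log_change_from:
  assumes e: "e \<in> E" and v: "v \<in> V" "v \<notin> e"
  shows "log_change (\<lambda>s. qp (P v + Complex (of_int i) (of_int j) - \<gamma> e s)) =
      turn e v - 2 * pi * \<i> * of_int i * (Im (\<gamma> e 1) - Im (\<gamma> e 0))"
    and "log_change (\<lambda>s. qp (\<gamma> e s - (P v + Complex (of_int i) (of_int j)))) =
      turn e v - 2 * pi * \<i> * of_int i * (Im (\<gamma> e 1) - Im (\<gamma> e 0))"
proof -
  let ?h = "\<lambda>s. - (2 * pi * \<i> * of_int i * Im (\<gamma> e s - P v))"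
  have 1: "qp (P v + Complex (of_int i) (of_int j) - \<gamma> e s) = - ((-1) powi (i + j)) * exp (?h s) * qp (\<gamma>
    e s - P v)" for s
    using qp_shift[of "P v - \<gamma> e s" i j] qp_uminus[of "\<gamma> e s - P v"] by (simp add: algebra_simps)
  have 2: "qp (\<gamma> e s - (P v + Complex (of_int i) (of_int j))) = (-1) powi (- i - j) * exp (?h s) * qp (\<gamma>
    e s - P v)" for s
    using qp_shift[of "\<gamma> e s - P v" "- i" "- j"] by (simp add: algebra_simps complex_eq_iff Complex_eq)
  have c: "continuous_on {0..1} (\<lambda>s. qp (\<gamma> e s - P v))" "continuous_on {0..1} ?h"
    using cont[OF e] by (auto intro!: continuous_intros)
  have nz: "qp (\<gamma> e s - P v) \<noteq> 0" if "s \<in> {0..1}" for s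
    using off_edge[OF e v that] by (simp add: qp_eq_0_iff)
  show "log_change (\<lambda>s. qp (P v + Complex (of_int i) (of_int j) - \<gamma> e s)) =
      turn e v - 2 * pi * \<i> * of_int i * (Im (\<gamma> e 1) - Im (\<gamma> e 0))"
    by (subst log_change_mult_exp[OF c(1) nz c(2) 1])
       (auto simp: turn_def algebra_simps)
  show "log_change (\<lambda>s. qp (\<gamma> e s - (P v + Complex (of_int i) (of_int j)))) =
      turn e v - 2 * pi * \<i> * of_int i * (Im (\<gamma> e 1) - Im (\<gamma> e 0))"
    by (subst log_change_mult_exp[OF c(1) nz c(2) 2])
       (auto simp: turn_def algebra_simps)
qed

text \<open>On each side of the parameter square of \<open>qp (\<gamma> e s - \<gamma> f t)\<close>
  one edge rests at an end point, so the four changes of the logarithm are turns. Where it rests at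
  its target, the lift is displaced, which gives the correction terms.\<close>

lemma turn_square:
  assumes e: "e \<in> E" "f \<in> E" "e \<inter> f = {}"
  shows "turn e (src f) + turn f (tgt e) - 2 * pi * \<i> * of_int (m e) * (Im (\<gamma> f 1) - Im (\<gamma> f 0)) =
     turn f (src e) + turn e (tgt f) - 2 * pi * \<i> * of_int (m f) * (Im (\<gamma> e 1) - Im (\<gamma> e 0))"
proof -
  have c: "continuous_on ({0..1} \<times> {0..1}) (\<lambda>(s,t). qp (\<gamma> e s - \<gamma> f t))"
    unfolding case_prod_beta
    by (intro continuous_intros continuous_on_compose2[OF cont[OF e(1)], of _ fst]
        continuous_on_compose2[OF cont[OF e(2)], of _ snd]) auto
  have nz: "qp (\<gamma> e s - \<gamma> f t) \<noteq> 0" if "s \<in> {0..1}" "t \<in> {0..1}" for s t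
    using edges_apart[OF e that] by (simp add: qp_eq_0_iff)
  have notin: "src f \<notin> e" "tgt f \<notin> e" "src e \<notin> f" "tgt e \<notin> f"
    using ends_mem e by blast+
  have z: "Complex 0 0 = 0" by (simp add: complex_eq_iff)
  show ?thesis
    using log_change_square[of "\<lambda>s t. qp (\<gamma> e s - \<gamma> f t)", OF c nz]
      log_change_from(1)[of f "tgt e" "m e" "n e"] log_change_from(2)[of e "tgt f" "m f" "n f"]
      log_change_from(1)[of f "src e" 0 0] log_change_from(2)[of e "src f" 0 0] e notin ends_mem
    by (simp add: start finish z add_diff_eq)
qed

text \<open>The principal branch is an arbitrary choice: another branch would only alter the
  integers of \<open>turn_eq\<close> and \<open>vlog_swap\<close>.\<close>

definition vlog :: "'a \<Rightarrow> 'a \<Rightarrow> complex" where "vlog u v = Ln (qp (P u - P v))"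

lemma exp_vlog: "u \<in> V \<Longrightarrow> v \<in> V \<Longrightarrow> u \<noteq> v \<Longrightarrow> exp (vlog u v) = qp (P u - P v)"
  using verts_apart[of u v] by (simp add: vlog_def qp_eq_0_iff)

text \<open>Both sides, without the term in \<open>N\<close>, have the same exponential: the
  quotient of the values of \<open>qp\<close> at the two ends, with \<open>qp_shift\<close>
  accounting for the displacement.\<close>

lemma turn_eq:
  assumes e: "e \<in> E" and v: "v \<in> V" "v \<notin> e"
  shows "\<exists>N::int. turn e v = vlog (tgt e) v - vlog (src e) v + pi * \<i> * of_int (m e + n e)
     + 2 * pi * \<i> * of_int (m e) * Im (P (tgt e) - P v) + 2 * pi * \<i> * of_int N"
proof -
  have c: "continuous_on {0..1} (\<lambda>s. qp (\<gamma> e s - P v))"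
    using cont[OF e] by (auto intro!: continuous_intros)
  have nz: "qp (\<gamma> e s - P v) \<noteq> 0" if "s \<in> {0..1}" for s
    using off_edge[OF e v that] by (simp add: qp_eq_0_iff)
  have "exp (turn e v) = qp (P (tgt e) - P v + Complex (of_int (m e)) (of_int (n e))) / qp (P (src e) -
    P v)"
    using exp_log_change[OF c nz] by (simp add: turn_def start finish e algebra_simps)
  also have "\<dots> = exp (vlog (tgt e) v - vlog (src e) v + pi * \<i> * of_int (m e + n e)
     + 2 * pi * \<i> * of_int (m e) * Im (P (tgt e) - P v))"
  proof -
    have "(-1) powi (m e + n e) = exp (pi * \<i> * of_int (m e + n e))"
      unfolding cis_pi_int[symmetric] by (simp add: cis_conv_exp algebra_simps)
    then show ?thesis
      using e v ends_mem[OF e] unfolding qp_shift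
      by (subst exp_vlog[symmetric], auto)+ (simp add: exp_add exp_diff algebra_simps)
  qed
  finally show ?thesis
    unfolding exp_eq by (auto simp: algebra_simps)
qed

text \<open>Oddness of \<open>qp\<close> makes the two exponentials opposite, so the logarithms
  differ by an odd multiple of \<open>pi * \<i>\<close>. This is where the asymmetry of
  \<open>\<delta>\<close> comes from.\<close>

lemma vlog_swap:
  assumes "u \<in> V" "v \<in> V" "u \<noteq> v"
  shows "\<exists>d::int. vlog u v - vlog v u = pi * \<i> * (2 * of_int d - 1)"
proof -
  have "exp (vlog u v) = exp (vlog v u - pi * \<i>)"
    using exp_vlog[of u v] exp_vlog[of v u] assms qp_uminus[of "P v - P u"]
    by (simp add: exp_diff mult.commute)
  then obtain d :: int where "vlog u v = vlog v u - pi * \<i> + (2 * of_int d * pi) * \<i>"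
    unfolding exp_eq by auto
  then show ?thesis by (intro exI[of _ d]) (simp add: algebra_simps)
qed

text \<open>When \<open>turn_eq\<close> is inserted into \<open>turn_square\<close>, the positions
  of the vertices cancel and the logarithms leave only the integers of \<open>vlog_swap\<close>.
  Division by \<open>2 * pi * \<i>\<close> gives an identity of integers, read modulo 2. As
  \<open>\<delta>\<close> involves no edges and \<open>N\<close> only one edge and one vertex, both
  disappear from sums in which they occur evenly often.\<close>

theorem intersection_parity:
  obtains \<delta> :: "'a \<Rightarrow> 'a \<Rightarrow> bit" and N :: "'a set \<Rightarrow> 'a \<Rightarrow> bit"
  where "\<And>u v. u \<in> V \<Longrightarrow> v \<in> V \<Longrightarrow> u \<noteq> v \<Longrightarrow> \<delta> v u = 1 + \<delta> u v"
    and "\<And>a b c d. {a,b} \<in> E \<Longrightarrow> {c,d} \<in> E \<Longrightarrow> {a,b} \<inter> {c,d} = {} \<Longrightarrow>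
      \<delta> a c + \<delta> a d + \<delta> b c + \<delta> b d + N {a,b} c + N {a,b} d + N {c,d} a + N {c,d} b
      + of_int (m {a,b} * n {c,d} + n {a,b} * m {c,d}) = 0"
proof -
  define N where "N e v = (SOME N::int. turn e v = vlog (tgt e) v - vlog (src e) v + pi * \<i> * of_int (m
    e + n e)
     + 2 * pi * \<i> * of_int (m e) * Im (P (tgt e) - P v) + 2 * pi * \<i> * of_int N)" for e v
  have N: "turn e v = vlog (tgt e) v - vlog (src e) v + pi * \<i> * of_int (m e + n e)
     + 2 * pi * \<i> * of_int (m e) * Im (P (tgt e) - P v) + 2 * pi * \<i> * of_int (N e v)"
    if "e \<in> E" "v \<in> V" "v \<notin> e" for e v
    unfolding N_def by (rule someI_ex) (rule turn_eq[OF that])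
  define D where "D u v = (SOME d::int. vlog u v - vlog v u = pi * \<i> * (2 * of_int d - 1))" for u v
  have D: "vlog u v - vlog v u = pi * \<i> * (2 * of_int (D u v) - 1)"
    if "u \<in> V" "v \<in> V" "u \<noteq> v" for u v
    unfolding D_def by (rule someI_ex) (rule vlog_swap[OF that])
  have D': "D v u = 1 - D u v" if "u \<in> V" "v \<in> V" "u \<noteq> v" for u v
  proof -
    have "pi * \<i> * (2 * of_int (D u v) - 1) = - (pi * \<i> * (2 * of_int (D v u) - 1))"
      using D[of u v] D[of v u] that by (metis minus_diff_eq)
    then have "pi * \<i> * (2 * of_int (D u v) - 1) = pi * \<i> * (- (2 * of_int (D v u) - 1))"
      by (simp only: mult_minus_right)
    then have "2 * complex_of_int (D u v) - 1 = - (2 * of_int (D v u) - 1)"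
      by (subst (asm) mult_left_cancel) simp_all
    then have "complex_of_int (2 * D u v + 2 * D v u) = of_int 2"
      by (simp add: algebra_simps)
    then have "2 * D u v + 2 * D v u = 2" unfolding of_int_eq_iff .
    then show ?thesis by simp
  qed
  have main: "D (tgt e) (src f) - D (src e) (src f) - D (tgt e) (tgt f) + D (src e) (tgt f)
      + N e (src f) - N e (tgt f) + N f (tgt e) - N f (src e) + m f * n e - m e * n f = 0" (is "?X = 0")
    if e: "e \<in> E" "f \<in> E" "e \<inter> f = {}" for e f
  proof -
    have notin: "src f \<notin> e" "tgt f \<notin> e" "src e \<notin> f" "tgt e \<notin> f"
      using ends_mem(3,4)[OF e(1)] ends_mem(3,4)[OF e(2)] e(3) by auto
    then have ne: "src f \<noteq> src e" "tgt f \<noteq> src e" "src f \<noteq> tgt e" "tgt f \<noteq> tgt e"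
      using ends_mem(3,4)[OF e(1)] by auto
    note V = ends_mem(1,2)[OF e(1)] ends_mem(1,2)[OF e(2)]
    have im: "Im (\<gamma> g 1) = Im (P (tgt g)) + of_int (n g)" "Im (\<gamma> g 0) = Im (P (src g))" if "g \<in> E" for g
      using start finish that by auto
    have D'': "vlog u v = vlog v u + pi * \<i> * (2 * of_int (D u v) - 1)" if "u \<in> V" "v \<in> V" "u \<noteq> v" for u v
      using D[OF that] by (simp add: algebra_simps)
    note T = turn_square[OF e]
    note T = T[unfolded N[OF e(1) V(3) notin(1)] N[OF e(1) V(4) notin(2)] N[OF e(2) V(1) notin(3)]
        N[OF e(2) V(2) notin(4)] im[OF e(1)] im[OF e(2)]
        D''[OF V(1) V(3) ne(1)[symmetric]] D''[OF V(1) V(4) ne(2)[symmetric]]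
        D''[OF V(2) V(3) ne(3)[symmetric]] D''[OF V(2) V(4) ne(4)[symmetric]]]
    have "2 * pi * \<i> * of_int ?X = 0"
      using T by (simp add: algebra_simps)
    moreover have "x = 0" if "2 * pi * \<i> * of_int x = 0" for x :: int using that by simp
    ultimately show ?thesis by blast
  qed
  show thesis
  proof (rule that[of "\<lambda>u v. of_int (D u v)" "\<lambda>e v. of_int (N e v)"])
    fix u v assume "u \<in> V" "v \<in> V" "u \<noteq> v"
    then show "of_int (D v u) = 1 + (of_int (D u v) :: bit)" by (simp add: D'[of u v])
  next
    fix a b c d assume *: "{a,b} \<in> E" "{c,d} \<in> E" "{a,b} \<inter> {c,d} = {}"
    let ?e = "{a,b}" and ?f = "{c,d}"
    have "of_int (D (tgt ?e) (src ?f) - D (src ?e) (src ?f) - D (tgt ?e) (tgt ?f) + D (src ?e) (tgt ?f)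
      + N ?e (src ?f) - N ?e (tgt ?f) + N ?f (tgt ?e) - N ?f (src ?e) + m ?f * n ?e - m ?e * n ?f) =
        (0::bit)"
      using arg_cong[OF main[OF *], of of_int] by (simp only: of_int_0)
    \<comment> \<open>Modulo 2 the identity is symmetric in the ends of each edge, so all
      orientations lead to the same relation.\<close>
    moreover have "src ?e = a \<and> tgt ?e = b \<or> src ?e = b \<and> tgt ?e = a"
      using ends[OF *(1)] by (metis doubleton_eq_iff)
    moreover have "src ?f = c \<and> tgt ?f = d \<or> src ?f = d \<and> tgt ?f = c"
      using ends[OF *(2)] by (metis doubleton_eq_iff)
    ultimately show "of_int (D a c) + of_int (D a d) + of_int (D b c) + of_int (D b d)
      + of_int (N ?e c) + of_int (N ?e d) + of_int (N ?f a) + of_int (N ?f b)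
      + of_int (m ?e * n ?f + n ?e * m ?f) = (0::bit)"
      by (elim disjE conjE)
         (simp_all only: of_int_add of_int_diff of_int_mult minus_bit_def ac_simps)
  qed
qed

end

section \<open>Sums over pairs of disjoint edges modulo 2\<close>

lemma bit_add_self': "x + x = (0::bit)"
  by (cases x) simp_all

lemma bit_add_left_self: "x + (x + y) = (y::bit)"
  by (cases x; cases y) simp_all

lemmas bit_sum_simps = add.assoc add.commute add.left_commute bit_add_self' bit_add_left_self add_0_left
  add_0_right

definition matchings :: "('a set \<Rightarrow> 'a set \<Rightarrow> bit) \<Rightarrow> 'a \<Rightarrow> 'a \<Rightarrow> 'a \<Rightarrow> 'a \<Rightarrow> bit" where
  "matchings \<omega> a b c d = \<omega> {a,b} {c,d} + \<omega> {a,c} {b,d} + \<omega> {a,d} {b,c}"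

text \<open>The sum over the 15 pairs of disjoint edges of \<open>K\<^sub>5\<close>.\<close>

definition pfaffian5 :: "('a set \<Rightarrow> 'a set \<Rightarrow> bit) \<Rightarrow> 'a \<Rightarrow> 'a \<Rightarrow> 'a \<Rightarrow> 'a \<Rightarrow> 'a \<Rightarrow> bit" where
  "pfaffian5 \<omega> a b c d e = matchings \<omega> b c d e + matchings \<omega> a c d e + matchings \<omega> a b d e
     + matchings \<omega> a b c e + matchings \<omega> a b c d"

lemma bit_third: "x + y + z = (0::bit) \<Longrightarrow> z = x + y"
  by (cases x; cases y; cases z) simp_all

text \<open>The edges of a \<open>K\<^sub>5\<close> disjoint from a given edge form a triangle. So
  each value of \<open>p\<close> is multiplied by the sum of \<open>g\<close> over a triangle. The
  calculation expresses \<open>g\<close> by its values on the edges at \<open>a\<close>.\<close>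

lemma pfaffian5_eq_0:
  assumes "\<And>x y z. distinct [x,y,z] \<Longrightarrow> {x,y,z} \<subseteq> {a,b,c,d,e} \<Longrightarrow> g {x,y} + g {x,z} + g {y,z} = 0"
    and "distinct [a,b,c,d,e]"
  shows "pfaffian5 (\<lambda>e f. p e * g f + g e * p f) a b c d e = 0"
proof -
  have "g {b,c} = g {a,b} + g {a,c}" "g {b,d} = g {a,b} + g {a,d}" "g {b,e} = g {a,b} + g {a,e}" "g
    {c,d} = g {a,c} + g {a,d}" "g {c,e} = g {a,c} + g {a,e}" "g {d,e} = g {a,d} + g {a,e}"
    by (rule bit_third[OF assms(1)]; use assms(2) in simp)+
  then show ?thesis
    unfolding pfaffian5_def matchings_def
    by (simp only: distrib_left distrib_right mult.commute[of "p _"] bit_sum_simps)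
qed

text \<open>An edge at the fifth vertex is paired with the three edges of a triangle among the other
  four, where both \<open>p\<close> and \<open>g\<close> sum to zero. In the matchings of the four
  vertices themselves both functions are coboundaries, and each product of potentials occurs twice.
  Nothing is asked of the edges at \<open>e\<close>.\<close>

lemma pfaffian5_eq_0':
  assumes "\<And>x y z. distinct [x,y,z] \<Longrightarrow> {x,y,z} \<subseteq> {a,b,c,d} \<Longrightarrow> g {x,y} + g {x,z} + g {y,z} = 0"
    and "\<And>x y z. distinct [x,y,z] \<Longrightarrow> {x,y,z} \<subseteq> {a,b,c,d} \<Longrightarrow> p {x,y} + p {x,z} + p {y,z} = 0"
    and "distinct [a,b,c,d]"
  shows "pfaffian5 (\<lambda>e f. p e * g f + g e * p f) a b c d e = 0"
proof -
  have "g {b,c} = g {a,b} + g {a,c}" "g {b,d} = g {a,b} + g {a,d}" "g {c,d} = g {a,c} + g {a,d}"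
    by (rule bit_third[OF assms(1)]; use assms(3) in simp)+
  moreover have "p {b,c} = p {a,b} + p {a,c}" "p {b,d} = p {a,b} + p {a,d}" "p {c,d} = p {a,c} + p {a,d}"
    by (rule bit_third[OF assms(2)]; use assms(3) in simp)+
  ultimately show ?thesis
    unfolding pfaffian5_def matchings_def
    by (simp only: distrib_left distrib_right mult.commute[of "p _"] bit_sum_simps)
qed

text \<open>What the combinatorial part keeps of a drawing; \<open>p\<close> and \<open>q\<close>
  are the coordinates of the class of an edge modulo 2.\<close>

locale parity_drawing =
  fixes V :: "'a set" and E :: "'a set set"
    and \<delta> :: "'a \<Rightarrow> 'a \<Rightarrow> bit" and N :: "'a set \<Rightarrow> 'a \<Rightarrow> bit" and p q :: "'a set \<Rightarrow> bit"
  assumes edge_sub: "e \<in> E \<Longrightarrow> e \<subseteq> V"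
    and delta: "u \<in> V \<Longrightarrow> v \<in> V \<Longrightarrow> u \<noteq> v \<Longrightarrow> \<delta> v u = 1 + \<delta> u v"
    and parity: "{a,b} \<in> E \<Longrightarrow> {c,d} \<in> E \<Longrightarrow> {a,b} \<inter> {c,d} = {} \<Longrightarrow>
      \<delta> a c + \<delta> a d + \<delta> b c + \<delta> b d + N {a,b} c + N {a,b} d + N {c,d} a + N {c,d} b
      + (p {a,b} * q {c,d} + q {a,b} * p {c,d}) = 0"
begin

definition clique :: "'a set \<Rightarrow> bool" where "clique A \<longleftrightarrow> (\<forall>u\<in>A. \<forall>v\<in>A. u \<noteq> v \<longrightarrow> {u,v} \<in> E)"

abbreviation "\<omega> \<equiv> \<lambda>e f. p e * q f + q e * p f"

text \<open>Each pair of the four vertices is separated by two of the three matchings. Its two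
  \<open>\<delta>\<close> terms have the same order for three pairs and opposite orders for the
  other three, which leaves \<open>1 + 1 + 1 = 1\<close>: the one crossing of a convex
  quadrilateral.\<close>

lemma matchings_sum:
  assumes "clique {x,y,z,w}" "distinct [x,y,z,w]"
  shows "matchings \<omega> x y z w = 1 + (N {x,y} z + N {x,y} w + N {x,z} y + N {x,z} w + N {x,w} y + N {x,w}
    z + N {y,z} x + N {y,z} w + N {y,w} x + N {y,w} z + N {z,w} x + N {z,w} y)"
proof -
  have *: "\<omega> {i,j} {k,l} = \<delta> i k + \<delta> i l + \<delta> j k + \<delta> j l + N {i,j} k + N {i,j} l + N {k,l} i + N {k,l} j"
    if "{i,j,k,l} \<subseteq> {x,y,z,w} \<and> distinct [i,j,k,l]" for i j k l
  proof -
    have "{i,j} \<in> E" "{k,l} \<in> E" using that assms(1) unfolding clique_def by auto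
    then have "(\<delta> i k + \<delta> i l + \<delta> j k + \<delta> j l + N {i,j} k + N {i,j} l + N {k,l} i + N {k,l} j) + \<omega> {i,j}
      {k,l} = 0"
      using that by (intro parity) auto
    then show ?thesis by (metis bit_add_left_self add_0_right)
  qed
  have c: "{x,y,z,w} \<subseteq> {x,y,z,w} \<and> distinct [x,y,z,w]" "{x,z,y,w} \<subseteq> {x,y,z,w} \<and> distinct [x,z,y,w]"
    "{x,w,y,z} \<subseteq> {x,y,z,w} \<and> distinct [x,w,y,z]"
    using assms(2) by auto
  have V: "{x,y,z,w} \<subseteq> V" using assms edge_sub unfolding clique_def by (auto; metis insert_subset)
  have d: "\<delta> z y = 1 + \<delta> y z" "\<delta> w y = 1 + \<delta> y w" "\<delta> w z = 1 + \<delta> z w"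
    by (rule delta; use V assms(2) in simp)+
  show ?thesis
    unfolding matchings_def *[OF c(1)] *[OF c(2)] *[OF c(3)] by (simp only: d bit_sum_simps)
qed

text \<open>The five quadruples contribute five ones, and \<open>N {x,y} z\<close> cancels because
  it occurs for the two quadruples that contain \<open>x\<close>, \<open>y\<close> and
  \<open>z\<close>.\<close>

lemma pfaffian5_clique:
  assumes "clique {a,b,c,d,e}" "distinct [a,b,c,d,e]"
  shows "pfaffian5 \<omega> a b c d e = 1"
proof -
  have K: "clique {b,c,d,e}" "clique {a,c,d,e}" "clique {a,b,d,e}" "clique {a,b,c,e}" "clique {a,b,c,d}"
    using assms(1) unfolding clique_def by blast+
  have D: "distinct [b,c,d,e]" "distinct [a,c,d,e]" "distinct [a,b,d,e]" "distinct [a,b,c,e]" "distinct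
    [a,b,c,d]"
    using assms(2) by simp_all
  show ?thesis
    unfolding pfaffian5_def matchings_sum[OF K(1) D(1)] matchings_sum[OF K(2) D(2)]
      matchings_sum[OF K(3) D(3)] matchings_sum[OF K(4) D(4)] matchings_sum[OF K(5) D(5)]
    by (simp only: bit_sum_simps)
qed

text \<open>Over the nine pairs of edges, \<open>\<delta> i k\<close> occurs four times, as two
  edges of each triangle pass through a vertex, and \<open>N {i,j} k\<close> twice. By bilinearity
  the sum is the form on the two triangle classes.\<close>

lemma triangles_orthogonal:
  assumes "clique {a,b,c}" "clique {x,y,z}" "distinct [a,b,c,x,y,z]"
  shows "(p {a,b} + p {a,c} + p {b,c}) * (q {x,y} + q {x,z} + q {y,z})
       + (q {a,b} + q {a,c} + q {b,c}) * (p {x,y} + p {x,z} + p {y,z}) = 0"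
proof -
  have *: "\<omega> {i,j} {k,l} = \<delta> i k + \<delta> i l + \<delta> j k + \<delta> j l + N {i,j} k + N {i,j} l + N {k,l} i + N {k,l} j"
    if "{i,j} \<subseteq> {a,b,c}" "{k,l} \<subseteq> {x,y,z}" "i \<noteq> j" "k \<noteq> l" for i j k l
  proof -
    have "{i,j} \<in> E" "{k,l} \<in> E" using that assms unfolding clique_def by auto
    then have "(\<delta> i k + \<delta> i l + \<delta> j k + \<delta> j l + N {i,j} k + N {i,j} l + N {k,l} i + N {k,l} j) + \<omega> {i,j}
      {k,l} = 0"
      using that assms(3) by (intro parity) auto
    then show ?thesis by (metis bit_add_left_self add_0_right)
  qed
  have "\<omega> {a,b} {x,y} + \<omega> {a,b} {x,z} + \<omega> {a,b} {y,z} + \<omega> {a,c} {x,y} + \<omega> {a,c} {x,z} + \<omega> {a,c} {y,z} +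
    \<omega> {b,c} {x,y} + \<omega> {b,c} {x,z} + \<omega> {b,c} {y,z} = 0"
    by (subst *, (use assms(3) in simp; fail), (use assms(3) in simp; fail), (use assms(3) in simp;
      fail), (use assms(3) in simp; fail))+
       (simp only: bit_sum_simps)
  then show ?thesis
    by (simp only: distrib_left distrib_right bit_sum_simps)
qed

text \<open>If the class \<open>t\<close> of the triangle were nonzero, \<open>g = \<omega> t\<close> would vanish on all triangles of the
  \<open>K\<^sub>5\<close>, and expanding \<open>\<omega>\<close> in a symplectic basis containing \<open>t\<close> makes the sum over pairs of disjoint
  edges vanish as well.\<close>

lemma triangle_null:
  assumes K: "clique {a,b,c,d,e}" "distinct [a,b,c,d,e]"
    and T: "clique {x,y,z}" "distinct [x,y,z]" "{x,y,z} \<inter> {a,b,c,d,e} = {}"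
  shows "p {x,y} + p {x,z} + p {y,z} = 0 \<and> q {x,y} + q {x,z} + q {y,z} = 0"
proof (rule ccontr)
  assume nz: "\<not> ?thesis"
  have orth: "(p {x,y} + p {x,z} + p {y,z}) * (q {u,v} + q {u,w} + q {v,w})
       + (q {x,y} + q {x,z} + q {y,z}) * (p {u,v} + p {u,w} + p {v,w}) = 0"
    if "distinct [u,v,w]" "{u,v,w} \<subseteq> {a,b,c,d,e}" for u v w
    using that T K by (intro triangles_orthogonal) (auto simp: clique_def)
  consider "p {x,y} + p {x,z} + p {y,z} = 1" "q {x,y} + q {x,z} + q {y,z} = 0"
    | "p {x,y} + p {x,z} + p {y,z} = 0" "q {x,y} + q {x,z} + q {y,z} = 1"
    | "p {x,y} + p {x,z} + p {y,z} = 1" "q {x,y} + q {x,z} + q {y,z} = 1"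
    using nz by (meson bit_not_one_iff)
  then have "pfaffian5 \<omega> a b c d e = 0"
  proof cases
    case 1
    show ?thesis
      by (rule pfaffian5_eq_0) (use orth[unfolded 1] K(2) in \<open>simp_all only: mult_1 mult_zero_left
        add_0_right\<close>)
  next
    case 2
    have "pfaffian5 (\<lambda>e f. q e * p f + p e * q f) a b c d e = 0"
      by (rule pfaffian5_eq_0) (use orth[unfolded 2] K(2) in \<open>simp_all only: mult_1 mult_zero_left
        add_0_left\<close>)
    then show ?thesis by (simp only: add.commute)
  next
    case 3
    \<comment> \<open>Orthogonality to the class (1,1) says that \<open>p + q\<close> vanishes on
      triangles, so the form is rewritten with \<open>p\<close> and \<open>p + q\<close>; the two
      products \<open>p e * p f\<close> cancel.\<close>
    have "pfaffian5 (\<lambda>e f. p e * (p f + q f) + (p e + q e) * p f) a b c d e = 0"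
      by (rule pfaffian5_eq_0) (use orth[unfolded 3] K(2) in \<open>simp_all only: mult_1 bit_sum_simps\<close>)
    moreover have "p e * (p f + q f) + (p e + q e) * p f = \<omega> e f" for e f
      by (simp only: distrib_left distrib_right bit_sum_simps)
    ultimately show ?thesis by simp
  qed
  then show False using pfaffian5_clique[OF K] by simp
qed

text \<open>All triangles in \<open>A\<close> are null, so \<open>p\<close> and \<open>q\<close> are
  coboundaries on \<open>A\<close>, and \<open>pfaffian5_eq_0'\<close> makes the sum over
  \<open>insert v A\<close> zero whatever the edges at \<open>v\<close> do; but the sum over a
  clique is 1.\<close>

theorem parity_obstruction:
  assumes A: "clique (insert v A)" "card A = 4" "v \<notin> A"
    and B: "\<And>T. T \<subseteq> A \<Longrightarrow> card T = 3 \<Longrightarrow> \<exists>B. clique B \<and> card B = 5 \<and> B \<inter> T = {}"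
  shows False
proof -
  have null: "p {x,y} + p {x,z} + p {y,z} = 0 \<and> q {x,y} + q {x,z} + q {y,z} = 0"
    if T: "distinct [x,y,z]" "{x,y,z} \<subseteq> A" for x y z
  proof -
    obtain B where B': "clique B" "card B = 5" "B \<inter> {x,y,z} = {}" using B[of "{x,y,z}"] T by auto
    obtain xs where "set xs = B" "distinct xs" "length xs = 5"
      using B'(2) by (metis card.infinite distinct_card finite_distinct_list zero_neq_numeral)
    then obtain a b c d e where "B = {a,b,c,d,e}" "distinct [a,b,c,d,e]"
      by (auto simp: numeral_eq_Suc length_Suc_conv)
    with B' T A(1) show ?thesis
      by (intro triangle_null[of a b c d e]) (auto simp: clique_def)
  qed
  obtain xs where "set xs = A" "distinct xs" "length xs = 4"
    using A(2) by (metis card.infinite distinct_card finite_distinct_list zero_neq_numeral)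
  then obtain a b c d where abcd: "A = {a,b,c,d}" "distinct [a,b,c,d]"
    by (auto simp: numeral_eq_Suc length_Suc_conv)
  have "pfaffian5 \<omega> a b c d v = 0"
    by (rule pfaffian5_eq_0') (use null abcd in blast)+
  moreover have "pfaffian5 \<omega> a b c d v = 1"
    using A abcd by (intro pfaffian5_clique) (auto simp: insert_commute)
  ultimately show False by simp
qed

end

section \<open>Drawings on surfaces\<close>

locale drawing =
  fixes V :: "'a set" and E :: "'a set set" and S :: "'b::topological_space set"
    and p :: "'a \<Rightarrow> 'b" and c :: "'a set \<Rightarrow> real \<Rightarrow> 'b"
  assumes inj: "inj_on p V" and p_in: "p ` V \<subseteq> S"
    and arc: "e \<in> E \<Longrightarrow> arc (c e)" and c_in: "e \<in> E \<Longrightarrow> path_image (c e) \<subseteq> S"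
    and c_ends: "e \<in> E \<Longrightarrow> {pathstart (c e), pathfinish (c e)} = p ` e"
    and c_verts: "e \<in> E \<Longrightarrow> path_image (c e) \<inter> p ` V \<subseteq> p ` e"
    and c_meet: "e \<in> E \<Longrightarrow> f \<in> E \<Longrightarrow> e \<noteq> f \<Longrightarrow> path_image (c e) \<inter> path_image (c f) \<subseteq> p ` (e \<inter> f)"

lemma (in drawing) embeds_in: "embeds_in (V, E) S"
  unfolding embeds_in_def fst_conv snd_conv
  by (intro exI[of _ p] exI[of _ c] conjI ballI impI inj p_in arc c_in c_ends c_verts c_meet)

lemma embeds_in_drawing:
  assumes "embeds_in (V, E) S"
  obtains p c where "drawing V E S p c"
proof -
  obtain p c where "inj_on p V \<and> p ` V \<subseteq> S \<and>
       (\<forall>e\<in>E. arc (c e) \<and> path_image (c e) \<subseteq> S \<and>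
          {pathstart (c e), pathfinish (c e)} = p ` e \<and> path_image (c e) \<inter> p ` V \<subseteq> p ` e) \<and>
       (\<forall>e\<in>E. \<forall>f\<in>E. e \<noteq> f \<longrightarrow> path_image (c e) \<inter> path_image (c f) \<subseteq> p ` (e \<inter> f))"
    using assms unfolding embeds_in_def fst_conv snd_conv by (elim exE)
  then have "drawing V E S p c"
    by (elim conjE, intro drawing.intro) (assumption | drule (1) bspec, elim conjE, assumption | simp)+
  then show thesis by (rule that)
qed

lemma embeds_in_continuous_image:
  fixes f :: "'b::topological_space \<Rightarrow> 'c::topological_space"
  assumes G: "embeds_in G S" and f: "continuous_on S f" "inj_on f S" "f ` S \<subseteq> T"
  shows "embeds_in G T"
proof -
  obtain V E where VE: "G = (V, E)" by (cases G)
  then obtain p c where "drawing V E S p c" using G embeds_in_drawing by metis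
  then interpret drawing V E S p c .
  have sub: "f ` A \<inter> f ` B \<subseteq> f ` C" if "A \<subseteq> S" "B \<subseteq> S" "A \<inter> B \<subseteq> C" for A B C
    using inj_on_image_Int[OF f(2) that(1,2)] that(3) by auto
  have i: "(\<lambda>v. f (p v)) ` A = f ` (p ` A)" for A by auto
  have "drawing V E T (\<lambda>v. f (p v)) (\<lambda>e. f \<circ> c e)"
  proof
    show "inj_on (\<lambda>v. f (p v)) V"
      using inj p_in f(2) by (auto simp: inj_on_def image_subset_iff)
    show "(\<lambda>v. f (p v)) ` V \<subseteq> T" using p_in f(3) by auto
  next
    fix e assume e: "e \<in> E"
    have "path (f \<circ> c e)"
      using arc[OF e] c_in[OF e] f(1)
      by (intro path_continuous_image) (auto simp: arc_def intro: continuous_on_subset)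
    moreover have "inj_on (f \<circ> c e) {0..1}"
      using arc[OF e] c_in[OF e] f(2)
      by (auto simp: arc_def path_image_def intro!: comp_inj_on intro: inj_on_subset)
    ultimately show "arc (f \<circ> c e)" by (simp add: arc_def)
    show "path_image (f \<circ> c e) \<subseteq> T" using c_in[OF e] f(3) by (auto simp: path_image_compose)
    show "{pathstart (f \<circ> c e), pathfinish (f \<circ> c e)} = (\<lambda>v. f (p v)) ` e"
      unfolding i c_ends[OF e, symmetric] by (simp add: pathstart_compose pathfinish_compose)
    show "path_image (f \<circ> c e) \<inter> (\<lambda>v. f (p v)) ` V \<subseteq> (\<lambda>v. f (p v)) ` e"
      unfolding i path_image_compose by (rule sub[OF c_in[OF e] p_in c_verts[OF e]])
  next
    fix e e' assume e: "e \<in> E" "e' \<in> E" "e \<noteq> e'"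
    show "path_image (f \<circ> c e) \<inter> path_image (f \<circ> c e') \<subseteq> (\<lambda>v. f (p v)) ` (e \<inter> e')"
      unfolding i path_image_compose by (rule sub[OF c_in[OF e(1)] c_in[OF e(2)] c_meet[OF e]])
  qed
  then show ?thesis unfolding VE by (rule drawing.embeds_in)
qed

lemma embeds_in_subgraph:
  assumes H: "embeds_in (V', E') S" and edges: "\<And>e. e \<in> E \<Longrightarrow> e \<subseteq> V"
    and h: "inj_on h V" "h ` V \<subseteq> V'" "\<And>e. e \<in> E \<Longrightarrow> h ` e \<in> E'"
  shows "embeds_in (V, E) S"
proof -
  obtain p c where "drawing V' E' S p c" using embeds_in_drawing[OF H] by metis
  then interpret drawing V' E' S p c .
  have i: "(\<lambda>v. p (h v)) ` A = p ` (h ` A)" for A by auto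
  have "drawing V E S (\<lambda>v. p (h v)) (\<lambda>e. c (h ` e))"
  proof
    show "inj_on (\<lambda>v. p (h v)) V"
      using inj h by (auto simp: inj_on_def image_subset_iff)
    show "(\<lambda>v. p (h v)) ` V \<subseteq> S" using p_in h by auto
  next
    fix e assume e: "e \<in> E"
    note he = h(3)[OF e]
    show "arc (c (h ` e))" "path_image (c (h ` e)) \<subseteq> S"
      "{pathstart (c (h ` e)), pathfinish (c (h ` e))} = (\<lambda>v. p (h v)) ` e"
      unfolding i using arc[OF he] c_in[OF he] c_ends[OF he] by auto
    show "path_image (c (h ` e)) \<inter> (\<lambda>v. p (h v)) ` V \<subseteq> (\<lambda>v. p (h v)) ` e"
      unfolding i using c_verts[OF he] image_mono[OF h(2), of p] by blast
  next
    fix e e' assume e: "e \<in> E" "e' \<in> E" "e \<noteq> e'"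
    have "h ` e \<noteq> h ` e'" using inj_on_image_eq_iff[OF h(1) edges[OF e(1)] edges[OF e(2)]] e by simp
    then show "path_image (c (h ` e)) \<inter> path_image (c (h ` e')) \<subseteq> (\<lambda>v. p (h v)) ` (e \<inter> e')"
      unfolding i inj_on_image_Int[OF h(1) edges[OF e(1)] edges[OF e(2)]]
      using c_meet[OF h(3)[OF e(1)] h(3)[OF e(2)]] by simp
  qed
  then show ?thesis by (rule drawing.embeds_in)
qed

lemma (in drawing) oriented_edges:
  assumes E: "\<And>e. e \<in> E \<Longrightarrow> card e = 2"
  obtains src tgt where "\<And>e. e \<in> E \<Longrightarrow> e = {src e, tgt e}" "\<And>e. e \<in> E \<Longrightarrow> src e \<noteq> tgt e"
    "\<And>e. e \<in> E \<Longrightarrow> c e 0 = p (src e)" "\<And>e. e \<in> E \<Longrightarrow> c e 1 = p (tgt e)"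
proof -
  have "\<exists>a b. e \<in> E \<longrightarrow> e = {a,b} \<and> a \<noteq> b \<and> c e 0 = p a \<and> c e 1 = p b" for e
  proof (cases "e \<in> E")
    case True
    then obtain a b where ab: "e = {a,b}" "a \<noteq> b" using E by (meson card_2_iff)
    then have "{c e 0, c e 1} = {p a, p b}"
      using c_ends[OF True] by (auto simp: pathstart_def pathfinish_def)
    then show ?thesis using ab by (auto simp: doubleton_eq_iff)
  qed auto
  then obtain src tgt where "\<And>e. e \<in> E \<Longrightarrow> e = {src e, tgt e} \<and> src e \<noteq> tgt e \<and>
      c e 0 = p (src e) \<and> c e 1 = p (tgt e)" by metis
  then show thesis by (intro that[of src tgt]) blast+
qed

lemma (in drawing) on_edge: "s \<in> {0..1} \<Longrightarrow> c e s \<in> path_image (c e)"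
  by (auto simp: path_image_def)

section \<open>Lifting drawings to the plane\<close>

abbreviation unit_torus :: "(complex \<times> complex) set" where
  "unit_torus \<equiv> sphere 0 1 \<times> sphere 0 1"

definition torus_cover :: "complex \<Rightarrow> complex \<times> complex" where
  "torus_cover z = (cis (2 * pi * Re z), cis (2 * pi * Im z))"

lemma cis_2pi_eq_iff: "cis (2 * pi * x) = cis (2 * pi * y) \<longleftrightarrow> x - y \<in> \<int>"
proof -
  have "cis (2 * pi * x) = cis (2 * pi * y) \<longleftrightarrow> cis (2 * pi * (x - y)) = 1"
    by (simp add: right_diff_distrib flip: cis_divide)
  also have "\<dots> \<longleftrightarrow> x - y \<in> \<int>"
    unfolding cis_conv_exp exp_eq_1 by (auto simp: Ints_def)
  finally show ?thesis .
qed

lemma torus_cover_eq_iff: "torus_cover z = torus_cover w \<longleftrightarrow> z - w \<in> int_lattice"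
  by (simp add: torus_cover_def cis_2pi_eq_iff)

lemma circle_lift:
  fixes c :: "real \<Rightarrow> complex"
  assumes c: "continuous_on {0..1} c" "\<And>s. s \<in> {0..1} \<Longrightarrow> cmod (c s) = 1"
    and x: "cis (2 * pi * x) = c 0"
  obtains g where "continuous_on {0..1} g" "g 0 = x" "\<And>s. s \<in> {0..1} \<Longrightarrow> cis (2 * pi * g s) = c s"
proof -
  obtain L where L: "continuous_on {0..1} L" "\<And>s. s \<in> {0..1} \<Longrightarrow> c s = exp (L s)"
    by (rule obtain_log[of c]) (use c in force)+
  have cs: "c s = cis (Im (L s))" if "s \<in> {0..1}" for s
    using c(2)[OF that] L(2)[OF that] by (metis exp_eq_polar norm_exp_eq_Re of_real_1 mult_1)
  define g where "g s = (Im (L s) - Im (L 0)) / (2*pi) + x" for s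
  have "cis (2 * pi * g s) = c s" if s: "s \<in> {0..1}" for s
  proof -
    have "2 * pi * g s = Im (L s) - Im (L 0) + 2 * pi * x" by (simp add: g_def field_simps)
    then have "cis (2 * pi * g s) = cis (Im (L s)) / cis (Im (L 0)) * cis (2 * pi * x)"
      by (simp add: cis_mult cis_divide)
    then have "cis (2 * pi * g s) = c s / c 0 * cis (2 * pi * x)"
      using cs[OF s] cs[of 0] by simp
    then show ?thesis using x c(2)[of 0] by auto
  qed
  then show thesis
    by (intro that[of g]) (use L(1) in \<open>auto simp: g_def intro!: continuous_intros\<close>)
qed

lemma torus_lift:
  fixes c :: "real \<Rightarrow> complex \<times> complex"
  assumes c: "continuous_on {0..1} c" "c ` {0..1} \<subseteq> unit_torus" and z: "torus_cover z = c 0"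
  obtains g where "continuous_on {0..1} g" "g 0 = z" "\<And>s. s \<in> {0..1} \<Longrightarrow> torus_cover (g s) = c s"
proof -
  have n: "cmod (fst (c s)) = 1" "cmod (snd (c s)) = 1" if "s \<in> {0..1}" for s
    using c(2) that by (auto simp: image_subset_iff mem_Times_iff)
  have zz: "cis (2 * pi * Re z) = fst (c 0)" "cis (2 * pi * Im z) = snd (c 0)"
    using z by (auto simp: torus_cover_def prod_eq_iff)
  obtain g1 where g1: "continuous_on {0..1} g1" "g1 0 = Re z" "\<And>s. s \<in> {0..1} \<Longrightarrow> cis (2 * pi * g1 s) =
    fst (c s)"
    by (rule circle_lift[of "\<lambda>s. fst (c s)", OF _ n(1) zz(1)]) (use c(1) in \<open>auto intro: continuous_on_fst\<close>)
  obtain g2 where g2: "continuous_on {0..1} g2" "g2 0 = Im z" "\<And>s. s \<in> {0..1} \<Longrightarrow> cis (2 * pi * g2 s) =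
    snd (c s)"
    by (rule circle_lift[of "\<lambda>s. snd (c s)", OF _ n(2) zz(2)]) (use c(1) in \<open>auto intro: continuous_on_snd\<close>)
  show thesis
    by (rule that[of "\<lambda>s. Complex (g1 s) (g2 s)"])
       (use g1 g2 in \<open>auto simp: torus_cover_def prod_eq_iff complex_eq_iff intro!: continuous_on_Complex\<close>)
qed

lemma obtain_torus_cover:
  assumes "w \<in> unit_torus" obtains z where "torus_cover z = w"
proof -
  have "cis (2 * pi * (Arg u / (2 * pi))) = u" if "cmod u = 1" for u
    using that cis_Arg[of u] by (cases "u = 0") (auto simp: sgn_div_norm)
  then show thesis
    using assms by (intro that[of "Complex (Arg (fst w) / (2 * pi)) (Arg (snd w) / (2 * pi))"])
      (auto simp: torus_cover_def prod_eq_iff mem_Times_iff)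
qed

lemma (in lifted_drawing) parity_drawing:
  obtains \<delta> N where "parity_drawing V E \<delta> N (\<lambda>e. of_int (m e)) (\<lambda>e. of_int (n e))"
proof (rule intersection_parity)
  fix \<delta> :: "'a \<Rightarrow> 'a \<Rightarrow> bit" and N
  assume "\<And>u v. u \<in> V \<Longrightarrow> v \<in> V \<Longrightarrow> u \<noteq> v \<Longrightarrow> \<delta> v u = 1 + \<delta> u v"
    and "\<And>a b c d. {a,b} \<in> E \<Longrightarrow> {c,d} \<in> E \<Longrightarrow> {a,b} \<inter> {c,d} = {} \<Longrightarrow>
      \<delta> a c + \<delta> a d + \<delta> b c + \<delta> b d + N {a,b} c + N {a,b} d + N {c,d} a + N {c,d} b
      + of_int (m {a,b} * n {c,d} + n {a,b} * m {c,d}) = 0"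
  then show thesis
    by (intro that[of \<delta> N] parity_drawing.intro sub) (simp_all only: of_int_add of_int_mult)
qed

text \<open>Serves two situations: the torus, with \<open>U\<close> the whole plane and
  \<open>\<pi>\<close> the covering map, and the plane, with \<open>U\<close> a small disc and
  \<open>\<pi>\<close> the identity. The last premise turns disjointness below into disjointness
  modulo the lattice above.\<close>

lemma (in drawing) lift:
  assumes E: "\<And>e. e \<in> E \<Longrightarrow> e \<subseteq> V"
    and st: "\<And>e. e \<in> E \<Longrightarrow> e = {src e, tgt e}" "\<And>e. e \<in> E \<Longrightarrow> src e \<noteq> tgt e"
    and P: "\<And>v. v \<in> V \<Longrightarrow> P v \<in> U \<and> \<pi> (P v) = p v"
    and \<gamma>: "\<And>e. e \<in> E \<Longrightarrow> continuous_on {0..1} (\<gamma> e)" "\<And>e. e \<in> E \<Longrightarrow> \<gamma> e 0 = P (src e)"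
      "\<And>e. e \<in> E \<Longrightarrow> \<gamma> e 1 = P (tgt e) + Complex (of_int (m e)) (of_int (n e))"
      "\<And>e s. e \<in> E \<Longrightarrow> s \<in> {0..1} \<Longrightarrow> \<gamma> e s \<in> U \<and> \<pi> (\<gamma> e s) = c e s"
    and U: "\<And>z w. z \<in> U \<Longrightarrow> w \<in> U \<Longrightarrow> z - w \<in> int_lattice \<Longrightarrow> \<pi> z = \<pi> w"
  shows "lifted_drawing V E P \<gamma> src tgt m n"
proof
  fix e assume e: "e \<in> E"
  show "e = {src e, tgt e}" "src e \<noteq> tgt e" "e \<subseteq> V" "continuous_on {0..1} (\<gamma> e)" "\<gamma> e 0 = P (src e)"
    "\<gamma> e 1 = P (tgt e) + Complex (of_int (m e)) (of_int (n e))"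
    by (fact st(1)[OF e] st(2)[OF e] E[OF e] \<gamma>(1)[OF e] \<gamma>(2)[OF e] \<gamma>(3)[OF e])+
  show "\<gamma> e s - P v \<notin> int_lattice" if v: "v \<in> V" "v \<notin> e" and s: "s \<in> {0..1}" for v s
  proof
    assume "\<gamma> e s - P v \<in> int_lattice"
    then have "c e s = p v" using U[of "\<gamma> e s" "P v"] \<gamma>(4)[OF e s] P[OF v(1)] by simp
    then have "p v \<in> p ` e" using c_verts[OF e] v(1) on_edge[OF s, of e] by auto
    then show False using v inj E[OF e] by (meson inj_on_image_mem_iff)
  qed
  show "\<gamma> e s - \<gamma> f t \<notin> int_lattice"
    if f: "f \<in> E" "e \<inter> f = {}" and s: "s \<in> {0..1}" "t \<in> {0..1}" for f s t
  proof
    assume "\<gamma> e s - \<gamma> f t \<in> int_lattice"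
    then have "c e s = c f t" using U[of "\<gamma> e s" "\<gamma> f t"] \<gamma>(4)[OF e s(1)] \<gamma>(4)[OF f(1) s(2)] by simp
    moreover have "e \<noteq> f" using f st(1)[OF e] by auto
    ultimately show False
      using c_meet[OF e f(1)] f(2) on_edge[OF s(1), of e] on_edge[OF s(2), of f] by auto
  qed
next
  fix u v assume uv: "u \<in> V" "v \<in> V" "u \<noteq> v"
  then have "p u \<noteq> p v" using inj by (simp add: inj_on_eq_iff)
  then show "P u - P v \<notin> int_lattice" using U[of "P u" "P v"] P uv by auto
qed

lemma torus_parity_drawing:
  assumes emb: "embeds_in (V, E) unit_torus" and E: "\<And>e. e \<in> E \<Longrightarrow> e \<subseteq> V \<and> card e = 2"
  obtains \<delta> N p q where "parity_drawing V E \<delta> N p q"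
proof -
  obtain p c where "drawing V E unit_torus p c" using embeds_in_drawing[OF emb] by metis
  then interpret drawing V E unit_torus p c .
  have "\<exists>z. v \<in> V \<longrightarrow> torus_cover z = p v" for v
    using p_in obtain_torus_cover by (metis image_subset_iff)
  then obtain P where P: "\<And>v. v \<in> V \<Longrightarrow> torus_cover (P v) = p v" by metis
  obtain src tgt where st: "\<And>e. e \<in> E \<Longrightarrow> e = {src e, tgt e}" "\<And>e. e \<in> E \<Longrightarrow> src e \<noteq> tgt e"
    "\<And>e. e \<in> E \<Longrightarrow> c e 0 = p (src e)" "\<And>e. e \<in> E \<Longrightarrow> c e 1 = p (tgt e)"
    by (rule oriented_edges) (use E in auto)
  have stV: "src e \<in> V" "tgt e \<in> V" if "e \<in> E" for e using st(1)[OF that] E[OF that] by auto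
  have "\<exists>g. continuous_on {0..1} g \<and> g 0 = P (src e) \<and> (\<forall>s\<in>{0..1}. torus_cover (g s) = c e s)"
    if e: "e \<in> E" for e
  proof -
    have "continuous_on {0..1} (c e)" "c e ` {0..1} \<subseteq> unit_torus"
      using arc[OF e] c_in[OF e] by (simp_all add: arc_def path_def path_image_def)
    moreover have "torus_cover (P (src e)) = c e 0" using P stV(1)[OF e] st(3)[OF e] by simp
    ultimately show ?thesis by (rule torus_lift) blast
  qed
  then obtain \<gamma> where \<gamma>: "\<And>e. e \<in> E \<Longrightarrow> continuous_on {0..1} (\<gamma> e) \<and> \<gamma> e 0 = P (src e) \<and>
      (\<forall>s\<in>{0..1}. torus_cover (\<gamma> e s) = c e s)" by metis
  have "\<exists>m n. \<gamma> e 1 = P (tgt e) + Complex (of_int m) (of_int n)" if e: "e \<in> E" for e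
  proof -
    have "torus_cover (\<gamma> e 1) = torus_cover (P (tgt e))"
      using \<gamma>[OF e] st(4)[OF e] P stV[OF e] by auto
    then obtain m n where "Re (\<gamma> e 1 - P (tgt e)) = of_int m" "Im (\<gamma> e 1 - P (tgt e)) = of_int n"
      unfolding torus_cover_eq_iff by (auto elim!: Ints_cases)
    then show ?thesis by (intro exI[of _ m] exI[of _ n]) (auto simp: complex_eq_iff)
  qed
  then obtain m n where mn: "\<And>e. e \<in> E \<Longrightarrow> \<gamma> e 1 = P (tgt e) + Complex (of_int (m e)) (of_int (n e))"
    by metis
  interpret lifted_drawing V E P \<gamma> src tgt m n
    by (rule lift[where U = UNIV and \<pi> = torus_cover])
       (use E st(1,2) P \<gamma> mn in \<open>simp_all only: UNIV_I torus_cover_eq_iff simp_thms\<close>)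
  show thesis by (rule parity_drawing) (rule that)
qed

definition complete_edges :: "'a set \<Rightarrow> 'a set set" where
  "complete_edges A = {{u,v} | u v. u \<in> A \<and> v \<in> A \<and> u \<noteq> v}"

lemma complete_edgesD: "e \<in> complete_edges A \<Longrightarrow> e \<subseteq> A \<and> card e = 2"
  by (auto simp: complete_edges_def)

theorem not_embeds_in_torus:
  assumes G: "\<And>e. e \<in> E \<Longrightarrow> e \<subseteq> V \<and> card e = 2"
    and A: "complete_edges (insert v A) \<subseteq> E" "card A = 4" "v \<notin> A"
    and B: "\<And>T. T \<subseteq> A \<Longrightarrow> card T = 3 \<Longrightarrow> \<exists>B. complete_edges B \<subseteq> E \<and> card B = 5 \<and> B \<inter> T = {}"
  shows "\<not> embeds_in (V, E) unit_torus"
proof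
  assume "embeds_in (V, E) unit_torus"
  then obtain \<delta> N p q where "parity_drawing V E \<delta> N p q"
    using torus_parity_drawing[OF _ G] by blast
  then interpret parity_drawing V E \<delta> N p q .
  have c: "clique B \<longleftrightarrow> complete_edges B \<subseteq> E" for B
    unfolding clique_def complete_edges_def by blast
  show False by (rule parity_obstruction[OF _ A(2,3)]) (unfold c, rule A(1), rule B)
qed

text \<open>Inside a disc of radius \<open>1/4\<close> distinct points never differ by a lattice
  vector, so a planar drawing shrunk into it is a lifted drawing with all displacements zero. The
  form is then zero, whereas its sum over \<open>K\<^sub>5\<close> has to be 1.\<close>

lemma K5_not_embeds_in_plane:
  assumes "card B = 5"
  shows "\<not> embeds_in (B, complete_edges B) (UNIV :: complex set)"
proof
  let ?E = "complete_edges B"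
  let ?D = "ball 0 (1/4) :: complex set"
  assume emb: "embeds_in (B, ?E) (UNIV :: complex set)"
  have "?D homeomorphic ball (0::complex) 1" by (rule homeomorphic_balls) auto
  then have "?D homeomorphic (UNIV :: complex set)"
    using homeomorphic_ball01_UNIV homeomorphic_trans by blast
  then obtain f g where fg: "homeomorphism (UNIV :: complex set) ?D f g"
    by (meson homeomorphic_def homeomorphic_sym)
  have "inj f" using fg unfolding homeomorphism_def by (metis UNIV_I inj_onI)
  then have "embeds_in (B, ?E) ?D"
    using fg by (intro embeds_in_continuous_image[OF emb, of f]) (auto simp: homeomorphism_def)
  then obtain p c where "drawing B ?E ?D p c" by (rule embeds_in_drawing)
  then interpret drawing B ?E ?D p c .
  obtain src tgt where st: "\<And>e. e \<in> ?E \<Longrightarrow> e = {src e, tgt e}" "\<And>e. e \<in> ?E \<Longrightarrow> src e \<noteq> tgt e"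
    "\<And>e. e \<in> ?E \<Longrightarrow> c e 0 = p (src e)" "\<And>e. e \<in> ?E \<Longrightarrow> c e 1 = p (tgt e)"
    by (rule oriented_edges) (use complete_edgesD in auto)
  have small: "z - w \<notin> int_lattice" if zw: "z \<in> ?D" "w \<in> ?D" "z \<noteq> w" for z w
  proof
    assume l: "z - w \<in> int_lattice"
    have "cmod (z - w) < 1" using zw norm_triangle_ineq4[of z w] by simp
    then have "\<bar>Re (z - w)\<bar> < 1" "\<bar>Im (z - w)\<bar> < 1"
      using abs_Re_le_cmod abs_Im_le_cmod by (meson le_less_trans)+
    then have "Re (z - w) = 0" "Im (z - w) = 0"
      using l by (auto elim!: Ints_cases simp flip: of_int_abs)
    then show False using zw by (simp add: complex_eq_iff)
  qed
  interpret lifted_drawing B ?E p c src tgt "\<lambda>_. 0" "\<lambda>_. 0"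
  proof (rule lift[where U = ?D and \<pi> = "\<lambda>z. z"])
    show "p v \<in> ?D \<and> p v = p v" if "v \<in> B" for v using p_in that by blast
    show "z = w" if "z \<in> ?D" "w \<in> ?D" "z - w \<in> int_lattice" for z w using small that by blast
    fix e assume e: "e \<in> ?E"
    show "e \<subseteq> B" using complete_edgesD[OF e] by blast
    show "e = {src e, tgt e}" "src e \<noteq> tgt e" "c e 0 = p (src e)" by (fact st(1)[OF e] st(2)[OF e]
      st(3)[OF e])+
    show "c e 1 = p (tgt e) + Complex (of_int 0) (of_int 0)" using st(4)[OF e] by (simp add: complex_eq_iff)
    show "continuous_on {0..1} (c e)" using arc[OF e] by (simp add: arc_def path_def)
    show "c e s \<in> ?D \<and> c e s = c e s" if "s \<in> {0..1}" for s using c_in[OF e] on_edge[OF that] by blast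
  qed
  obtain \<delta> N where "parity_drawing B ?E \<delta> N (\<lambda>e. of_int 0) (\<lambda>e. of_int 0)"
    by (rule parity_drawing)
  then interpret parity_drawing B ?E \<delta> N "\<lambda>e. of_int 0" "\<lambda>e. of_int 0" .
  obtain xs where "set xs = B" "distinct xs" "length xs = 5"
    using assms by (metis card.infinite distinct_card finite_distinct_list zero_neq_numeral)
  then obtain x y z u w where B: "B = {x,y,z,u,w}" "distinct [x,y,z,u,w]"
    by (auto simp: numeral_eq_Suc length_Suc_conv)
  have "clique B" by (simp add: clique_def) (auto simp: complete_edges_def)
  then have "pfaffian5 (\<lambda>e f. of_int 0 * of_int 0 + of_int 0 * of_int 0) x y z u w = 1"
    using B by (intro pfaffian5_clique) simp_all
  then show False by (simp add: pfaffian5_def matchings_def)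
qed

lemma punctured_sphere_homeomorphic_plane:
  assumes "a \<in> orientable_surface 0"
  shows "orientable_surface 0 - {a} homeomorphic (UNIV :: complex set)"
proof -
  let ?Q = "{0..1} \<times> {0..3} \<times> {0..1} :: (real \<times> real \<times> real) set"
  have Q: "handlebody 0 = ?Q" by (simp add: handlebody_def)
  have ne: "interior ?Q \<noteq> {}" by (simp add: interior_Times)
  have conv: "convex ?Q" by (intro convex_Times) auto
  have bd: "bounded ?Q" by (intro bounded_Times) auto
  have rf: "rel_frontier ?Q = orientable_surface 0"
    unfolding orientable_surface_def Q by (rule rel_frontier_nonempty_interior[OF ne])
  have "rel_frontier ?Q - {a} homeomorphic (UNIV :: complex set)"
  proof (rule homeomorphic_punctured_sphere_affine_gen[OF conv bd])
    show "a \<in> rel_frontier ?Q" using assms unfolding rf .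
    show "aff_dim ?Q = aff_dim (UNIV :: complex set) + 1"
      using aff_dim_nonempty_interior[OF ne] by simp
  qed auto
  then show ?thesis unfolding rf .
qed

text \<open>The vertex \<open>w\<close> provides a point that the drawing of the
  \<open>K\<^sub>5\<close> misses; the sphere punctured there is a plane.\<close>

theorem K5_not_embeds_in_sphere:
  assumes B: "complete_edges B \<subseteq> E" "card B = 5" "B \<subseteq> V" and w: "w \<in> V" "w \<notin> B"
  shows "\<not> embeds_in (V, E) (orientable_surface 0)"
proof
  assume "embeds_in (V, E) (orientable_surface 0)"
  then obtain p c where "drawing V E (orientable_surface 0) p c" by (rule embeds_in_drawing)
  then interpret drawing V E "orientable_surface 0" p c .
  have "drawing B (complete_edges B) (orientable_surface 0 - {p w}) p c"
  proof
    show "inj_on p B" using inj B(3) inj_on_subset by blast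
    show "p ` B \<subseteq> orientable_surface 0 - {p w}"
      using p_in B(3) inj_on_image_mem_iff[OF inj w(1) B(3)] w(2) by blast
  next
    fix e assume e: "e \<in> complete_edges B"
    have eE: "e \<in> E" and eB: "e \<subseteq> B" using e B complete_edgesD by blast+
    show "arc (c e)" "{pathstart (c e), pathfinish (c e)} = p ` e" by (fact arc[OF eE] c_ends[OF eE])+
    have "p w \<notin> p ` e" using w inj eB B(3) by (meson inj_on_image_mem_iff order_trans subsetD)
    then show "path_image (c e) \<subseteq> orientable_surface 0 - {p w}"
      using c_in[OF eE] c_verts[OF eE] w by blast
    show "path_image (c e) \<inter> p ` B \<subseteq> p ` e" using c_verts[OF eE] B(3) by blast
  next
    fix e f assume "e \<in> complete_edges B" "f \<in> complete_edges B" "e \<noteq> f"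
    then show "path_image (c e) \<inter> path_image (c f) \<subseteq> p ` (e \<inter> f)" using c_meet B(1) by blast
  qed
  then have emb: "embeds_in (B, complete_edges B) (orientable_surface 0 - {p w})"
    by (rule drawing.embeds_in)
  have "p w \<in> orientable_surface 0" using p_in w by blast
  then obtain f g where "homeomorphism (orientable_surface 0 - {p w}) (UNIV :: complex set) f g"
    using punctured_sphere_homeomorphic_plane unfolding homeomorphic_def by blast
  then have "embeds_in (B, complete_edges B) (UNIV :: complex set)"
    by (intro embeds_in_continuous_image[OF emb, of f]) (auto simp: homeomorphism_def intro!:
      inj_on_inverseI)
  then show False using K5_not_embeds_in_plane B(2) by blast
qed

section \<open>The surface of the drilled box as a product of two circles\<close>

definition max_norm :: "complex \<Rightarrow> real" where "max_norm u = max \<bar>Re u\<bar> \<bar>Im u\<bar>"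

lemma max_norm_nonneg: "0 \<le> max_norm u"
  by (simp add: max_norm_def)

lemma max_norm_eq_0_iff [simp]: "max_norm u = 0 \<longleftrightarrow> u = 0"
  by (auto simp: max_norm_def complex_eq_iff max_def)

lemma max_norm_0 [simp]: "max_norm 0 = 0"
  by simp

lemma max_norm_pos: "u \<noteq> 0 \<Longrightarrow> 0 < max_norm u"
  using max_norm_nonneg[of u] max_norm_eq_0_iff[of u] by linarith

lemma max_norm_scaleR: "max_norm (r *\<^sub>R u) = \<bar>r\<bar> * max_norm u"
  by (simp add: max_norm_def abs_mult max_mult_distrib_left)

lemma continuous_on_max_norm [continuous_intros]:
  "continuous_on S f \<Longrightarrow> continuous_on S (\<lambda>x. max_norm (f x))"
  unfolding max_norm_def by (intro continuous_intros)

text \<open>The analogue in the maximum norm of the equation of a torus of revolution, with centre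
  (3/2, 3/2, 1/2), core radius 1 and tube radius 1/2: both the core and the cross section are
  squares.\<close>

lemma orientable_surface_1_iff:
  "(x, y, z) \<in> orientable_surface 1 \<longleftrightarrow>
     max_norm (Complex (max_norm (Complex (x - 3/2) (y - 3/2)) - 1) (z - 1/2)) = 1/2"
proof -
  define r where "r = max_norm (Complex (x - 3/2) (y - 3/2))"
  have h: "handlebody 1 = {0..3} \<times> {0..3} \<times> {0..1} - {1<..<2} \<times> {1<..<2} \<times> UNIV"
    by (simp add: handlebody_def lessThan_Suc)
  have "open ({1<..<2} \<times> {1<..<2} \<times> UNIV :: (real \<times> real \<times> real) set)"
    by (intro open_Times) auto
  moreover have "closed ({0..3} \<times> {0..3} \<times> {0..1} :: (real \<times> real \<times> real) set)"
    by (intro closed_Times) auto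
  ultimately have "closed (handlebody 1)" unfolding h by (rule closed_Diff[rotated])
  then have "frontier (handlebody 1) = handlebody 1 - interior (handlebody 1)"
    by (simp add: frontier_def)
  also have "interior (handlebody 1) = {0<..<3} \<times> {0<..<3} \<times> {0<..<1} - {1..2} \<times> {1..2} \<times> UNIV"
    unfolding h by (simp add: interior_diff interior_Times closure_Times)
  finally have "orientable_surface 1 = ({0..3} \<times> {0..3} \<times> {0..1} - {1<..<2} \<times> {1<..<2} \<times> UNIV) -
      ({0<..<3} \<times> {0<..<3} \<times> {0<..<1} - {1..2} \<times> {1..2} \<times> UNIV)"
    unfolding orientable_surface_def h .
  then have "(x, y, z) \<in> orientable_surface 1 \<longleftrightarrow>
      ((x \<in> {0..3} \<and> y \<in> {0..3}) \<and> z \<in> {0..1} \<and> \<not> (x \<in> {1<..<2} \<and> y \<in> {1<..<2})) \<and>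
      \<not> ((x \<in> {0<..<3} \<and> y \<in> {0<..<3}) \<and> z \<in> {0<..<1} \<and> \<not> (x \<in> {1..2} \<and> y \<in> {1..2}))"
    by auto
  also have "x \<in> {0..3} \<and> y \<in> {0..3} \<longleftrightarrow> r \<le> 3/2"
    unfolding r_def max_norm_def complex.sel max.bounded_iff abs_le_iff by auto
  also have "x \<in> {1<..<2} \<and> y \<in> {1<..<2} \<longleftrightarrow> r < 1/2"
    unfolding r_def max_norm_def complex.sel max_less_iff_conj abs_less_iff by auto
  also have "x \<in> {0<..<3} \<and> y \<in> {0<..<3} \<longleftrightarrow> r < 3/2"
    unfolding r_def max_norm_def complex.sel max_less_iff_conj abs_less_iff by auto
  also have "x \<in> {1..2} \<and> y \<in> {1..2} \<longleftrightarrow> r \<le> 1/2"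
    unfolding r_def max_norm_def complex.sel max.bounded_iff abs_le_iff by auto
  also have "(r \<le> 3/2 \<and> z \<in> {0..1} \<and> \<not> r < 1/2) \<and> \<not> (r < 3/2 \<and> z \<in> {0<..<1} \<and> \<not> r \<le> 1/2) \<longleftrightarrow>
      max \<bar>r - 1\<bar> \<bar>z - 1/2\<bar> = 1/2"
    by (auto simp: max_def abs_if)
  finally show ?thesis unfolding r_def[symmetric] by (simp add: max_norm_def)
qed

definition to_square :: "complex \<Rightarrow> complex" where "to_square u = u /\<^sub>R max_norm u"

lemma max_norm_to_square [simp]: "u \<noteq> 0 \<Longrightarrow> max_norm (to_square u) = 1"
  using max_norm_pos[of u] by (simp add: to_square_def max_norm_scaleR)

lemma max_norm_scaleR_to_square: "max_norm q *\<^sub>R to_square q = q"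
  by (cases "q = 0") (simp_all add: to_square_def)

lemma to_square_sgn: "to_square (sgn q) = to_square q"
  using max_norm_pos[of q] by (cases "q = 0") (simp_all add: to_square_def sgn_div_norm max_norm_scaleR)

lemma to_square_inj: "inj_on to_square (sphere 0 1)"
proof (rule inj_onI)
  fix u v :: complex assume uv: "u \<in> sphere 0 1" "v \<in> sphere 0 1" and eq: "to_square u = to_square v"
  have "0 < max_norm u" "0 < max_norm v" using uv by (auto intro!: max_norm_pos)
  moreover have "norm (to_square u) = norm (to_square v)" using eq by simp
  ultimately have "max_norm u = max_norm v" using uv by (simp add: to_square_def)
  then show "u = v"
    using eq \<open>0 < max_norm u\<close> \<open>0 < max_norm v\<close> by (auto simp: to_square_def)
qed

text \<open>The usual parametrisation of a torus of revolution, with both circles projected radially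
  onto squares.\<close>

definition torus_map :: "complex \<times> complex \<Rightarrow> real \<times> real \<times> real" where
  "torus_map = (\<lambda>(u, w).
     let q = (1 + Re (to_square w) / 2) *\<^sub>R to_square u
     in (3/2 + Re q, 3/2 + Im q, 1/2 + Im (to_square w) / 2))"

lemma homeomorphic_unit_torus: "unit_torus homeomorphic orientable_surface 1"
proof (rule homeomorphic_compact[where f = torus_map])
  show "compact unit_torus" by (intro compact_Times compact_sphere)
  show "continuous_on unit_torus torus_map"
    unfolding torus_map_def to_square_def case_prod_beta Let_def
    by (intro continuous_intros) auto
  \<comment> \<open>The distance from the axis stays positive. Hence the maximum norm of
    \<open>q\<close> gives back the real part of \<open>to_square w\<close>, and dividing by it
    gives back \<open>to_square u\<close>.\<close>
  have r: "1/2 \<le> 1 + Re (to_square w) / 2" if "w \<in> sphere 0 1" for w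
  proof -
    have "\<bar>Re (to_square w)\<bar> \<le> max_norm (to_square w)" unfolding max_norm_def by simp
    also have "\<dots> = 1" using that by (intro max_norm_to_square) auto
    finally show ?thesis by linarith
  qed
  have nq: "max_norm ((1 + Re (to_square w) / 2) *\<^sub>R to_square u) = 1 + Re (to_square w) / 2"
    if "u \<in> sphere 0 1" "w \<in> sphere 0 1" for u w
  proof -
    have "u \<noteq> 0" using that by auto
    then show ?thesis using r[OF that(2)] by (simp add: max_norm_scaleR)
  qed
  show "inj_on torus_map unit_torus"
  proof (rule inj_onI, clarify)
    fix u w u' w' :: complex
    assume n: "u \<in> sphere 0 1" "w \<in> sphere 0 1" "u' \<in> sphere 0 1" "w' \<in> sphere 0 1"
      and eq: "torus_map (u, w) = torus_map (u', w')"
    have q: "(1 + Re (to_square w) / 2) *\<^sub>R to_square u = (1 + Re (to_square w') / 2) *\<^sub>R to_square u'"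
      and im: "Im (to_square w) = Im (to_square w')"
      using eq by (auto simp: torus_map_def Let_def complex_eq_iff)
    have re: "Re (to_square w) = Re (to_square w')"
      using arg_cong[OF q, of max_norm] nq n by simp
    then have "w = w'"
      using im n by (intro inj_onD[OF to_square_inj, of w w']) (simp_all add: complex_eq_iff)
    moreover have "to_square u = to_square u'"
      using q r[OF n(2)] unfolding re by simp
    ultimately show "u = u' \<and> w = w'" using n inj_onD[OF to_square_inj] by simp
  qed
  show "torus_map ` unit_torus = orientable_surface 1"
  proof (intro equalityI subsetI)
    fix P assume "P \<in> torus_map ` unit_torus"
    then obtain u w where uw: "u \<in> sphere 0 1" "w \<in> sphere 0 1" "P = torus_map (u, w)" by auto
    define q where "q = (1 + Re (to_square w) / 2) *\<^sub>R to_square u"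
    have P: "P = (3/2 + Re q, 3/2 + Im q, 1/2 + Im (to_square w) / 2)"
      using uw by (simp add: torus_map_def Let_def q_def)
    have "Complex (Re (to_square w) / 2) (Im (to_square w) / 2) = (1/2) *\<^sub>R to_square w"
      by (simp add: complex_eq_iff)
    then have "max_norm (Complex (Re (to_square w) / 2) (Im (to_square w) / 2)) = 1/2"
      using max_norm_to_square[of w] uw(2) by (cases "w = 0") (simp_all add: max_norm_scaleR)
    moreover have "max_norm q = 1 + Re (to_square w) / 2" unfolding q_def using nq uw by blast
    ultimately show "P \<in> orientable_surface 1"
      unfolding P orientable_surface_1_iff by simp
  next
    fix P assume P: "P \<in> orientable_surface 1"
    obtain x y z where xyz: "P = (x, y, z)" by (cases P)
    define q where "q = Complex (x - 3/2) (y - 3/2)"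
    define W where "W = Complex (max_norm q - 1) (z - 1/2)"
    have W: "max_norm W = 1/2" using P unfolding xyz orientable_surface_1_iff q_def W_def .
    have "\<bar>max_norm q - 1\<bar> \<le> max_norm W" by (simp add: W_def max_norm_def)
    then have "max_norm q \<noteq> 0" unfolding W by (auto simp: abs_if)
    then have q0: "q \<noteq> 0" by simp
    have W0: "W \<noteq> 0" using W by (metis max_norm_0 half_gt_zero_iff less_irrefl zero_less_one)
    have sq: "to_square W = 2 *\<^sub>R W" unfolding to_square_def W by simp
    have "torus_map (sgn q, sgn W) = (3/2 + Re q, 3/2 + Im q, 1/2 + Im W)"
      using max_norm_scaleR_to_square[of q]
      by (simp add: torus_map_def to_square_sgn sq Let_def) (simp add: W_def complex_eq_iff)
    then have "torus_map (sgn q, sgn W) = P" by (simp add: W_def q_def xyz)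
    moreover have "(sgn q, sgn W) \<in> unit_torus" using q0 W0 by (simp add: norm_sgn)
    ultimately show "P \<in> torus_map ` unit_torus" by blast
  qed
qed

lemma embeds_in_homeomorphic:
  assumes "S homeomorphic T" "embeds_in G S" shows "embeds_in G T"
proof -
  obtain f g where "homeomorphism S T f g" using assms by (auto simp: homeomorphic_def)
  then show ?thesis
    by (intro embeds_in_continuous_image[OF assms(2), of f]) (auto simp: homeomorphism_def intro!:
      inj_on_inverseI)
qed

lemma embeds_in_torus_iff: "embeds_in G (orientable_surface 1) \<longleftrightarrow> embeds_in G unit_torus"
  using embeds_in_homeomorphic[OF homeomorphic_unit_torus]
    embeds_in_homeomorphic[OF homeomorphic_unit_torus[unfolded homeomorphic_sym[of unit_torus]]] by metis

section \<open>Straight-line drawings\<close>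

type_synonym point = "int \<times> int"

fun dot :: "point \<Rightarrow> point \<Rightarrow> int" where "dot (x, y) (a, b) = x * a + y * b"

fun translate :: "point \<Rightarrow> point \<Rightarrow> point" where "translate (x, y) (a, b) = (x + a, y + b)"

fun normals :: "point \<Rightarrow> point \<Rightarrow> point list" where
  "normals (a, b) (c, d) = [(b - d, c - a), (d - b, a - c)]"

definition directions :: "point \<Rightarrow> point \<Rightarrow> point \<Rightarrow> point \<Rightarrow> point list" where
  "directions a b c d = [(1, 0), (- 1, 0), (0, 1), (0, - 1)] @ normals a b @ normals c d"

text \<open>A strictly separating direction is sought among finitely many candidates, so success
  certifies disjointness and failure says nothing. The coordinate directions take care of collinear
  segments and of single points.\<close>

definition segments_apart :: "point \<Rightarrow> point \<Rightarrow> point \<Rightarrow> point \<Rightarrow> bool" where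
  "segments_apart a b c d \<longleftrightarrow>
     list_ex (\<lambda>n. dot n a < dot n c \<and> dot n a < dot n d \<and> dot n b < dot n c \<and> dot n b < dot n d)
       (directions a b c d)"

text \<open>The weak inequalities allow one segment to run inside the separating line through
  \<open>s\<close>; the strict one keeps the other segment off that line except at
  \<open>s\<close>.\<close>

definition segments_touch :: "point \<Rightarrow> point \<Rightarrow> point \<Rightarrow> bool" where
  "segments_touch s a b \<longleftrightarrow>
     list_ex (\<lambda>n. dot n a \<le> dot n s \<and> dot n s \<le> dot n b \<and> dot n a < dot n b) (directions s a s b)"

definition segments_ok :: "point \<Rightarrow> point \<Rightarrow> point \<Rightarrow> point \<Rightarrow> bool" where
  "segments_ok a b c d \<longleftrightarrow> segments_apart a b c d \<or>
     (a = c \<and> segments_touch a b d) \<or> (a = d \<and> segments_touch a b c) \<or>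
     (b = c \<and> segments_touch b a d) \<or> (b = d \<and> segments_touch b a c)"

type_synonym segment = "point \<times> point \<times> nat \<times> nat"

fun pairwise_list :: "('a \<Rightarrow> 'a \<Rightarrow> bool) \<Rightarrow> 'a list \<Rightarrow> bool" where
  "pairwise_list P [] = True"
| "pairwise_list P (x # xs) = (list_all (P x) xs \<and> pairwise_list P xs)"

text \<open>The points \<open>a\<close> and \<open>b\<close> are lifts of the vertices
  \<open>u\<close> and \<open>v\<close>. Avoiding its own translates keeps the segment injective in
  the quotient; the last condition keeps it away from the lifts of all other vertices.\<close>

definition check_segment :: "point \<Rightarrow> point list \<Rightarrow> point list \<Rightarrow> segment \<Rightarrow> bool" where
  "check_segment bd ls ps = (\<lambda>(a, b, u, v).
     list_all (\<lambda>p. 0 \<le> fst p \<and> fst p \<le> fst bd \<and> 0 \<le> snd p \<and> snd p \<le> snd bd) [a, b] \<and>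
     u < length ps \<and> v < length ps \<and> u \<noteq> v \<and> a \<noteq> b \<and>
     list_ex (\<lambda>l. a = translate (ps ! u) l) ls \<and> list_ex (\<lambda>l. b = translate (ps ! v) l) ls \<and>
     list_all (\<lambda>l. (l = (0, 0) \<or> segments_apart a b (translate a l) (translate b l)) \<and>
       list_all (\<lambda>w. w = u \<or> w = v \<or>
         segments_apart a b (translate (ps ! w) l) (translate (ps ! w) l)) [0..<length ps]) ls)"

definition check_drawing :: "point \<Rightarrow> point list \<Rightarrow> point list \<Rightarrow> segment list \<Rightarrow> bool" where
  "check_drawing bd ls ps es \<longleftrightarrow>
     list_all (\<lambda>p. 0 \<le> fst p \<and> fst p \<le> fst bd \<and> 0 \<le> snd p \<and> snd p \<le> snd bd) ps \<and>
     pairwise_list (\<lambda>p q. list_all (\<lambda>l. p \<noteq> translate q l) ls) ps \<and>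
     list_all (check_segment bd ls ps) es \<and>
     pairwise_list (\<lambda>(a, b, _) (c, d, _).
       list_all (\<lambda>l. segments_ok a b (translate c l) (translate d l)) ls) es"

text \<open>The torus is the plane modulo the lattice of all \<open>(x, y)\<close> with \<open>10\<close> dividing \<open>y\<close> and \<open>70\<close>
  dividing \<open>x + 2 y\<close>, listed as far as it matters in the strip of height 10. The points \<open>(10 k, 0)\<close>
  span the regular triangulation by \<open>K\<^sub>7\<close>; the points 7, 8, 9 lie inside one of its triangles.\<close>

definition torus_periods :: "point list" where
  "torus_periods = [(0, 0), (70, 0), (- 70, 0), (- 20, 10), (50, 10), (20, - 10), (- 50, - 10)]"

definition torus_points :: "point list" where
  "torus_points = [(0, 0), (10, 0), (20, 0), (30, 0), (40, 0), (50, 0), (60, 0), (7, 5), (6, 2), (4, 2)]"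

text \<open>Since (-20, 10) is a period, one row up means index plus two. So the horizontal,
  vertical and diagonal segments join \<open>k\<close> to \<open>k + 1\<close>, \<open>k + 2\<close>
  and \<open>k + 3\<close> modulo 7, which are all 21 edges of \<open>K\<^sub>7\<close>. The last
  eight lie in the triangle on 0, 1, 3 and complete the cliques on 0, 7, 8, 9 and on 0, 1, 7,
  8.\<close>

definition torus_segments :: "segment list" where
  "torus_segments = [((0, 0), (10, 0), 0, 1), ((0, 0), (0, 10), 0, 2), ((0, 0), (10, 10), 0, 3),
     ((10, 0), (20, 0), 1, 2), ((10, 0), (10, 10), 1, 3), ((10, 0), (20, 10), 1, 4),
     ((20, 0), (30, 0), 2, 3), ((20, 0), (20, 10), 2, 4), ((20, 0), (30, 10), 2, 5),
     ((30, 0), (40, 0), 3, 4), ((30, 0), (30, 10), 3, 5), ((30, 0), (40, 10), 3, 6),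
     ((40, 0), (50, 0), 4, 5), ((40, 0), (40, 10), 4, 6), ((40, 0), (50, 10), 4, 0),
     ((50, 0), (60, 0), 5, 6), ((50, 0), (50, 10), 5, 0), ((50, 0), (60, 10), 5, 1),
     ((60, 0), (70, 0), 6, 0), ((60, 0), (60, 10), 6, 1), ((60, 0), (70, 10), 6, 2),
     ((7, 5), (0, 0), 7, 0), ((7, 5), (10, 0), 7, 1), ((6, 2), (0, 0), 8, 0),
     ((6, 2), (10, 0), 8, 1), ((7, 5), (6, 2), 7, 8), ((4, 2), (0, 0), 9, 0),
     ((4, 2), (7, 5), 9, 7), ((4, 2), (6, 2), 9, 8)]"

text \<open>A \<open>K\<^sub>4\<close> with 0 inside the triangle on 1, 2, 3; the points 4, 5, 6 lie
  in the three faces at 0, and 7, 8, 9 inside the triangle on 0, 1, 4.\<close>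

definition plane_points :: "point list" where
  "plane_points = [(30, 20), (0, 0), (60, 0), (31, 60), (33, 8), (17, 25), (44, 24), (25, 12), (16, 7),
    (22, 11)]"

definition plane_segments :: "segment list" where
  "plane_segments = [((30, 20), (0, 0), 0, 1), ((30, 20), (60, 0), 0, 2), ((30, 20), (31, 60), 0, 3),
     ((0, 0), (60, 0), 1, 2), ((0, 0), (31, 60), 1, 3), ((60, 0), (31, 60), 2, 3),
     ((33, 8), (30, 20), 4, 0), ((33, 8), (0, 0), 4, 1), ((33, 8), (60, 0), 4, 2),
     ((17, 25), (30, 20), 5, 0), ((17, 25), (0, 0), 5, 1), ((17, 25), (31, 60), 5, 3),
     ((44, 24), (30, 20), 6, 0), ((44, 24), (60, 0), 6, 2), ((44, 24), (31, 60), 6, 3),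
     ((25, 12), (30, 20), 7, 0), ((16, 7), (30, 20), 8, 0), ((22, 11), (30, 20), 9, 0),
     ((25, 12), (16, 7), 7, 8), ((25, 12), (22, 11), 7, 9), ((16, 7), (22, 11), 8, 9)]"

lemma check_torus: "check_drawing (70, 10) torus_periods torus_points torus_segments"
  by code_simp

lemma check_plane: "check_drawing (60, 60) [(0, 0)] plane_points plane_segments"
  by code_simp

section \<open>Correctness of the certificates\<close>

definition point_of :: "point \<Rightarrow> complex" where
  "point_of p = Complex (of_int (fst p)) (of_int (snd p))"

lemma point_of_translate: "point_of (translate p q) = point_of p + point_of q"
  by (cases p; cases q) (simp add: point_of_def complex_eq_iff)

lemma point_of_eq_iff: "point_of p = point_of q \<longleftrightarrow> p = q"
  by (auto simp: point_of_def prod_eq_iff)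

definition height :: "point \<Rightarrow> complex \<Rightarrow> real" where
  "height n z = of_int (fst n) * Re z + of_int (snd n) * Im z"

lemma height_point_of: "height n (point_of p) = of_int (dot n p)"
  by (cases n; cases p) (simp add: height_def point_of_def)

lemma height_segment:
  assumes "z \<in> closed_segment a b"
  obtains t where "0 \<le> t" "t \<le> 1" "height n z = (1 - t) * height n a + t * height n b"
    "z = a + t *\<^sub>R (b - a)"
proof -
  obtain t where t: "0 \<le> t" "t \<le> 1" "z = (1 - t) *\<^sub>R a + t *\<^sub>R b" using assms by (auto simp: in_segment)
  show thesis
    by (rule that[of t]) (use t(1,2) in \<open>simp_all add: t(3) height_def algebra_simps\<close>)
qed

abbreviation seg :: "point \<Rightarrow> point \<Rightarrow> complex set" where
  "seg a b \<equiv> closed_segment (point_of a) (point_of b)"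

lemma segments_apart_disjoint:
  assumes "segments_apart a b c d" shows "seg a b \<inter> seg c d = {}"
proof -
  obtain n where n: "dot n a < dot n c" "dot n a < dot n d" "dot n b < dot n c" "dot n b < dot n d"
    using assms unfolding segments_apart_def list_ex_iff by blast
  have False if z: "z \<in> seg a b" "z \<in> seg c d" for z
  proof -
    obtain t where t: "0 \<le> t" "t \<le> 1" "height n z = (1 - t) * of_int (dot n a) + t * of_int (dot n b)"
      by (rule height_segment[OF z(1), of n]) (simp add: height_point_of)
    obtain s where s: "0 \<le> s" "s \<le> 1" "height n z = (1 - s) * of_int (dot n c) + s * of_int (dot n d)"
      by (rule height_segment[OF z(2), of n]) (simp add: height_point_of)
    let ?m = "max (dot n a) (dot n b)"
    have "height n z \<le> of_int ?m"
      unfolding t(3) by (rule convex_bound_le) (use t in auto)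
    moreover have "- height n z < - of_int ?m"
    proof -
      have "(1 - s) * (- of_int (dot n c)) + s * (- of_int (dot n d)) < - real_of_int ?m"
        by (rule convex_bound_lt) (use s n in auto)
      then show ?thesis unfolding s(3) by (simp add: algebra_simps)
    qed
    ultimately show False by simp
  qed
  then show ?thesis by blast
qed

lemma segments_touch_inter:
  assumes "segments_touch s a b" shows "seg s a \<inter> seg s b \<subseteq> {point_of s}"
proof
  obtain n where n: "dot n a \<le> dot n s" "dot n s \<le> dot n b" "dot n a < dot n b"
    using assms unfolding segments_touch_def list_ex_iff by blast
  fix z assume "z \<in> seg s a \<inter> seg s b"
  then have z: "z \<in> seg s a" "z \<in> seg s b" by auto
  obtain t where t: "0 \<le> t" "height n z = of_int (dot n s) + t * (of_int (dot n a) - of_int (dot n s))"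
      "z = point_of s + t *\<^sub>R (point_of a - point_of s)"
    by (rule height_segment[OF z(1), of n]) (simp add: height_point_of algebra_simps)
  obtain r where r: "0 \<le> r" "height n z = of_int (dot n s) + r * (of_int (dot n b) - of_int (dot n s))"
      "z = point_of s + r *\<^sub>R (point_of b - point_of s)"
    by (rule height_segment[OF z(2), of n]) (simp add: height_point_of algebra_simps)
  have "t * (real_of_int (dot n a) - of_int (dot n s)) \<le> 0" "0 \<le> r * (real_of_int (dot n b) - of_int
    (dot n s))"
    using t(1) r(1) n by (auto intro: mult_nonneg_nonpos)
  then have "t * (real_of_int (dot n a) - of_int (dot n s)) = 0" "r * (real_of_int (dot n b) - of_int
    (dot n s)) = 0"
    using t(2) r(2) by linarith+
  then have "t = 0 \<or> r = 0" using n by auto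
  then show "z \<in> {point_of s}" using t(3) r(3) by auto
qed

lemma segments_ok_inter:
  assumes "segments_ok a b c d" "z \<in> seg a b" "z \<in> seg c d"
  obtains s where "z = point_of s" "s \<in> {a, b}" "s \<in> {c, d}"
proof -
  have c: "seg x y = seg y x" for x y by (rule closed_segment_commute)
  consider "segments_apart a b c d" | "a = c" "segments_touch a b d" | "a = d" "segments_touch a b c"
    | "b = c" "segments_touch b a d" | "b = d" "segments_touch b a c"
    using assms(1) unfolding segments_ok_def by blast
  then have "z = point_of a \<and> a \<in> {c, d} \<or> z = point_of b \<and> b \<in> {c, d}"
  proof cases
    case 1
    then show ?thesis using segments_apart_disjoint[OF 1] assms(2,3) by blast
  next
    case 2
    then show ?thesis using segments_touch_inter[OF 2(2)] assms(2,3) by blast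
  next
    case 3
    then show ?thesis using segments_touch_inter[OF 3(2)] assms(2,3) c[of c d] by blast
  next
    case 4
    then show ?thesis using segments_touch_inter[OF 4(2)] assms(2,3) c[of a b] by blast
  next
    case 5
    then show ?thesis using segments_touch_inter[OF 5(2)] assms(2,3) c[of a b] c[of c d] by blast
  qed
  then show thesis using that by blast
qed

lemma pairwise_listD:
  "pairwise_list P xs \<Longrightarrow> x \<in> set xs \<Longrightarrow> y \<in> set xs \<Longrightarrow> x \<noteq> y \<Longrightarrow> P x y \<or> P y x"
  by (induction xs) (auto simp: list_all_iff)

lemma pairwise_list_nthD:
  "pairwise_list P xs \<Longrightarrow> i < j \<Longrightarrow> j < length xs \<Longrightarrow> P (xs ! i) (xs ! j)"
proof (induction xs arbitrary: i j)
  case (Cons x xs)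
  then show ?case by (cases i; cases j) (auto simp: list_all_iff)
qed simp

definition segment_edges :: "segment list \<Rightarrow> nat set set" where
  "segment_edges es = (\<lambda>(a, b, u, v). {u, v}) ` set es"

text \<open>Finitely many periods suffice because all points and segments lie in one box, and points
  of the box identified by \<open>\<Theta>\<close> differ by a listed period. With the identity and
  the period zero this is a statement on plane drawings.\<close>

theorem check_drawing_embeds:
  fixes \<Theta> :: "complex \<Rightarrow> 'b::topological_space"
  assumes chk: "check_drawing bd ls ps es"
    and cont: "continuous_on UNIV \<Theta>" and range: "range \<Theta> \<subseteq> S"
    and per: "\<And>l z. l \<in> set ls \<Longrightarrow> \<Theta> (z + point_of l) = \<Theta> z"
    and same: "\<And>z w. \<Theta> z = \<Theta> w \<Longrightarrow> z \<in> cbox 0 (point_of bd) \<Longrightarrow> w \<in> cbox 0 (point_of bd) \<Longrightarrow>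
      \<exists>l\<in>set ls. z = w + point_of l"
  shows "embeds_in ({..<length ps}, segment_edges es) S"
proof -
  let ?B = "cbox 0 (point_of bd)"
  let ?p = "\<lambda>u. \<Theta> (point_of (ps ! u))"
  have inB: "point_of p \<in> ?B \<longleftrightarrow> 0 \<le> fst p \<and> fst p \<le> fst bd \<and> 0 \<le> snd p \<and> snd p \<le> snd bd" for p
    by (simp add: point_of_def in_cbox_complex_iff)
  have psB: "point_of (ps ! u) \<in> ?B" if "u < length ps" for u
    using chk that unfolding check_drawing_def list_all_iff inB by auto
  have es: "check_segment bd ls ps (a, b, u, v)" if "(a, b, u, v) \<in> set es" for a b u v
    using chk that unfolding check_drawing_def list_all_iff by auto
  have segB: "seg a b \<subseteq> ?B" if "(a, b, u, v) \<in> set es" for a b u v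
    using es[OF that] inB[of a] inB[of b]
    by (intro closed_segment_subset convex_box) (auto simp: check_segment_def)
  have uv: "u < length ps" "v < length ps" "u \<noteq> v" "a \<noteq> b" "\<Theta> (point_of a) = ?p u" "\<Theta> (point_of b) = ?p v"
    if "(a, b, u, v) \<in> set es" for a b u v
    using es[OF that] per by (auto simp: check_segment_def list_ex_iff point_of_translate)
  have seg_translate: "z + point_of l \<in> seg (translate c l) (translate d l)" if "z \<in> seg c d" for z c d l
    using that unfolding point_of_translate in_segment
    by (auto simp: algebra_simps scaleR_add_left[symmetric] intro!: exI)
  have meet: "\<exists>l\<in>set ls. z \<in> seg (translate c l) (translate d l)"
    if "\<Theta> z = \<Theta> w" "z \<in> ?B" "w \<in> ?B" "w \<in> seg c d" for z w c d
    using same[OF that(1-3)] seg_translate[OF that(4)] by blast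
  have inj: "inj_on ?p {..<length ps}"
  proof (rule inj_onI)
    fix u v assume u: "u \<in> {..<length ps}" and v: "v \<in> {..<length ps}" and eq: "?p u = ?p v"
    have False if ij: "i < j" "j < length ps" "?p i = ?p j" for i j
    proof -
      obtain l where "l \<in> set ls" "point_of (ps ! i) = point_of (ps ! j) + point_of l"
        using same[OF ij(3)] psB[OF ij(2)] psB[OF less_trans[OF ij(1,2)]] by blast
      moreover have "list_all (\<lambda>l. ps ! i \<noteq> translate (ps ! j) l) ls"
        using chk pairwise_list_nthD[OF _ ij(1,2)] unfolding check_drawing_def by blast
      ultimately show False
        by (auto simp: list_all_iff point_of_translate[symmetric] point_of_eq_iff)
    qed
    then show "u = v" using u v eq by (metis lessThan_iff linorder_neqE_nat)
  qed
  define t where "t e = (SOME x. x \<in> set es \<and> e = {fst (snd (snd x)), snd (snd (snd x))})" for e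
  have t: "\<exists>a b u v. t e = (a, b, u, v) \<and> (a, b, u, v) \<in> set es \<and> e = {u, v}" if e: "e \<in> segment_edges
    es" for e
  proof -
    have "\<exists>x. x \<in> set es \<and> e = {fst (snd (snd x)), snd (snd (snd x))}"
      using e unfolding segment_edges_def by force
    then have "t e \<in> set es \<and> e = {fst (snd (snd (t e))), snd (snd (snd (t e)))}"
      unfolding t_def by (rule someI_ex)
    then show ?thesis by (cases "t e") auto
  qed
  define c where "c e = \<Theta> \<circ> linepath (point_of (fst (t e))) (point_of (fst (snd (t e))))" for e
  have c_eq: "c e = \<Theta> \<circ> linepath (point_of a) (point_of b)" if "t e = (a, b, u, v)" for e a b u v
    using that by (simp add: c_def)
  have c_img: "path_image (c e) = \<Theta> ` seg a b" if "t e = (a, b, u, v)" for e a b u v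
    unfolding c_eq[OF that] path_image_compose by simp
  have "drawing {..<length ps} (segment_edges es) S ?p c"
  proof
    show "inj_on ?p {..<length ps}" by (rule inj)
    show "?p ` {..<length ps} \<subseteq> S" using range by auto
  next
    fix e assume "e \<in> segment_edges es"
    then obtain a b u v where te: "t e = (a, b, u, v)" "(a, b, u, v) \<in> set es" "e = {u, v}" using t by blast
    note uv = uv[OF te(2)]
    have ck: "l = (0, 0) \<or> segments_apart a b (translate a l) (translate b l)"
        "\<And>w. w < length ps \<Longrightarrow> w = u \<or> w = v \<or> segments_apart a b (translate (ps ! w) l) (translate (ps !
          w) l)"
      if "l \<in> set ls" for l
      using es[OF te(2)] that unfolding check_segment_def by (auto simp: list_all_iff)
    show "{pathstart (c e), pathfinish (c e)} = ?p ` e"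
      unfolding c_eq[OF te(1)] pathstart_compose pathfinish_compose using uv te(3) by simp
    show "path_image (c e) \<subseteq> S" unfolding c_img[OF te(1)] using range by blast
    have "inj_on \<Theta> (seg a b)"
    proof (rule inj_onI)
      fix z w assume zw: "z \<in> seg a b" "w \<in> seg a b" "\<Theta> z = \<Theta> w"
      obtain l where l: "l \<in> set ls" "z = w + point_of l"
        using same[OF zw(3)] zw segB[OF te(2)] by blast
      have "\<not> segments_apart a b (translate a l) (translate b l)"
        using segments_apart_disjoint[of a b "translate a l" "translate b l"] zw(1) seg_translate[OF
          zw(2), of l] l(2) by blast
      then have "l = (0, 0)" using ck(1)[OF l(1)] by blast
      then show "z = w" using l by (simp add: point_of_def complex_eq_iff)
    qed
    moreover have "inj_on (linepath (point_of a) (point_of b)) {0..1}"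
      using uv(4) by (intro arc_imp_inj_on arc_linepath) (simp add: point_of_eq_iff)
    ultimately have "inj_on (c e) {0..1}"
      unfolding c_eq[OF te(1)] by (intro comp_inj_on) (simp_all add: linepath_image_01)
    moreover have "path (c e)"
      unfolding c_eq[OF te(1)] by (intro path_continuous_image) (auto intro: continuous_on_subset[OF cont])
    ultimately show "arc (c e)" by (simp add: arc_def)
    show "path_image (c e) \<inter> ?p ` {..<length ps} \<subseteq> ?p ` e"
    proof
      fix x assume "x \<in> path_image (c e) \<inter> ?p ` {..<length ps}"
      then obtain z w where zw: "z \<in> seg a b" "x = \<Theta> z" "w < length ps" "x = ?p w"
        unfolding c_img[OF te(1)] by auto
      obtain l where l: "l \<in> set ls" "z = point_of (ps ! w) + point_of l"
        using same[of z "point_of (ps ! w)"] zw(1,2,4) segB[OF te(2)] psB[OF zw(3)] by (metis subsetD)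
      have "\<not> segments_apart a b (translate (ps ! w) l) (translate (ps ! w) l)"
        using segments_apart_disjoint[of a b "translate (ps ! w) l" "translate (ps ! w) l"] zw(1) l(2)
        by (auto simp: point_of_translate)
      then have "w \<in> e" using ck(2)[OF l(1) zw(3)] te(3) by auto
      then show "x \<in> ?p ` e" using zw(4) by blast
    qed
  next
    fix e f assume e: "e \<in> segment_edges es" and f: "f \<in> segment_edges es" and ne: "e \<noteq> f"
    obtain a b u v where te: "t e = (a, b, u, v)" "(a, b, u, v) \<in> set es" "e = {u, v}" using t[OF e] by
      blast
    obtain a' b' u' v' where tf: "t f = (a', b', u', v')" "(a', b', u', v') \<in> set es" "f = {u', v'}"
      using t[OF f] by blast
    have key: "\<exists>w. \<Theta> z = ?p w \<and> w \<in> {u,v} \<inter> {u',v'}"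
      if s: "(a, b, u, v) \<in> set es" "(a', b', u', v') \<in> set es"
        and ok: "list_all (\<lambda>l. segments_ok a b (translate a' l) (translate b' l)) ls"
        and z: "z \<in> seg a b" "w \<in> seg a' b'" "\<Theta> z = \<Theta> w"
      for a b u v a' b' u' v' z w
    proof -
      obtain l where l: "l \<in> set ls" "z \<in> seg (translate a' l) (translate b' l)"
        using meet[OF z(3) _ _ z(2)] z segB[OF s(1)] segB[OF s(2)] by blast
      then obtain q where q: "z = point_of q" "q \<in> {a, b}" "q \<in> {translate a' l, translate b' l}"
        using segments_ok_inter[OF _ z(1) l(2)] ok by (auto simp: list_all_iff)
      have "\<Theta> z = \<Theta> (point_of a) \<or> \<Theta> z = \<Theta> (point_of b)" using q(1,2) by auto
      then obtain i where i: "i \<in> {u, v}" "\<Theta> z = ?p i" using uv(5,6)[OF s(1)] by auto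
      have "\<Theta> z = \<Theta> (point_of a') \<or> \<Theta> z = \<Theta> (point_of b')"
        using q(1,3) per[OF l(1)] by (auto simp: point_of_translate)
      then obtain j where j: "j \<in> {u', v'}" "\<Theta> z = ?p j" using uv(5,6)[OF s(2)] by auto
      have "i = j" using i j inj uv[OF s(1)] uv[OF s(2)] unfolding inj_on_def by auto
      then show ?thesis using i j by blast
    qed
    have "(a, b, u, v) \<noteq> (a', b', u', v')" using ne te tf by auto
    \<comment> \<open>Each pair is tested in list order only, so which of the two segments has been
      translated depends on their positions in the list.\<close>
    then consider "list_all (\<lambda>l. segments_ok a b (translate a' l) (translate b' l)) ls"
      | "list_all (\<lambda>l. segments_ok a' b' (translate a l) (translate b l)) ls"
      using chk pairwise_listD[OF _ te(2) tf(2)] unfolding check_drawing_def by fastforce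
    then have *: "\<exists>w. \<Theta> z = ?p w \<and> w \<in> {u,v} \<inter> {u',v'}"
      if "z \<in> seg a b" "z' \<in> seg a' b'" "\<Theta> z = \<Theta> z'" for z z'
      using key[OF te(2) tf(2) _ that] key[OF tf(2) te(2) _ that(2,1) that(3)[symmetric]] that(3)
      by cases (blast, metis Int_commute)
    show "path_image (c e) \<inter> path_image (c f) \<subseteq> ?p ` (e \<inter> f)"
    proof
      fix x assume "x \<in> path_image (c e) \<inter> path_image (c f)"
      then obtain z z' where "z \<in> seg a b" "x = \<Theta> z" "z' \<in> seg a' b'" "x = \<Theta> z'"
        unfolding c_img[OF te(1)] c_img[OF tf(1)] by blast
      then show "x \<in> ?p ` (e \<inter> f)" using *[of z z'] te(3) tf(3) by auto
    qed
  qed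
  then show ?thesis by (rule drawing.embeds_in)
qed

lemma torus_graph_embeds:
  "embeds_in ({..<10}, segment_edges torus_segments) (orientable_surface 1)"
proof -
  \<comment> \<open>These coordinates send the generators (70, 0) and (-20, 10) of the period
    lattice to (1, 0) and (0, 1).\<close>
  let ?\<Theta> = "\<lambda>z. torus_cover (Complex ((Re z + 2 * Im z) / 70) (Im z / 10))"
  have "embeds_in ({..<length torus_points}, segment_edges torus_segments) unit_torus"
  proof (rule check_drawing_embeds[OF check_torus, where \<Theta> = ?\<Theta>])
    show "continuous_on UNIV ?\<Theta>"
      unfolding torus_cover_def by (auto intro!: continuous_intros)
    show "range ?\<Theta> \<subseteq> unit_torus" by (auto simp: torus_cover_def)
    show "?\<Theta> (z + point_of l) = ?\<Theta> z" if "l \<in> set torus_periods" for l z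
      using that unfolding torus_cover_eq_iff torus_periods_def
      by (auto simp: point_of_def add_divide_distrib diff_divide_distrib)
    fix z w :: complex
    assume eq: "?\<Theta> z = ?\<Theta> w" and z: "z \<in> cbox 0 (point_of (70, 10))" and w: "w \<in> cbox 0 (point_of (70, 10))"
    have zw: "0 \<le> Re z" "Re z \<le> 70" "0 \<le> Im z" "Im z \<le> 10" "0 \<le> Re w" "Re w \<le> 70" "0 \<le> Im w" "Im w \<le> 10"
      using z w by (auto simp: in_cbox_complex_iff point_of_def)
    obtain i j :: int where ij: "(Re z + 2 * Im z) / 70 - (Re w + 2 * Im w) / 70 = of_int i" "Im z / 10
      - Im w / 10 = of_int j"
      using eq unfolding torus_cover_eq_iff by (auto elim!: Ints_cases)
    have im: "Im z = Im w + 10 * of_int j" using ij(2) by simp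
    have re: "Re z = Re w + 70 * of_int i - 20 * of_int j" using ij(1) im by (simp add: field_simps)
    have "\<bar>real_of_int j\<bar> \<le> 1" using im zw by linarith
    then have j: "j \<in> {- 1, 0, 1}" by auto
    have "\<bar>70 * real_of_int i - 20 * of_int j\<bar> \<le> 70" using re zw by linarith
    then have "\<bar>70 * i - 20 * j\<bar> \<le> 70" by linarith
    then have l: "(70 * i - 20 * j, 10 * j) \<in> set torus_periods"
    proof -
      consider "j = 0" "i \<in> {- 1, 0, 1}" | "j = 1" "i \<in> {0, 1}" | "j = - 1" "i \<in> {- 1, 0}"
        using j \<open>\<bar>70 * i - 20 * j\<bar> \<le> 70\<close> by force
      then show ?thesis by cases (auto simp: torus_periods_def)
    qed
    show "\<exists>l\<in>set torus_periods. z = w + point_of l"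
      by (rule bexI[OF _ l]) (simp add: point_of_def complex_eq_iff im re)
  qed
  moreover have "length torus_points = 10" by (simp add: torus_points_def)
  ultimately show ?thesis unfolding embeds_in_torus_iff by simp
qed

lemma plane_graph_embeds:
  "embeds_in ({..<10}, segment_edges plane_segments) (orientable_surface 0)"
proof -
  have "embeds_in ({..<length plane_points}, segment_edges plane_segments) (UNIV :: complex set)"
    by (rule check_drawing_embeds[OF check_plane, where \<Theta> = "\<lambda>z. z"]) (auto simp: point_of_def
      complex_eq_iff)
  moreover have "length plane_points = 10" by (simp add: plane_points_def)
  ultimately have emb: "embeds_in ({..<10}, segment_edges plane_segments) (UNIV :: complex set)"
    by simp
  have "(0, 0, 0) \<in> orientable_surface 0"
    by (simp add: orientable_surface_def handlebody_def frontier_def closure_Times interior_Times)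
  then have "orientable_surface 0 - {(0, 0, 0)} homeomorphic (UNIV :: complex set)"
    by (rule punctured_sphere_homeomorphic_plane)
  then have "embeds_in ({..<10}, segment_edges plane_segments) (orientable_surface 0 - {(0, 0, 0)})"
    using embeds_in_homeomorphic emb homeomorphic_sym by blast
  then show ?thesis
    by (rule embeds_in_continuous_image[where f = "\<lambda>x. x"]) auto
qed

section \<open>The upper ideal relation graph\<close>

lemma graph_genus_eq_1_iff:
  "graph_genus G = 1 \<longleftrightarrow> embeds_in G (orientable_surface 1) \<and> \<not> embeds_in G (orientable_surface 0)"
proof -
  define S where "S = {g. embeds_in G (orientable_surface g)}"
  have "Inf (enat ` S) = 1 \<longleftrightarrow> 1 \<in> S \<and> 0 \<notin> S"
  proof
    assume eq: "Inf (enat ` S) = 1"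
    have 0: "0 \<notin> S"
    proof
      assume "0 \<in> S"
      then have "Inf (enat ` S) \<le> 0" by (metis Inf_lower imageI zero_enat_def)
      then show False using eq by simp
    qed
    have "1 \<in> S"
    proof (rule ccontr)
      assume 1: "1 \<notin> S"
      have "enat 2 \<le> Inf (enat ` S)"
      proof (rule Inf_greatest)
        fix x assume "x \<in> enat ` S"
        then obtain g where "g \<in> S" "x = enat g" by auto
        moreover have "g \<noteq> 0" "g \<noteq> 1" using 0 1 \<open>g \<in> S\<close> by metis+
        ultimately show "enat 2 \<le> x" by simp
      qed
      then show False using eq by (simp add: one_enat_def)
    qed
    then show "1 \<in> S \<and> 0 \<notin> S" using 0 by simp
  next
    assume a: "1 \<in> S \<and> 0 \<notin> S"
    show "Inf (enat ` S) = 1"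
    proof (rule antisym)
      show "Inf (enat ` S) \<le> 1" using a by (metis Inf_lower imageI one_enat_def)
      show "1 \<le> Inf (enat ` S)"
      proof (rule Inf_greatest)
        fix x assume "x \<in> enat ` S"
        then obtain g where "g \<in> S" "x = enat g" by auto
        moreover have "g \<noteq> 0" using a \<open>g \<in> S\<close> by metis
        ultimately show "1 \<le> x" by (simp add: one_enat_def)
      qed
    qed
  qed
  then show ?thesis unfolding graph_genus_def S_def by simp
qed

context cring
begin

lemma nonunits_carrier: "nonunits R \<subseteq> carrier R"
  by (auto simp: nonunits_def)

lemma PIdl_subset_nonunits:
  assumes z: "z \<in> nonunits R" shows "PIdl z \<subseteq> nonunits R"
proof
  have zR: "z \<in> carrier R" using z by (simp add: nonunits_def)
  fix x assume "x \<in> PIdl z"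
  then obtain r where r: "r \<in> carrier R" "x = r \<otimes> z" unfolding cgenideal_def by blast
  then have "z \<in> Units R" if "x \<in> Units R" using unit_factor[of z r] that zR by (simp add: m_comm)
  then show "x \<in> nonunits R" using z r zR by (auto simp: nonunits_def)
qed

lemma Idl_subset_iff:
  assumes "x \<in> carrier R" "z \<in> carrier R"
  shows "Idl {x} \<subseteq> Idl {z} \<longleftrightarrow> x \<in> PIdl z"
  using assms cgenideal_self cgenideal_minimal[OF cgenideal_ideal]
  by (auto simp flip: cgenideal_eq_genideal)

text \<open>A nonunit generates an ideal of nonunits, so the condition that \<open>x\<close> and
  \<open>y\<close> are vertices is implied.\<close>

lemma upper_graph_edges:
  "edges (upper_ideal_relation_graph R) =
     {{x, y} | x y. x \<noteq> y \<and> (\<exists>z\<in>nonunits R. x \<in> PIdl z \<and> y \<in> PIdl z)}"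
proof -
  have "x \<in> nonunits R \<and> y \<in> nonunits R \<and> x \<noteq> y \<and> (\<exists>z\<in>nonunits R. Idl {x} \<subseteq> Idl {z} \<and> Idl {y} \<subseteq> Idl {z})
    \<longleftrightarrow> x \<noteq> y \<and> (\<exists>z\<in>nonunits R. x \<in> PIdl z \<and> y \<in> PIdl z)" for x y
    using Idl_subset_iff PIdl_subset_nonunits nonunits_carrier by (metis subsetD)
  then show ?thesis unfolding upper_ideal_relation_graph_def snd_conv by simp
qed

lemma upper_graph_edge: "e \<in> edges (upper_ideal_relation_graph R) \<Longrightarrow> e \<subseteq> nonunits R \<and> card e = 2"
  unfolding upper_graph_edges using PIdl_subset_nonunits by auto

lemma complete_edges_PIdl:
  "z \<in> nonunits R \<Longrightarrow> complete_edges (PIdl z) \<subseteq> edges (upper_ideal_relation_graph R)"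
  unfolding upper_graph_edges complete_edges_def by blast

lemma embeds_upper_graph_iff:
  "embeds_in (upper_ideal_relation_graph R) W \<longleftrightarrow>
     embeds_in (nonunits R, edges (upper_ideal_relation_graph R)) W"
  by (simp add: upper_ideal_relation_graph_def)

end

lemma ring_iso_upper_graph_embeds:
  assumes R: "cring R" and S: "cring S" and iso: "R \<simeq> S"
    and emb: "embeds_in (upper_ideal_relation_graph S) W"
  shows "embeds_in (upper_ideal_relation_graph R) W"
proof -
  interpret R: cring R by fact
  interpret S: cring S by fact
  obtain h where h: "h \<in> ring_iso R S" using iso by (auto simp: is_ring_iso_def)
  have hom: "h \<in> ring_hom R S" and bij: "bij_betw h (carrier R) (carrier S)"
    using h by (auto simp: ring_iso_def)
  have non: "h x \<in> nonunits S" if x: "x \<in> nonunits R" for x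
  proof -
    have "x \<in> Units R" if u: "h x \<in> Units S" and xR: "x \<in> carrier R"
    proof -
      obtain y where y: "y \<in> carrier S" "h x \<otimes>\<^bsub>S\<^esub> y = \<one>\<^bsub>S\<^esub>"
        using u S.Units_r_inv S.Units_inv_closed by blast
      then obtain z where z: "z \<in> carrier R" "y = h z" using bij by (auto simp: bij_betw_def)
      have "h (x \<otimes>\<^bsub>R\<^esub> z) = h \<one>\<^bsub>R\<^esub>"
        using y z xR ring_hom_mult[OF hom] ring_hom_one[OF hom] by simp
      then have "x \<otimes>\<^bsub>R\<^esub> z = \<one>\<^bsub>R\<^esub>" using bij z xR by (auto simp: bij_betw_def inj_on_def)
      then show ?thesis using xR z R.m_comm[of x z] unfolding Units_def by auto
    qed
    then show ?thesis using x bij unfolding nonunits_def bij_betw_def by auto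
  qed
  have mult: "h x \<in> PIdl\<^bsub>S\<^esub> h z" if "x \<in> PIdl\<^bsub>R\<^esub> z" "z \<in> carrier R" for x z
    using that ring_hom_mult[OF hom] ring_hom_closed[OF hom] unfolding cgenideal_def by auto
  have inj: "inj_on h (nonunits R)"
    using bij R.nonunits_carrier by (meson bij_betw_def inj_on_subset)
  have "embeds_in (nonunits R, edges (upper_ideal_relation_graph R)) W"
  proof (rule embeds_in_subgraph[OF emb[unfolded S.embeds_upper_graph_iff]])
    show "e \<subseteq> nonunits R" if "e \<in> edges (upper_ideal_relation_graph R)" for e
      using R.upper_graph_edge that by blast
    show "inj_on h (nonunits R)" by fact
    show "h ` nonunits R \<subseteq> nonunits S" using non by auto
    fix e assume "e \<in> edges (upper_ideal_relation_graph R)"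
    then obtain x y z where xyz: "e = {x, y}" "x \<noteq> y" "z \<in> nonunits R" "x \<in> PIdl\<^bsub>R\<^esub> z" "y \<in> PIdl\<^bsub>R\<^esub> z"
      unfolding R.upper_graph_edges by blast
    then have "x \<in> nonunits R" "y \<in> nonunits R" using R.PIdl_subset_nonunits by blast+
    then have "h x \<noteq> h y" using inj xyz(2) by (auto dest: inj_onD)
    then show "h ` e \<in> edges (upper_ideal_relation_graph S)"
      unfolding S.upper_graph_edges using xyz mult non R.nonunits_carrier by blast
  qed
  then show ?thesis unfolding R.embeds_upper_graph_iff .
qed

text \<open>Only sizes matter: the three parts of \<open>I \<union> J\<close> are injected
  separately into the corresponding parts of \<open>P \<union> Q\<close>, so whatever lies in
  \<open>I\<close> lands in the clique \<open>P\<close>, and whatever lies in \<open>J\<close> in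
  \<open>Q\<close>.\<close>

lemma embeds_in_two_cliques:
  assumes emb: "embeds_in (V', E') W" and fin: "finite I" "finite J" "finite P" "finite Q"
    and E: "\<And>e. e \<in> E \<Longrightarrow> card e = 2 \<and> (e \<subseteq> I \<or> e \<subseteq> J)"
    and PQ: "complete_edges P \<subseteq> E'" "complete_edges Q \<subseteq> E'" "P \<union> Q \<subseteq> V'"
    and card: "card (I \<inter> J) \<le> card (P \<inter> Q)" "card (I - J) \<le> card (P - Q)" "card (J - I) \<le> card (Q - P)"
  shows "embeds_in (I \<union> J, E) W"
proof -
  obtain f where f: "f ` (I \<inter> J) \<subseteq> P \<inter> Q" "inj_on f (I \<inter> J)" using card_le_inj[OF _ _ card(1)] fin by blast
  obtain g where g: "g ` (I - J) \<subseteq> P - Q" "inj_on g (I - J)" using card_le_inj[OF _ _ card(2)] fin by blast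
  obtain k where k: "k ` (J - I) \<subseteq> Q - P" "inj_on k (J - I)" using card_le_inj[OF _ _ card(3)] fin by blast
  define h where "h x = (if x \<in> J then if x \<in> I then f x else k x else g x)" for x
  have hI: "h ` I \<subseteq> P" using f(1) g(1) by (auto simp: h_def)
  have hJ: "h ` J \<subseteq> Q" using f(1) k(1) by (auto simp: h_def)
  have inj: "inj_on h (I \<union> J)"
  proof (rule inj_onI)
    fix x y assume xy: "x \<in> I \<union> J" "y \<in> I \<union> J" "h x = h y"
    have *: "x \<in> I \<inter> J \<and> f x \<in> P \<inter> Q \<and> h x = f x \<or> x \<in> I - J \<and> g x \<in> P - Q \<and> h x = g x \<or> x \<in> J - I \<and> k x
      \<in> Q - P \<and> h x = k x"
      if "x \<in> I \<union> J" for x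
      using that f(1) g(1) k(1) unfolding h_def by auto
    show "x = y"
      using *[OF xy(1)] *[OF xy(2)] xy(3) f(2) g(2) k(2) unfolding inj_on_def by (elim disjE) auto
  qed
  show ?thesis
  proof (rule embeds_in_subgraph[OF emb _ inj])
    show "e \<subseteq> I \<union> J" if "e \<in> E" for e using E[OF that] by auto
    show "h ` (I \<union> J) \<subseteq> V'" using hI hJ PQ(3) by auto
    fix e assume e: "e \<in> E"
    then obtain x y where xy: "e = {x, y}" "x \<noteq> y" using E by (meson card_2_iff)
    have "h x \<noteq> h y" using xy E[OF e] inj by (auto dest: inj_onD)
    moreover have "h ` e \<subseteq> P \<or> h ` e \<subseteq> Q" using E[OF e] hI hJ by blast
    ultimately have "h ` e \<in> complete_edges P \<union> complete_edges Q"
      unfolding complete_edges_def xy by auto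
    then show "h ` e \<in> E'" using PQ by blast
  qed
qed

section \<open>Unions of cliques that cannot be drawn on the torus\<close>

lemma complete_edges_mono: "A \<subseteq> B \<Longrightarrow> complete_edges A \<subseteq> complete_edges B"
  unfolding complete_edges_def by blast

lemma not_toroidal_K8:
  assumes E: "\<And>e. e \<in> E \<Longrightarrow> e \<subseteq> V \<and> card e = 2" and K: "complete_edges K \<subseteq> E" "8 \<le> card K"
  shows "\<not> embeds_in (V, E) (orientable_surface 1)"
proof -
  obtain L where L: "L \<subseteq> K" "card L = 8" using K(2) by (meson obtain_subset_with_card_n)
  have "4 \<le> card L" using L(2) by simp
  then obtain A where A: "A \<subseteq> L" "card A = 4" by (meson obtain_subset_with_card_n)
  have finL: "finite L" by (rule card_ge_0_finite) (simp add: L(2))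
  have "card (L - A) = 4" using A L(2) card_Diff_subset[OF finite_subset[OF A(1) finL] A(1)] by simp
  then have "L - A \<noteq> {}" by force
  then obtain v where v: "v \<in> L" "v \<notin> A" by blast
  show ?thesis
    unfolding embeds_in_torus_iff
  proof (rule not_embeds_in_torus[OF E, where v = v and A = A])
    show "complete_edges (insert v A) \<subseteq> E"
      using complete_edges_mono[of "insert v A" K] A v L K(1) by blast
    fix T assume T: "T \<subseteq> A" "card T = 3"
    then have "T \<subseteq> L" using A by blast
    then have "card (L - T) = 5" using T(2) L(2) card_Diff_subset[OF finite_subset[OF _ finL]] by simp
    then show "\<exists>B. complete_edges B \<subseteq> E \<and> card B = 5 \<and> B \<inter> T = {}"
      using complete_edges_mono[of "L - T" K] L K(1) by blast
  qed (use A v in auto)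
qed

text \<open>A single \<open>B\<close> serves every triangle of \<open>A\<close>. The vertex
  \<open>v\<close> may lie in \<open>B\<close>, which is what lets the two cliques overlap.\<close>

lemma not_toroidal_two_cliques:
  assumes E: "\<And>e. e \<in> E \<Longrightarrow> e \<subseteq> V \<and> card e = 2"
    and K: "complete_edges K \<subseteq> E" "complete_edges L \<subseteq> E"
    and A: "A \<subseteq> K" "card A = 4" "v \<in> K - A" and B: "B \<subseteq> L" "card B = 5" "A \<inter> B = {}"
  shows "\<not> embeds_in (V, E) (orientable_surface 1)"
  unfolding embeds_in_torus_iff
proof (rule not_embeds_in_torus[OF E, where v = v and A = A])
  show "complete_edges (insert v A) \<subseteq> E"
    using complete_edges_mono[of "insert v A" K] A K(1) by blast
  fix T assume "T \<subseteq> A" "card T = 3"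
  then show "\<exists>B. complete_edges B \<subseteq> E \<and> card B = 5 \<and> B \<inter> T = {}"
    using complete_edges_mono[of B L] B K(2) by blast
qed (use A in auto)

lemma not_toroidal_K5_wedge_K5:
  assumes E: "\<And>e. e \<in> E \<Longrightarrow> e \<subseteq> V \<and> card e = 2"
    and K: "complete_edges K \<subseteq> E" "complete_edges L \<subseteq> E"
    and c: "5 \<le> card K" "5 \<le> card L" "K \<inter> L = {v}"
  shows "\<not> embeds_in (V, E) (orientable_surface 1)"
proof -
  have "4 \<le> card (K - {v})" using c by (subst card_Diff_singleton) auto
  then obtain A where A: "A \<subseteq> K - {v}" "card A = 4" by (meson obtain_subset_with_card_n)
  obtain B where B: "B \<subseteq> L" "card B = 5" using c(2) by (meson obtain_subset_with_card_n)
  show ?thesis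
    by (rule not_toroidal_two_cliques[OF E K, where A = A and v = v and B = B]) (use A B c in auto)
qed

text \<open>The common triangle \<open>x\<close>, \<open>y\<close>, \<open>z\<close> is shared out:
  \<open>x\<close> completes \<open>A\<close> in the first clique, \<open>y\<close> and
  \<open>z\<close> complete \<open>B\<close> in the second, and \<open>y\<close> is also the apex
  \<open>v\<close>.\<close>

lemma not_toroidal_K6_K6:
  assumes E: "\<And>e. e \<in> E \<Longrightarrow> e \<subseteq> V \<and> card e = 2"
    and K: "complete_edges K \<subseteq> E" "complete_edges L \<subseteq> E"
    and c: "3 \<le> card (K \<inter> L)" "3 \<le> card (K - L)" "3 \<le> card (L - K)"
  shows "\<not> embeds_in (V, E) (orientable_surface 1)"
proof -
  obtain S where S: "S \<subseteq> K \<inter> L" "card S = 3" using c(1) by (meson obtain_subset_with_card_n)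
  then obtain x y z where xyz: "S = {x,y,z}" "x \<noteq> y" "x \<noteq> z" "y \<noteq> z" by (auto simp: card_3_iff)
  obtain C where C: "C \<subseteq> K - L" "card C = 3" using c(2) by (meson obtain_subset_with_card_n)
  obtain D where D: "D \<subseteq> L - K" "card D = 3" using c(3) by (meson obtain_subset_with_card_n)
  have fin: "finite C" "finite D" using C D by (auto intro: card_ge_0_finite)
  show ?thesis
  proof (rule not_toroidal_two_cliques[OF E K, where A = "insert x C" and v = y and B = "insert y
    (insert z D)"])
    show "card (insert x C) = 4" using fin C xyz S by (subst card_insert_disjoint) auto
    have "z \<notin> D" "y \<notin> insert z D" using D S xyz by auto
    then show "card (insert y (insert z D)) = 5" using fin D by simp
  qed (use C D S xyz in auto)
qed

section \<open>The graph of a direct product\<close>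

lemma RDirProd_simps [simp]:
  "carrier (RDirProd A B) = carrier A \<times> carrier B"
  "(a, b) \<otimes>\<^bsub>RDirProd A B\<^esub> (c, d) = (a \<otimes>\<^bsub>A\<^esub> c, b \<otimes>\<^bsub>B\<^esub> d)"
  "(a, b) \<oplus>\<^bsub>RDirProd A B\<^esub> (c, d) = (a \<oplus>\<^bsub>A\<^esub> c, b \<oplus>\<^bsub>B\<^esub> d)"
  "\<one>\<^bsub>RDirProd A B\<^esub> = (\<one>\<^bsub>A\<^esub>, \<one>\<^bsub>B\<^esub>)" "\<zero>\<^bsub>RDirProd A B\<^esub> = (\<zero>\<^bsub>A\<^esub>, \<zero>\<^bsub>B\<^esub>)"
  by (simp_all add: RDirProd_def DirProd_def monoid.defs)

lemma RDirProd_cring: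
  assumes "cring A" "cring B" shows "cring (RDirProd A B)"
proof -
  interpret A: cring A by fact
  interpret B: cring B by fact
  interpret ring "RDirProd A B" by (rule RDirProd_ring[OF A.ring_axioms B.ring_axioms])
  show ?thesis
    by (unfold_locales) (auto simp: A.m_comm B.m_comm)
qed

locale two_crings = A: cring A + B: cring B
  for A :: "('a, 'c) ring_scheme" and B :: "('b, 'd) ring_scheme"
begin

sublocale AB: cring "RDirProd A B"
  by (rule RDirProd_cring) unfold_locales

lemma nonunits_RDirProd:
  "nonunits (RDirProd A B) = nonunits A \<times> carrier B \<union> carrier A \<times> nonunits B"
proof -
  have "(a, b) \<in> Units (RDirProd A B) \<longleftrightarrow> a \<in> Units A \<and> b \<in> Units B" for a b
    unfolding Units_def by auto
  then show ?thesis unfolding nonunits_def by auto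
qed

lemma PIdl_RDirProd: "PIdl\<^bsub>RDirProd A B\<^esub> (a, b) = (PIdl\<^bsub>A\<^esub> a) \<times> (PIdl\<^bsub>B\<^esub> b)"
  unfolding cgenideal_def by auto

abbreviation "zA \<equiv> \<zero>\<^bsub>A\<^esub>"
abbreviation "zB \<equiv> \<zero>\<^bsub>B\<^esub>"
abbreviation "uA \<equiv> \<one>\<^bsub>A\<^esub>"
abbreviation "uB \<equiv> \<one>\<^bsub>B\<^esub>"
abbreviation "IA \<equiv> cgenideal A"
abbreviation "IB \<equiv> cgenideal B"
abbreviation "\<Gamma> \<equiv> upper_ideal_relation_graph (RDirProd A B)"

text \<open>A nonunit of the product has a nonunit component, and so has everything in its ideal, at
  the same place. The two sets need not be cliques; for drawings it is enough that they bound the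
  graph from above.\<close>

lemma edge_cases:
  assumes "e \<in> edges \<Gamma>"
  shows "card e = 2 \<and> (e \<subseteq> nonunits A \<times> carrier B \<or> e \<subseteq> carrier A \<times> nonunits B)"
proof -
  obtain x y a b where *: "e = {x, y}" "x \<noteq> y" "(a, b) \<in> nonunits (RDirProd A B)"
      "x \<in> (IA a) \<times> (IB b)" "y \<in> (IA a) \<times> (IB b)"
    using assms unfolding AB.upper_graph_edges by (auto simp: PIdl_RDirProd)
  have sub: "IA a \<subseteq> carrier A" "IB b \<subseteq> carrier B"
    using *(3) AB.nonunits_carrier by (auto simp: cgenideal_def)
  have "a \<in> nonunits A \<or> b \<in> nonunits B" using *(3) by (auto simp: nonunits_RDirProd)
  then have "(IA a) \<times> (IB b) \<subseteq> nonunits A \<times> carrier B \<or> (IA a) \<times> (IB b) \<subseteq> carrier A \<times> nonunits B"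
    using A.PIdl_subset_nonunits B.PIdl_subset_nonunits sub by blast
  then show ?thesis using * by auto
qed

lemma clique_left: "a \<in> nonunits A \<Longrightarrow> complete_edges ((IA a) \<times> carrier B) \<subseteq> edges \<Gamma>"
proof -
  assume "a \<in> nonunits A"
  then have "(a, uB) \<in> nonunits (RDirProd A B)" by (auto simp: nonunits_RDirProd)
  moreover have "IB uB = carrier B" unfolding cgenideal_def using B.r_one by force
  ultimately show ?thesis using AB.complete_edges_PIdl[of "(a, uB)"] by (simp add: PIdl_RDirProd)
qed

lemma clique_right: "b \<in> nonunits B \<Longrightarrow> complete_edges (carrier A \<times> (IB b)) \<subseteq> edges \<Gamma>"
proof -
  assume "b \<in> nonunits B"
  then have "(uA, b) \<in> nonunits (RDirProd A B)" by (auto simp: nonunits_RDirProd)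
  moreover have "IA uA = carrier A" unfolding cgenideal_def using A.r_one by force
  ultimately show ?thesis using AB.complete_edges_PIdl[of "(uA, b)"] by (simp add: PIdl_RDirProd)
qed

lemma edge_wf: "e \<in> edges \<Gamma> \<Longrightarrow> e \<subseteq> nonunits (RDirProd A B) \<and> card e = 2"
  by (rule AB.upper_graph_edge)

lemma embeds_two_cliques:
  assumes "embeds_in (V', E') W" "finite (carrier A)" "finite (carrier B)" "finite P" "finite Q"
    and "complete_edges P \<subseteq> E'" "complete_edges Q \<subseteq> E'" "P \<union> Q \<subseteq> V'"
    and "card (nonunits A) * card (nonunits B) \<le> card (P \<inter> Q)"
    and "card (nonunits A) * (card (carrier B) - card (nonunits B)) \<le> card (P - Q)"
    and "(card (carrier A) - card (nonunits A)) * card (nonunits B) \<le> card (Q - P)"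
  shows "embeds_in \<Gamma> W"
proof -
  let ?I = "nonunits A \<times> carrier B" and ?J = "carrier A \<times> nonunits B"
  note fin = finite_subset[OF A.nonunits_carrier assms(2)] finite_subset[OF B.nonunits_carrier assms(3)]
  have "?I \<inter> ?J = nonunits A \<times> nonunits B" "?I - ?J = nonunits A \<times> (carrier B - nonunits B)"
    "?J - ?I = (carrier A - nonunits A) \<times> nonunits B"
    using A.nonunits_carrier B.nonunits_carrier by auto
  then have "embeds_in (?I \<union> ?J, edges \<Gamma>) W"
    using assms fin edge_cases
    by (intro embeds_in_two_cliques[OF assms(1), where P = P and Q = Q])
       (simp_all add: card_cartesian_product card_Diff_subset A.nonunits_carrier B.nonunits_carrier)
  then show ?thesis unfolding AB.embeds_upper_graph_iff nonunits_RDirProd .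
qed

end

lemma complete_edges_segments:
  assumes "\<And>u v. u \<in> P \<Longrightarrow> v \<in> P \<Longrightarrow> u < v \<Longrightarrow> {u, v} \<in> E" shows "complete_edges P \<subseteq> (E :: nat set set)"
  using assms unfolding complete_edges_def by (auto, metis insert_commute linorder_neqE_nat)

lemma segment_edges_Cons: "segment_edges ((a, b, u, v) # es) = insert {u, v} (segment_edges es)"
  by (simp add: segment_edges_def)

lemma segment_edges_Nil: "segment_edges [] = {}"
  by (simp add: segment_edges_def)

lemma torus_cliques:
  "complete_edges {0, 1, 2, 3, 4, 5, 6} \<subseteq> segment_edges torus_segments"
  "complete_edges {0, 7, 8, 9} \<subseteq> segment_edges torus_segments"
  "complete_edges {0, 1, 7, 8} \<subseteq> segment_edges torus_segments"
  by (rule complete_edges_segments; elim insertE emptyE;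
      simp add: torus_segments_def segment_edges_Cons doubleton_eq_iff)+

lemma plane_edges: "segment_edges plane_segments = {{0,1},{0,2},{0,3},{1,2},{1,3},{2,3},{4,0},{4,1},{4,2},
    {5,0},{5,1},{5,3},{6,0},{6,2},{6,3},{7,0},{8,0},{9,0},{7,8},{7,9},{8,9}}"
  by (simp add: plane_segments_def segment_edges_Cons segment_edges_Nil)

lemma plane_cliques:
  "complete_edges {0, 1, 2, 3} \<subseteq> segment_edges plane_segments"
  "complete_edges {0, 7, 8, 9} \<subseteq> segment_edges plane_segments"
  "complete_edges {0, 1, 2, 4} \<subseteq> segment_edges plane_segments"
  "complete_edges {0, 1, 3, 5} \<subseteq> segment_edges plane_segments"
  by (rule complete_edges_segments; elim insertE emptyE; simp add: plane_edges doubleton_eq_iff)+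

section \<open>Finite commutative rings\<close>

context cring
begin

lemma card_ideal_dvd:
  assumes "ideal I R" shows "card I dvd card (carrier R)"
proof -
  interpret I: ideal I R by fact
  have "subgroup I (add_monoid R)" by (rule I.a_subgroup)
  then have "card (rcosets\<^bsub>add_monoid R\<^esub> I) * card I = card (carrier R)"
    using add.lagrange by (simp add: Coset.order_def)
  then show ?thesis by (metis dvd_triv_right)
qed

lemma card_PIdl_dvd: "z \<in> carrier R \<Longrightarrow> card (PIdl z) dvd card (carrier R)"
  by (intro card_ideal_dvd cgenideal_ideal)

lemma zero_in_PIdl: "z \<in> carrier R \<Longrightarrow> \<zero> \<in> PIdl z"
  unfolding cgenideal_def by (auto intro!: exI[of _ \<zero>])

lemma PIdl_zero: "PIdl \<zero> = {\<zero>}"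
  unfolding cgenideal_def by (auto intro!: exI[of _ \<zero>])

lemma PIdl_subset_carrier: "z \<in> carrier R \<Longrightarrow> PIdl z \<subseteq> carrier R"
  unfolding cgenideal_def by auto

lemma PIdl_eq_carrier_imp_Unit:
  assumes "z \<in> carrier R" "PIdl z = carrier R" shows "z \<in> Units R"
proof -
  have "\<one> \<in> PIdl z" using assms by simp
  then obtain r where "r \<in> carrier R" "\<one> = r \<otimes> z" unfolding cgenideal_def by blast
  then show ?thesis using assms m_comm[of r z] unfolding Units_def by auto
qed

lemma zero_nonunit_iff: "\<zero> \<in> nonunits R \<longleftrightarrow> \<one> \<noteq> \<zero>"
proof
  assume z: "\<zero> \<in> nonunits R"
  show "\<one> \<noteq> \<zero>" using z Units_one_closed unfolding nonunits_def by (metis DiffD2)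
next
  assume o: "\<one> \<noteq> \<zero>"
  have "\<zero> \<notin> Units R"
  proof
    assume "\<zero> \<in> Units R"
    then have "\<zero> \<otimes> inv \<zero> = \<one>" "inv \<zero> \<in> carrier R" using Units_r_inv Units_inv_closed by blast+
    then show False using o by simp
  qed
  then show "\<zero> \<in> nonunits R" by (simp add: nonunits_def)
qed

lemma one_neq_zero: "1 < card (carrier R) \<Longrightarrow> \<one> \<noteq> \<zero>"
  using one_zeroD by force

lemma one_not_nonunit: "\<one> \<notin> nonunits R"
  by (simp add: nonunits_def)

text \<open>The ideal is proper, so its order is a proper divisor and at most 2, while it contains
  both \<open>\<zero>\<close> and \<open>z\<close>.\<close>

lemma PIdl_nonunit_eq:
  assumes fin: "finite (carrier R)" and z: "z \<in> nonunits R"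
    and d: "\<And>d. d dvd card (carrier R) \<Longrightarrow> d \<noteq> card (carrier R) \<Longrightarrow> d \<le> 2"
  shows "PIdl z = {\<zero>, z}"
proof -
  have zR: "z \<in> carrier R" using z nonunits_carrier by blast
  have sub: "{\<zero>, z} \<subseteq> PIdl z" using zero_in_PIdl cgenideal_self zR by simp
  have ne: "PIdl z \<noteq> carrier R" using PIdl_eq_carrier_imp_Unit zR z by (auto simp: nonunits_def)
  then have "card (PIdl z) \<noteq> card (carrier R)"
    using card_subset_eq[OF fin PIdl_subset_carrier[OF zR]] by blast
  then have c: "card (PIdl z) \<le> 2" using d card_PIdl_dvd[OF zR] by blast
  have finP: "finite (PIdl z)" using fin PIdl_subset_carrier[OF zR] finite_subset by blast
  show ?thesis
  proof (cases "z = \<zero>")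
    case True
    then show ?thesis using PIdl_zero by simp
  next
    case False
    then show ?thesis using card_seteq[OF finP sub] c by simp
  qed
qed

lemma nonunits_prime_order:
  assumes p: "prime (card (carrier R))" shows "nonunits R = {\<zero>}"
proof -
  have fin: "finite (carrier R)" using p by (metis card.infinite not_prime_0)
  have one: "\<one> \<noteq> \<zero>" using one_neq_zero prime_gt_1_nat[OF p] by blast
  have "z = \<zero>" if z: "z \<in> nonunits R" for z
  proof -
    have zR: "z \<in> carrier R" using z nonunits_carrier by blast
    have "card (PIdl z) \<noteq> card (carrier R)"
      using card_subset_eq[OF fin PIdl_subset_carrier[OF zR]] PIdl_eq_carrier_imp_Unit[OF zR] z
      by (auto simp: nonunits_def)
    then have "card (PIdl z) = 1" using card_PIdl_dvd[OF zR] p by (metis prime_nat_iff)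
    then show ?thesis using zero_in_PIdl[OF zR] cgenideal_self[OF zR] by (metis card_1_singletonE
      singletonD)
  qed
  then show ?thesis using zero_nonunit_iff one by blast
qed

lemma nat_multiple_mod:
  assumes "finite (carrier R)"
  shows "add_pow R (n mod card (carrier R)) \<one> = add_pow R (n) \<one>"
proof -
  let ?p = "card (carrier R)"
  have p0: "add_pow R (?p) \<one> = \<zero>"
    using add.pow_order_eq_1[of \<one>] by (simp add: Coset.order_def)
  have "add_pow R (?p * (n div ?p)) \<one> = add_pow R (n div ?p) (add_pow R (?p) \<one>)"
    by (simp add: add.nat_pow_pow)
  also have "\<dots> = \<zero>" unfolding p0 by simp
  finally have "add_pow R (?p * (n div ?p)) \<one> \<oplus> add_pow R (n mod ?p) \<one> = add_pow R (n mod ?p) \<one>"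
    by simp
  then show ?thesis by (subst (asm) add.nat_pow_mult) simp_all
qed

lemma prime_order_iso:
  assumes p: "prime (card (carrier R))"
  shows "R \<simeq> Zmod (int (card (carrier R)))"
proof -
  let ?p = "card (carrier R)"
  interpret Z: residues_prime ?p "Zmod (int ?p)" by unfold_locales (use p in auto)
  have fin: "finite (carrier R)" using p by (metis card.infinite not_prime_0)
  have one: "\<one> \<noteq> \<zero>" using one_neq_zero prime_gt_1_nat[OF p] by blast
  define h where "h k = add_pow R (nat k) \<one>" for k :: int
  have car: "carrier (Zmod (int ?p)) = {0..int ?p - 1}" by (rule Z.res_carrier_eq)
  have hmod: "h (k mod int ?p) = h k" if "0 \<le> k" for k
    unfolding h_def using nat_multiple_mod[OF fin, of "nat k"] that by (simp add: nat_mod_distrib)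
  have nz: "h d \<noteq> \<zero>" if d: "0 < d" "d < int ?p" for d
  proof
    assume h0: "h d = \<zero>"
    \<comment> \<open>An inverse \<open>x\<close> of \<open>d\<close> modulo the order turns
      \<open>h d = \<zero>\<close> into \<open>\<one> = \<zero>\<close>.\<close>
    have "coprime (nat d) ?p"
      using d p by (metis coprime_commute nat_dvd_not_less nat_less_iff prime_imp_coprime_nat
        zero_less_nat_eq less_imp_le)
    then obtain x where x: "[nat d * x = Suc 0] (mod ?p)"
      using cong_solve_coprime_nat by blast
    have "add_pow R (nat d * x) \<one> = add_pow R (x) (add_pow R (nat d) \<one>)" by (simp add: add.nat_pow_pow)
    also have "\<dots> = \<zero>" using h0 unfolding h_def by simp
    finally have "add_pow R ((nat d * x) mod ?p) \<one> = \<zero>" using nat_multiple_mod[OF fin] by simp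
    moreover have "(nat d * x) mod ?p = 1" using x prime_gt_1_nat[OF p] by (simp add: Cong.cong_def)
    ultimately show False using one by simp
  qed
  have closed: "h k \<in> carrier R" for k unfolding h_def by simp
  have add: "h (k + l) = h k \<oplus> h l" if "0 \<le> k" "0 \<le> l" for k l
    using that unfolding h_def by (simp add: nat_add_distrib add.nat_pow_mult)
  have inj: "inj_on h {0..int ?p - 1}"
  proof (rule linorder_inj_onI)
    fix k l :: int assume kl: "k < l" "k \<in> {0..int ?p - 1}" "l \<in> {0..int ?p - 1}"
    have "h l = h k \<oplus> h (l - k)" using add[of k "l - k"] kl by simp
    moreover have "h (l - k) \<noteq> \<zero>" using kl by (intro nz) auto
    ultimately show "h k \<noteq> h l" using closed by (metis add.l_cancel_one')
  qed auto
  then have "card (h ` {0..int ?p - 1}) = ?p" by (simp add: card_image)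
  then have "h ` {0..int ?p - 1} = carrier R" using closed by (intro card_subset_eq[OF fin]) auto
  then have "bij_betw h (carrier (Zmod (int ?p))) (carrier R)" unfolding car using inj by (simp add:
    bij_betw_def)
  moreover have "h (k \<otimes>\<^bsub>Zmod (int ?p)\<^esub> l) = h k \<otimes> h l" if "k \<in> {0..int ?p - 1}" "l \<in> {0..int ?p - 1}"
    for k l
  proof -
    have "h (k \<otimes>\<^bsub>Zmod (int ?p)\<^esub> l) = h (k * l)" unfolding Z.res_mult_eq using that by (intro hmod) simp
    also have "\<dots> = h k \<otimes> h l"
      using that unfolding h_def by (simp add: nat_mult_distrib add_pow_ldistr add.nat_pow_pow mult.commute)
    finally show ?thesis .
  qed
  moreover have "h (k \<oplus>\<^bsub>Zmod (int ?p)\<^esub> l) = h k \<oplus> h l" if "k \<in> {0..int ?p - 1}" "l \<in> {0..int ?p - 1}"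
    for k l
    unfolding Z.res_add_eq using that add hmod[of "k + l"] by simp
  moreover have "h \<one>\<^bsub>Zmod (int ?p)\<^esub> = \<one>" unfolding Z.res_one_eq h_def by simp
  ultimately have "h \<in> ring_iso (Zmod (int ?p)) R"
    using closed unfolding car by (intro ring_iso_memI) (auto simp: car)
  then have "Zmod (int ?p) \<simeq> R" unfolding is_ring_iso_def by blast
  then show ?thesis using ring_iso_sym Z.ring_axioms by blast
qed

section \<open>Local rings of order four\<close>

lemma dvd_4_le_2: "d dvd 4 \<Longrightarrow> d \<noteq> 4 \<Longrightarrow> d \<le> (2::nat)"
proof -
  assume "d dvd 4" "d \<noteq> 4"
  then have "d \<le> 4" "d \<noteq> 3" by (auto dest: dvd_imp_le)
  then show ?thesis using \<open>d \<noteq> 4\<close> by simp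
qed

lemma PIdl_order_4:
  assumes "card (carrier R) = 4" "z \<in> nonunits R" shows "PIdl z = {\<zero>, z}"
  using assms dvd_4_le_2 by (intro PIdl_nonunit_eq) (auto intro: card_ge_0_finite)

definition local4_elem :: "'a \<Rightarrow> bool \<times> bool \<Rightarrow> 'a" where
  "local4_elem b = (\<lambda>(i, j). (if i then \<one> else \<zero>) \<oplus> (if j then b else \<zero>))"

text \<open>Every element is written with two binary digits, for \<open>\<one>\<close> and for
  \<open>b\<close>. Both tables are forced except for \<open>\<one> \<oplus> \<one>\<close>, which
  is \<open>\<zero>\<close> or \<open>b\<close>; in the second case \<open>i \<and> k\<close> is a
  carry into the digit of \<open>b\<close>.\<close>

lemma local_order_4:
  assumes c: "card (carrier R) = 4" and N: "nonunits R = {\<zero>, b}" "b \<noteq> \<zero>"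
  shows "bij_betw (local4_elem b) UNIV (carrier R)"
    and "local4_elem b (i, j) \<oplus> local4_elem b (k, l) =
      local4_elem b (i \<noteq> k, (j \<noteq> l) \<noteq> (\<one> \<oplus> \<one> \<noteq> \<zero> \<and> i \<and> k))"
    and "local4_elem b (i, j) \<otimes> local4_elem b (k, l) = local4_elem b (i \<and> k, (i \<and> l) \<noteq> (j \<and> k))"
proof -
  have bR: "b \<in> carrier R" using N nonunits_carrier by blast
  have one: "\<one> \<noteq> \<zero>" using zero_nonunit_iff N by blast
  have b1: "\<one> \<noteq> b" using one_not_nonunit N by blast
  have unit: "x \<in> Units R" if "x \<in> carrier R" "x \<noteq> \<zero>" "x \<noteq> b" for x
    using that N unfolding nonunits_def by auto
  have multb: "x \<otimes> b = \<zero> \<or> x \<otimes> b = b" if "x \<in> carrier R" for x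
    using PIdl_order_4[OF c, of b] N that unfolding cgenideal_def by blast
  have unitb: "x \<otimes> b \<noteq> \<zero>" if "x \<in> Units R" for x
  proof
    assume "x \<otimes> b = \<zero>"
    then have "inv x \<otimes> (x \<otimes> b) = \<zero>" using that by simp
    moreover have "inv x \<otimes> (x \<otimes> b) = b" using that bR by (simp add: Units_closed flip: m_assoc)
    ultimately show False using N(2) by simp
  qed
  have dbl: "(\<one> \<oplus> \<one>) \<otimes> b = b \<oplus> b" using bR by (simp add: l_distr)
  have bb: "b \<oplus> b = \<zero>"
    using multb[of "\<one> \<oplus> \<one>"] bR N(2) unfolding dbl by (metis add.l_cancel_one add.m_closed one_closed)
  have two: "\<one> \<oplus> \<one> = (if \<one> \<oplus> \<one> = \<zero> then \<zero> else b)"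
    using unitb[of "\<one> \<oplus> \<one>"] unit[of "\<one> \<oplus> \<one>"] unfolding dbl bb by auto
  have sq: "b \<otimes> b = \<zero>"
  proof (rule ccontr)
    assume "b \<otimes> b \<noteq> \<zero>"
    then have e: "b \<otimes> b = b" using multb bR by blast
    \<comment> \<open>If \<open>b\<close> were idempotent, \<open>\<one> \<oplus> b\<close> would
      annihilate \<open>b\<close> and so be one of the nonunits \<open>\<zero>\<close> and
      \<open>b\<close>; both are impossible.\<close>
    have "(\<one> \<oplus> b) \<otimes> b = \<zero>" using bR e bb by (simp add: l_distr)
    then have "\<one> \<oplus> b \<notin> Units R" using unitb by blast
    then have "\<one> \<oplus> b = \<zero> \<or> \<one> \<oplus> b = b" using unit[of "\<one> \<oplus> b"] bR by auto
    then have "\<one> \<oplus> b = \<zero>" using one bR add.r_cancel[of b \<one> \<zero>] by auto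
    then have "\<one> \<oplus> (b \<oplus> b) = b" using bR by (simp add: a_assoc[symmetric])
    then show False using bb b1 by simp
  qed
  have bbx: "b \<oplus> (b \<oplus> x) = x" if "x \<in> carrier R" for x
    using bb bR that by (simp add: a_assoc[symmetric])
  have c1: "\<one> \<oplus> b \<noteq> \<zero>" "\<one> \<oplus> b \<noteq> \<one>" "\<one> \<oplus> b \<noteq> b"
  proof -
    have "\<one> \<oplus> b \<noteq> b \<oplus> b" using add.r_cancel[of b \<one> b] bR b1 by simp
    then show "\<one> \<oplus> b \<noteq> \<zero>" unfolding bb .
    show "\<one> \<oplus> b \<noteq> \<one>" "\<one> \<oplus> b \<noteq> b"
      using add.l_cancel[of \<one> b \<zero>] add.r_cancel[of b \<one> \<zero>] bR one N(2) by auto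
  qed
  have inj: "inj (local4_elem b)"
    unfolding local4_elem_def using one N(2) b1 c1 bR
    by (auto simp: inj_on_def split: if_splits)
  have "local4_elem b ` UNIV \<subseteq> carrier R" using bR by (auto simp: local4_elem_def)
  moreover have "card (local4_elem b ` UNIV) = 4" using inj by (simp add: card_image card_UNIV_bool)
  ultimately have "local4_elem b ` UNIV = carrier R"
    using c by (intro card_subset_eq) (auto intro: card_ge_0_finite)
  then show "bij_betw (local4_elem b) UNIV (carrier R)" using inj by (simp add: bij_betw_def)
  have two': "\<one> \<oplus> \<one> = b" if "\<one> \<oplus> \<one> \<noteq> \<zero>" using two that by simp
  define p q where "p i = (if i then \<one> else \<zero>)" and "q i = (if i then b else \<zero>)" for i
  have pq: "p i \<in> carrier R" "q i \<in> carrier R" for i using bR by (auto simp: p_def q_def)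
  have pp: "p i \<oplus> p k = p (i \<noteq> k) \<oplus> q (\<one> \<oplus> \<one> \<noteq> \<zero> \<and> i \<and> k)" for i k
    using two' bR by (auto simp: p_def q_def)
  have qq: "q i \<oplus> q k = q (i \<noteq> k)" for i k using bb bR by (auto simp: q_def)
  have e: "local4_elem b (i, j) = p i \<oplus> q j" for i j by (simp add: local4_elem_def p_def q_def)
  have "local4_elem b (i, j) \<oplus> local4_elem b (k, l) = (p i \<oplus> p k) \<oplus> (q j \<oplus> q l)"
    unfolding e using pq by (simp add: a_assoc a_lcomm)
  also have "\<dots> = p (i \<noteq> k) \<oplus> (q (j \<noteq> l) \<oplus> q (\<one> \<oplus> \<one> \<noteq> \<zero> \<and> i \<and> k))"
    unfolding pp qq[of j l] using a_assoc[OF pq(1) pq(2) pq(2)] a_comm[OF pq(2) pq(2)] by metis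
  finally show "local4_elem b (i, j) \<oplus> local4_elem b (k, l) =
      local4_elem b (i \<noteq> k, (j \<noteq> l) \<noteq> (\<one> \<oplus> \<one> \<noteq> \<zero> \<and> i \<and> k))"
    unfolding qq e by simp
  show "local4_elem b (i, j) \<otimes> local4_elem b (k, l) = local4_elem b (i \<and> k, (i \<and> l) \<noteq> (j \<and> k))"
    using bR bb sq
    by (cases i; cases j; cases k; cases l) (simp_all add: local4_elem_def l_distr r_distr a_assoc bbx)
qed

end

lemma local_order_4_iso:
  assumes A: "cring A" "card (carrier A) = 4" "nonunits A = {\<zero>\<^bsub>A\<^esub>, a}" "a \<noteq> \<zero>\<^bsub>A\<^esub>"
    and B: "cring B" "card (carrier B) = 4" "nonunits B = {\<zero>\<^bsub>B\<^esub>, b}" "b \<noteq> \<zero>\<^bsub>B\<^esub>"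
    and two: "\<one>\<^bsub>A\<^esub> \<oplus>\<^bsub>A\<^esub> \<one>\<^bsub>A\<^esub> = \<zero>\<^bsub>A\<^esub> \<longleftrightarrow> \<one>\<^bsub>B\<^esub> \<oplus>\<^bsub>B\<^esub> \<one>\<^bsub>B\<^esub> = \<zero>\<^bsub>B\<^esub>"
  shows "A \<simeq> B"
proof -
  interpret A: cring A by fact
  interpret B: cring B by fact
  let ?f = "A.local4_elem a" and ?g = "B.local4_elem b"
  note fa = A.local_order_4[OF A(2-4)] and gb = B.local_order_4[OF B(2-4)]
  define h where "h = ?g \<circ> inv_into UNIV ?f"
  have inj: "inj ?f" using fa(1) by (simp add: bij_betw_def)
  have h: "h (?f x) = ?g x" for x unfolding h_def by (simp add: inj)
  have ex: "\<exists>i j. x = ?f (i, j)" if "x \<in> carrier A" for x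
    using fa(1) that unfolding bij_betw_def by (metis imageE surj_pair)
  have bij: "bij_betw h (carrier A) (carrier B)"
    unfolding h_def by (rule bij_betw_trans[OF bij_betw_inv_into[OF fa(1)] gb(1)])
  have "h \<in> ring_iso A B"
  proof (rule ring_iso_memI)
    show "h x \<in> carrier B" if "x \<in> carrier A" for x using bij that by (auto simp: bij_betw_def)
    show "h (x \<otimes>\<^bsub>A\<^esub> y) = h x \<otimes>\<^bsub>B\<^esub> h y" if xy: "x \<in> carrier A" "y \<in> carrier A" for x y
    proof -
      obtain i j k l where "x = ?f (i, j)" "y = ?f (k, l)" using ex[OF xy(1)] ex[OF xy(2)] by blast
      then show ?thesis by (simp only: fa(3) gb(3) h)
    qed
    show "h (x \<oplus>\<^bsub>A\<^esub> y) = h x \<oplus>\<^bsub>B\<^esub> h y" if xy: "x \<in> carrier A" "y \<in> carrier A" for x y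
    proof -
      obtain i j k l where "x = ?f (i, j)" "y = ?f (k, l)" using ex[OF xy(1)] ex[OF xy(2)] by blast
      then show ?thesis by (simp only: fa(2) gb(2) h two)
    qed
    have "?f (True, False) = \<one>\<^bsub>A\<^esub>" "?g (True, False) = \<one>\<^bsub>B\<^esub>"
      by (simp_all add: A.local4_elem_def B.local4_elem_def)
    then show "h \<one>\<^bsub>A\<^esub> = \<one>\<^bsub>B\<^esub>" using h by metis
  qed (rule bij)
  then show ?thesis unfolding is_ring_iso_def by blast
qed

lemma Zmod_4:
  shows "cring (Zmod 4)" "card (carrier (Zmod 4)) = 4" "nonunits (Zmod 4) = {\<zero>\<^bsub>Zmod 4\<^esub>, 2}"
    "2 \<noteq> \<zero>\<^bsub>Zmod 4\<^esub>" "\<one>\<^bsub>Zmod 4\<^esub> \<oplus>\<^bsub>Zmod 4\<^esub> \<one>\<^bsub>Zmod 4\<^esub> \<noteq> \<zero>\<^bsub>Zmod 4\<^esub>"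
proof -
  interpret Z: residues 4 "Zmod 4" by unfold_locales auto
  show "cring (Zmod 4)" by (rule Z.cring)
  show "card (carrier (Zmod 4)) = 4" by (simp add: Z.res_carrier_eq)
  have "{0..4 - 1 :: int} = {0, 1, 2, 3}" by auto
  moreover have "\<not> coprime (2::int) 4" by (rule not_coprimeI[of 2]) auto
  moreover have "coprime (3::int) 4"
  proof (rule coprimeI)
    fix c :: int assume "c dvd 3" "c dvd 4"
    then show "is_unit c" using dvd_diff[of c 4 3] by simp
  qed
  ultimately show "nonunits (Zmod 4) = {\<zero>\<^bsub>Zmod 4\<^esub>, 2}"
    unfolding nonunits_def Z.res_carrier_eq Z.res_units_eq Z.res_zero_eq by auto
  show "2 \<noteq> \<zero>\<^bsub>Zmod 4\<^esub>" "\<one>\<^bsub>Zmod 4\<^esub> \<oplus>\<^bsub>Zmod 4\<^esub> \<one>\<^bsub>Zmod 4\<^esub> \<noteq> \<zero>\<^bsub>Zmod 4\<^esub>"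
    by (simp_all add: Z.res_zero_eq Z.res_one_eq Z.res_add_eq)
qed

lemma Z2_dual_numbers:
  defines "R \<equiv> Z2_dual_numbers"
  shows "cring R" "card (carrier R) = 4" "\<exists>x. nonunits R = {\<zero>\<^bsub>R\<^esub>, x} \<and> x \<noteq> \<zero>\<^bsub>R\<^esub>"
    "\<one>\<^bsub>R\<^esub> \<oplus>\<^bsub>R\<^esub> \<one>\<^bsub>R\<^esub> = \<zero>\<^bsub>R\<^esub>"
proof -
  interpret K: residues_prime 2 "Zmod 2" by unfold_locales auto
  interpret K: field "Zmod 2" using K.is_field by simp
  define P where "P = poly_ring (Zmod 2)"
  define t where "t = X\<^bsub>Zmod 2\<^esub>"
  interpret P: domain P unfolding P_def by (rule K.univ_poly_is_domain[OF K.carrier_is_subring])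
  have tP: "t \<in> carrier P" unfolding t_def P_def by (rule K.var_closed[OF K.carrier_is_subring])
  define I where "I = Idl\<^bsub>P\<^esub> {t [^]\<^bsub>P\<^esub> (2::nat)}"
  have t2: "t [^]\<^bsub>P\<^esub> (2::nat) = t \<otimes>\<^bsub>P\<^esub> t" using tP by (simp add: numeral_2_eq_2)
  have I_PIdl: "I = PIdl\<^bsub>P\<^esub> (t \<otimes>\<^bsub>P\<^esub> t)" unfolding I_def t2 using tP by (simp add: P.cgenideal_eq_genideal)
  interpret I: ideal I P unfolding I_PIdl using tP by (intro P.cgenideal_ideal) simp
  define D where "D = P Quot I"
  have D: "R = D" unfolding R_def Z2_dual_numbers_def D_def I_def P_def t_def Let_def ..
  interpret D: cring D unfolding D_def by (rule I.quotient_is_cring) unfold_locales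
  let ?z = "\<zero>\<^bsub>D\<^esub>" and ?u = "\<one>\<^bsub>D\<^esub>" and ?q = "t \<otimes>\<^bsub>P\<^esub> t"
  define c where "c r = I +>\<^bsub>P\<^esub> r" for r
  have c_hom: "c \<in> ring_hom P D" unfolding c_def D_def by (rule I.rcos_ring_hom)
  have c0: "c r = ?z \<longleftrightarrow> r \<in> I" if "r \<in> carrier P" for r
    unfolding c_def D_def FactRing_def using that I.a_rcos_const I.a_rcos_self by auto
  have c1: "c \<one>\<^bsub>P\<^esub> = ?u" by (rule ring_hom_one[OF c_hom])
  have t_unit: "t \<notin> Units P"
    using K.univ_poly_units[OF K.carrier_is_subfield] unfolding P_def t_def var_def by auto
  have t_notin: "t \<notin> I"
  proof
    assume "t \<in> I"
    then obtain f where f: "f \<in> carrier P" "t = f \<otimes>\<^bsub>P\<^esub> ?q" unfolding I_PIdl cgenideal_def by blast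
    have t0: "t \<noteq> \<zero>\<^bsub>P\<^esub>" unfolding t_def P_def var_def univ_poly_zero by simp
    \<comment> \<open>Cancelling one factor \<open>t\<close> would make \<open>t\<close> a unit, but
      the units of a polynomial ring over a field are constants.\<close>
    have "t \<otimes>\<^bsub>P\<^esub> \<one>\<^bsub>P\<^esub> = t \<otimes>\<^bsub>P\<^esub> (f \<otimes>\<^bsub>P\<^esub> t)" using f tP by (simp add: P.m_lcomm)
    then have "\<one>\<^bsub>P\<^esub> = f \<otimes>\<^bsub>P\<^esub> t" using P.m_lcancel[OF t0 tP, of "\<one>\<^bsub>P\<^esub>" "f \<otimes>\<^bsub>P\<^esub> t"] f(1) tP by blast
    then have "t \<in> Units P" using f(1) tP P.m_comm unfolding Units_def by auto
    then show False using t_unit by blast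
  qed
  then have "\<one>\<^bsub>P\<^esub> \<notin> I" using I.one_imp_carrier tP by blast
  then have D1: "?u \<noteq> ?z" using c0 c1 by force
  define x where "x = c t"
  have x: "x \<in> carrier D" "x \<noteq> ?z"
    unfolding x_def using ring_hom_closed[OF c_hom tP] c0[OF tP] t_notin by auto
  have xx: "x \<otimes>\<^bsub>D\<^esub> x = ?z"
  proof -
    have "?q \<in> I" unfolding I_PIdl using tP by (simp add: P.cgenideal_self)
    then show ?thesis unfolding x_def ring_hom_mult[OF c_hom tP tP, symmetric] using c0 tP by simp
  qed
  have two: "?u \<oplus>\<^bsub>D\<^esub> ?u = ?z"
  proof -
    have "\<one>\<^bsub>P\<^esub> \<oplus>\<^bsub>P\<^esub> \<one>\<^bsub>P\<^esub> = \<zero>\<^bsub>P\<^esub>"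
      unfolding P_def univ_poly_one univ_poly_add univ_poly_zero by (simp add: K.res_add_eq K.res_one_eq
        K.res_zero_eq)
    then show ?thesis unfolding c1[symmetric] ring_hom_add[OF c_hom P.one_closed P.one_closed, symmetric]
      using c0 I.zero_closed by simp
  qed
  have yy: "y \<oplus>\<^bsub>D\<^esub> y = ?z" if "y \<in> carrier D" for y
    using D.l_distr[OF D.one_closed D.one_closed that] that two by simp
  have x1: "x \<noteq> ?u" using xx D1 D.l_one by force
  have s: "?u \<oplus>\<^bsub>D\<^esub> x \<noteq> ?z" "?u \<oplus>\<^bsub>D\<^esub> x \<noteq> ?u" "?u \<oplus>\<^bsub>D\<^esub> x \<noteq> x"
    using D.add.l_cancel[of "?u" x "?u"] D.add.l_cancel[of "?u" x "?z"] D.add.r_cancel[of x "?u" "?z"]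
      two x x1 D1 by auto
  let ?S = "{?z, ?u, x, ?u \<oplus>\<^bsub>D\<^esub> x}"
  have S: "?S \<subseteq> carrier D" "card ?S = 4" using x s D1 x1 by auto
  have kK: "k \<in> carrier (Zmod 2) \<longleftrightarrow> k = 0 \<or> k = 1" for k unfolding K.res_carrier_eq by auto
  \<comment> \<open>The four remainders modulo \<open>X^2\<close>, as coefficient lists with the
    leading coefficient first: 0, 1, X and X + 1.\<close>
  have "carrier D \<subseteq> c ` {[], [1], [1, 0], [1, 1]}"
  proof
    fix y assume "y \<in> carrier D"
    then obtain f where f: "f \<in> carrier P" "y = c f"
      unfolding D_def FactRing_def c_def A_RCOSETS_def' by auto
    have "[] = \<zero>\<^bsub>P\<^esub>" "t \<noteq> []" by (simp_all add: P_def t_def var_def univ_poly_zero)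
    then have q: "?q \<in> carrier P" "?q \<noteq> []"
      using tP P.integral_iff by auto
    have deg: "length ?q - 1 = 2"
      unfolding t2[symmetric] unfolding t_def P_def
      by (subst K.unitary_monom_eq_var_pow[OF K.carrier_is_subring, symmetric]) (simp add: K.monom_def)
    obtain b r where br: "b \<in> carrier P" "r \<in> carrier P" "K.long_divides f ?q (b, r)"
      using K.exists_long_division[OF K.carrier_is_subfield f(1)[unfolded P_def] q(1)[unfolded P_def]] q(2)
      unfolding P_def by auto
    then have r: "f = (?q \<otimes>\<^bsub>P\<^esub> b) \<oplus>\<^bsub>P\<^esub> r" "r = [] \<or> length r - 1 < 2"
      unfolding K.long_divides_def deg P_def[symmetric] by auto
    have "?q \<otimes>\<^bsub>P\<^esub> b \<in> I" unfolding I_PIdl cgenideal_def using br tP P.m_comm by auto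
    then have "c (?q \<otimes>\<^bsub>P\<^esub> b) = ?z" using c0 br tP by simp
    then have "y = c r"
      unfolding f(2) r(1) using br tP ring_hom_add[OF c_hom, of "?q \<otimes>\<^bsub>P\<^esub> b" r] ring_hom_closed[OF c_hom
        br(2)]
      by simp
    moreover have "r \<in> {[], [1], [1, 0], [1, 1]}"
    proof -
      have "polynomial\<^bsub>Zmod 2\<^esub> (carrier (Zmod 2)) r" using br(2) unfolding P_def univ_poly_def by simp
      then have rr: "set r \<subseteq> carrier (Zmod 2)" "r \<noteq> [] \<Longrightarrow> hd r \<noteq> 0"
        unfolding polynomial_def K.res_zero_eq by auto
      have "length r \<le> 2" using r(2) by auto
      then consider "r = []" | k where "r = [k]" | k l where "r = [k, l]"
        by (cases r; cases "tl r"; auto simp: Suc_le_eq)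
      then show ?thesis using rr by cases (auto simp: kK)
    qed
    ultimately show "y \<in> c ` {[], [1], [1, 0], [1, 1]}" by blast
  qed
  then have "card (carrier D) \<le> card (c ` {[], [1], [1, 0], [1, 1]})" by (intro card_mono) auto
  also have "\<dots> \<le> card {[], [1], [1, 0], [1, 1 :: int]}" by (intro card_image_le) simp
  finally have card_le: "card (carrier D) \<le> 4" by simp
  have fin: "finite (carrier D)"
    using \<open>carrier D \<subseteq> c ` {[], [1], [1, 0], [1, 1]}\<close> by (rule finite_subset) simp
  have carD: "carrier D = ?S" using card_seteq[OF fin S(1)] card_le S(2) by simp
  have "x \<notin> Units D"
  proof
    assume u: "x \<in> Units D"
    then have "inv\<^bsub>D\<^esub> x \<otimes>\<^bsub>D\<^esub> (x \<otimes>\<^bsub>D\<^esub> x) = x" using x by (simp flip: D.m_assoc)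
    then show False using u x(2) unfolding xx by simp
  qed
  moreover have "?u \<oplus>\<^bsub>D\<^esub> x \<in> Units D"
  proof -
    have "(?u \<oplus>\<^bsub>D\<^esub> x) \<otimes>\<^bsub>D\<^esub> (?u \<oplus>\<^bsub>D\<^esub> x) = ?u \<oplus>\<^bsub>D\<^esub> (x \<oplus>\<^bsub>D\<^esub> x) \<oplus>\<^bsub>D\<^esub> x \<otimes>\<^bsub>D\<^esub> x"
      using x(1) by (simp add: D.l_distr D.r_distr D.a_assoc)
    then show ?thesis using x(1) yy[OF x(1)] unfolding xx Units_def by auto
  qed
  ultimately have N: "nonunits D = {?z, x}"
    using D.zero_nonunit_iff D1 D.Units_one_closed x unfolding nonunits_def carD by auto
  show "cring R" unfolding D by unfold_locales
  show "card (carrier R) = 4" unfolding D carD by (rule S(2))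
  show "\<exists>x. nonunits R = {\<zero>\<^bsub>R\<^esub>, x} \<and> x \<noteq> \<zero>\<^bsub>R\<^esub>"
    unfolding D using N x(2) by blast
  show "\<one>\<^bsub>R\<^esub> \<oplus>\<^bsub>R\<^esub> \<one>\<^bsub>R\<^esub> = \<zero>\<^bsub>R\<^esub>"
    unfolding D by (rule two)
qed

context cring
begin

section \<open>Splitting a ring that is not local\<close>

lemma finite_PIdl: "finite (carrier R) \<Longrightarrow> z \<in> carrier R \<Longrightarrow> finite (PIdl z)"
  using finite_subset[OF PIdl_subset_carrier] .

lemma power_idempotent:
  assumes fin: "finite (carrier R)" and a: "a \<in> carrier R"
  obtains k :: nat where "0 < k" "a [^] k \<otimes> a [^] k = a [^] k"
proof -
  have "\<not> inj_on (\<lambda>n::nat. a [^] n) UNIV"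
    using a fin finite_imageD[of "\<lambda>n::nat. a [^] n" UNIV] finite_subset[of "range (\<lambda>n::nat. a [^] n)"
      "carrier R"] by auto
  then obtain i j :: nat where ij: "i < j" "a [^] i = a [^] j"
    unfolding inj_on_def by (metis linorder_neqE_nat)
  define d where "d = j - i"
  have d: "0 < d" "i + d = j" using ij by (auto simp: d_def)
  have step: "a [^] (n + d) = a [^] n" if n: "i \<le> n" for n
  proof -
    obtain m where m: "n = i + m" using n nat_le_iff_add by blast
    have "a [^] (n + d) = a [^] j \<otimes> a [^] m"
    proof -
      have "n + d = j + m" using d m by linarith
      then show ?thesis unfolding nat_pow_mult[OF a] by (simp only:)
    qed
    also have "\<dots> = a [^] n" unfolding ij(2)[symmetric] nat_pow_mult[OF a] m ..
    finally show ?thesis .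
  qed
  have steps: "a [^] (n + d * c) = a [^] n" if "i \<le> n" for n c :: nat
  proof (induction c)
    case (Suc c)
    then show ?case using step[of "n + d * c"] that by (simp add: add_ac)
  qed simp
  \<comment> \<open>The powers of \<open>a\<close> repeat with period \<open>d\<close> from exponent
    \<open>i\<close> on. This \<open>k\<close> is a multiple of the period beyond \<open>i\<close>,
    so doubling the exponent \<open>k\<close> changes nothing; \<open>Suc\<close> keeps it positive
    when \<open>i\<close> is 0.\<close>
  define k where "k = d * Suc i"
  have "i \<le> k" using d(1) by (cases d) (auto simp: k_def)
  then have "a [^] k \<otimes> a [^] k = a [^] k" using steps[of k "Suc i"] a by (simp add: nat_pow_mult k_def)
  moreover have "0 < k" using d by (simp add: k_def)
  ultimately show thesis using that by blast
qed

text \<open>With only trivial idempotents, every nonunit is nilpotent; then two nonunits cannot add up to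
  a unit, so the nonunits form the unique maximal ideal.\<close>
lemma nonunit_plus_nonunit:
  assumes fin: "finite (carrier R)" and idem: "\<And>e. e \<in> carrier R \<Longrightarrow> e \<otimes> e = e \<Longrightarrow> e = \<zero> \<or> e = \<one>"
    and ab: "a \<in> nonunits R" "b \<in> nonunits R"
  shows "a \<oplus> b \<noteq> \<one>"
proof
  assume one: "a \<oplus> b = \<one>"
  have aR: "a \<in> carrier R" and bR: "b \<in> carrier R" using ab nonunits_carrier by blast+
  have unit: "x \<in> Units R" if k: "x [^] k = \<one>" "0 < k" "x \<in> carrier R" for x and k :: nat
  proof -
    obtain m where "k = Suc m" using k(2) by (cases k) auto
    then have "x [^] m \<otimes> x = \<one>" "x \<otimes> x [^] m = \<one>" using k m_comm by auto
    then show ?thesis using k(3) unfolding Units_def by auto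
  qed
  have nil: "\<exists>k::nat. x [^] k = \<zero> \<and> 0 < k" if "x \<in> nonunits R" for x
  proof -
    have xR: "x \<in> carrier R" using that nonunits_carrier by blast
    obtain k :: nat where k: "0 < k" "x [^] k \<otimes> x [^] k = x [^] k" using power_idempotent[OF fin xR] by
      blast
    then show ?thesis using idem[of "x [^] k"] unit[of x k] xR that by (auto simp: nonunits_def)
  qed
  \<comment> \<open>The last nonzero power \<open>a [^] m\<close> absorbs \<open>b\<close>:
    multiplying \<open>a \<oplus> b = \<one>\<close> by it gives
    \<open>b \<otimes> a [^] m = a [^] m\<close>, which contradicts that \<open>b\<close> is
    nilpotent.\<close>
  define k where "k = (LEAST k::nat. a [^] k = \<zero>)"
  have k: "a [^] k = \<zero>" unfolding k_def using nil[OF ab(1)] by (metis (mono_tags, lifting) LeastI)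
  have "k \<noteq> 0"
  proof
    assume "k = 0"
    then have "\<one> = \<zero>" using k by simp
    then show False using ab(1) zero_nonunit_iff one_not_nonunit by (metis aR nonunits_carrier m_comm
      l_null l_one zero_closed)
  qed
  then obtain m where m: "k = Suc m" by (cases k) auto
  have am: "a [^] m \<noteq> \<zero>" unfolding k_def using not_less_Least[of m "\<lambda>k. a [^] k = \<zero>"] m by (simp add: k_def)
  have "(a \<oplus> b) \<otimes> a [^] m = a \<otimes> a [^] m \<oplus> b \<otimes> a [^] m" using aR bR by (simp add: l_distr)
  then have "b \<otimes> a [^] m = a [^] m" using k aR bR unfolding m one by (simp add: m_comm)
  then have "b [^] j \<otimes> a [^] m = a [^] m" for j :: nat
    using aR bR by (induction j) (simp_all add: m_assoc)
  then show False using nil[OF ab(2)] am aR by (metis l_null nat_pow_closed)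
qed

lemma local_ringI:
  assumes fin: "finite (carrier R)" and one: "\<one> \<noteq> \<zero>"
    and idem: "\<And>e. e \<in> carrier R \<Longrightarrow> e \<otimes> e = e \<Longrightarrow> e = \<zero> \<or> e = \<one>"
  shows "local_ring R"
proof -
  let ?N = "nonunits R"
  have mult: "r \<otimes> x \<in> ?N" if "r \<in> carrier R" "x \<in> ?N" for r x
    using PIdl_subset_nonunits[OF that(2)] that(1) unfolding cgenideal_def by blast
  have add: "x \<oplus> y \<in> ?N" if "x \<in> ?N" "y \<in> ?N" for x y
  proof (rule ccontr)
    have xy: "x \<in> carrier R" "y \<in> carrier R" using that nonunits_carrier by blast+
    assume "x \<oplus> y \<notin> ?N"
    then have u: "x \<oplus> y \<in> Units R" using xy by (simp add: nonunits_def)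
    then have "inv (x \<oplus> y) \<otimes> x \<oplus> inv (x \<oplus> y) \<otimes> y = \<one>"
      using xy by (simp flip: r_distr)
    then show False using nonunit_plus_nonunit[OF fin idem mult mult] u that by blast
  qed
  have idl: "ideal ?N R"
  proof (rule idealI)
    show "subgroup ?N (add_monoid R)"
    proof (rule add.subgroupI)
      show "?N \<subseteq> carrier R" by (rule nonunits_carrier)
      show "?N \<noteq> {}" using zero_nonunit_iff one by blast
      show "\<ominus> x \<in> ?N" if "x \<in> ?N" for x
        using mult[of "\<ominus> \<one>" x] that nonunits_carrier by (simp add: l_minus subsetD)
    qed (rule add)
    show "x \<otimes> a \<in> ?N" "a \<otimes> x \<in> ?N" if "a \<in> ?N" "x \<in> carrier R" for a x
      using mult[OF that(2,1)] that nonunits_carrier m_comm by (auto simp: subsetD)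
  qed (rule ring_axioms)
  have proper: "J \<subseteq> ?N" if "ideal J R" "J \<noteq> carrier R" for J
  proof -
    interpret J: ideal J R by fact
    have "x \<notin> Units R" if "x \<in> J" for x
    proof
      assume "x \<in> Units R"
      then have "inv x \<otimes> x \<in> J" using J.I_l_closed[OF that Units_inv_closed] by blast
      then have "\<one> \<in> J" using \<open>x \<in> Units R\<close> by simp
      then show False using J.one_imp_carrier \<open>J \<noteq> carrier R\<close> by blast
    qed
    then show ?thesis using J.a_subset unfolding nonunits_def by blast
  qed
  have ne: "carrier R \<noteq> ?N" using one_not_nonunit by blast
  have "maximalideal ?N R"
    by (rule maximalidealI[OF idl ne]) (use proper in blast)
  moreover have "M = ?N" if "maximalideal M R" for M
  proof -
    interpret M: maximalideal M R by fact
    have "M \<subseteq> ?N" using proper M.ideal_axioms M.I_notcarr by blast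
    then show ?thesis using M.I_maximal[OF idl _ nonunits_carrier] ne by blast
  qed
  ultimately show ?thesis unfolding local_ring_def by blast
qed

text \<open>The Peirce corner of an idempotent: its unity is \<open>e\<close> rather than
  \<open>\<one>\<close>, so for \<open>e \<noteq> \<one>\<close> it is an ideal with a ring
  structure and not a unital subring. The elements keep their type.\<close>

definition corner :: "'a \<Rightarrow> 'a ring" where
  "corner e = \<lparr>carrier = PIdl e, monoid.mult = monoid.mult R, one = e, zero = \<zero>, add = add R\<rparr>"

lemma corner_simps [simp]:
  "carrier (corner e) = PIdl e" "x \<otimes>\<^bsub>corner e\<^esub> y = x \<otimes> y" "\<one>\<^bsub>corner e\<^esub> = e"
  "\<zero>\<^bsub>corner e\<^esub> = \<zero>" "x \<oplus>\<^bsub>corner e\<^esub> y = x \<oplus> y"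
  by (simp_all add: corner_def)

lemma corner_mult_one: "e \<in> carrier R \<Longrightarrow> e \<otimes> e = e \<Longrightarrow> x \<in> PIdl e \<Longrightarrow> x \<otimes> e = x"
  unfolding cgenideal_def by (auto simp: m_assoc)

lemma corner_cring:
  assumes e: "e \<in> carrier R" "e \<otimes> e = e" shows "cring (corner e)"
proof -
  interpret I: ideal "PIdl e" R by (rule cgenideal_ideal[OF e(1)])
  have sub: "x \<in> carrier R" if "x \<in> PIdl e" for x using that PIdl_subset_carrier[OF e(1)] by blast
  have eI: "e \<in> PIdl e" by (rule cgenideal_self[OF e(1)])
  show ?thesis
  proof (rule cringI)
    show "abelian_group (corner e)"
    proof (rule abelian_groupI)
      fix x assume "x \<in> carrier (corner e)"
      then show "\<exists>y\<in>carrier (corner e). y \<oplus>\<^bsub>corner e\<^esub> x = \<zero>\<^bsub>corner e\<^esub>"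
        using I.a_inv_closed[of x] sub by (intro bexI[of _ "\<ominus> x"]) (auto simp: l_neg)
    qed (auto simp: sub a_assoc I.a_closed intro: a_comm)
    show "comm_monoid (corner e)"
      using eI by (intro comm_monoidI)
        (auto simp: sub m_assoc I.I_l_closed corner_mult_one[OF e] m_comm[of e] intro: m_comm)
    show "(x \<oplus>\<^bsub>corner e\<^esub> y) \<otimes>\<^bsub>corner e\<^esub> z = x \<otimes>\<^bsub>corner e\<^esub> z \<oplus>\<^bsub>corner e\<^esub> y \<otimes>\<^bsub>corner e\<^esub> z"
      if "x \<in> carrier (corner e)" "y \<in> carrier (corner e)" "z \<in> carrier (corner e)" for x y z
      using that by (simp add: sub l_distr)
  qed
qed

lemma corner_decomposition:
  assumes e: "e \<in> carrier R" "e \<otimes> e = e"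
  shows "R \<simeq> RDirProd (corner e) (corner (\<one> \<ominus> e))"
proof -
  define f where "f = \<one> \<ominus> e"
  have fR: "f \<in> carrier R" using e by (simp add: f_def)
  have sum: "e \<oplus> f = \<one>" unfolding f_def using e by (simp add: minus_eq a_lcomm[of e] r_neg)
  have ef: "e \<otimes> f = \<zero>" "f \<otimes> e = \<zero>"
  proof -
    have "e \<otimes> (e \<oplus> f) = e" using sum e by simp
    then have "e \<oplus> e \<otimes> f = e" using e fR by (simp add: r_distr)
    then show "e \<otimes> f = \<zero>" using e fR by (simp add: add.l_cancel_one)
    then show "f \<otimes> e = \<zero>" using e fR by (simp add: m_comm)
  qed
  have ff: "f \<otimes> f = f"
  proof -
    have "(e \<oplus> f) \<otimes> f = f" using sum fR by simp
    then show ?thesis using ef e fR by (simp add: l_distr)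
  qed
  let ?h = "\<lambda>x. (x \<otimes> e, x \<otimes> f)"
  have inI: "x \<otimes> g \<in> PIdl g" if "x \<in> carrier R" for x g using that unfolding cgenideal_def by blast
  have split: "x \<otimes> e \<oplus> x \<otimes> f = x" if "x \<in> carrier R" for x
    using that e fR sum by (simp flip: r_distr)
  have idm: "(x \<otimes> y) \<otimes> g = (x \<otimes> g) \<otimes> (y \<otimes> g)" if "x \<in> carrier R" "y \<in> carrier R" "g \<in> carrier R" "g \<otimes> g
    = g" for x y g
  proof -
    have "(x \<otimes> g) \<otimes> (y \<otimes> g) = (x \<otimes> y) \<otimes> (g \<otimes> g)"
      using that(1-3) by (simp add: m_ac)
    then show ?thesis using that by simp
  qed
  have "bij_betw ?h (carrier R) ((PIdl e) \<times> (PIdl f))"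
  proof (rule bij_betw_imageI)
    show "inj_on ?h (carrier R)" using split by (intro inj_onI) (metis prod.inject)
    show "?h ` carrier R = (PIdl e) \<times> (PIdl f)"
    proof (intro equalityI subsetI)
      fix z assume "z \<in> ?h ` carrier R"
      then show "z \<in> (PIdl e) \<times> (PIdl f)" using inI by auto
    next
      fix z assume "z \<in> (PIdl e) \<times> (PIdl f)"
      then obtain x y where z: "z = (x \<otimes> e, y \<otimes> f)" "x \<in> carrier R" "y \<in> carrier R"
        unfolding cgenideal_def by auto
      have "(x \<otimes> e \<oplus> y \<otimes> f) \<otimes> e = x \<otimes> e" "(x \<otimes> e \<oplus> y \<otimes> f) \<otimes> f = y \<otimes> f"
        using z e fR ff ef by (simp_all add: l_distr m_assoc)
      then show "z \<in> ?h ` carrier R" using z e fR by (intro image_eqI[of _ _ "x \<otimes> e \<oplus> y \<otimes> f"]) auto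
    qed
  qed
  then have "?h \<in> ring_iso R (RDirProd (corner e) (corner f))"
    using inI idm[OF _ _ e] idm[OF _ _ fR ff] e fR
    by (intro ring_iso_memI) (auto simp: l_distr)
  then show ?thesis unfolding is_ring_iso_def f_def by blast
qed

text \<open>One nontrivial idempotent suffices. The two factors need not be local themselves; the
  later case analysis only counts the elements and nonunits of two factors.\<close>

lemma nonlocal_decomposition:
  assumes fin: "finite (carrier R)" and one: "\<one> \<noteq> \<zero>" and nonlocal: "\<not> local_ring R"
  obtains A B :: "'a ring" where "cring A" "cring B" "R \<simeq> RDirProd A B"
    "finite (carrier A)" "finite (carrier B)" "2 \<le> card (carrier A)" "2 \<le> card (carrier B)"
proof -
  obtain e where e: "e \<in> carrier R" "e \<otimes> e = e" "e \<noteq> \<zero>" "e \<noteq> \<one>"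
    using local_ringI[OF fin one] nonlocal by blast
  let ?f = "\<one> \<ominus> e"
  have fR: "?f \<in> carrier R" using e by simp
  have f0: "?f \<noteq> \<zero>" using e by (metis minus_eq one_closed r_right_minus_eq)
  have "e \<otimes> ?f = \<zero>" using e by (simp add: minus_eq r_distr r_minus r_neg)
  then have ff: "?f \<otimes> ?f = ?f"
    using e fR by (simp add: minus_eq l_distr l_minus)
  have two: "2 \<le> card (PIdl g)" if "g \<in> carrier R" "g \<noteq> \<zero>" for g
  proof -
    have "card {\<zero>, g} \<le> card (PIdl g)"
      using that zero_in_PIdl cgenideal_self by (intro card_mono finite_PIdl fin) auto
    then show ?thesis using that by simp
  qed
  show thesis
  proof (rule that)
    show "cring (corner e)" "cring (corner ?f)" using corner_cring e(1,2) fR ff by blast+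
    show "R \<simeq> RDirProd (corner e) (corner ?f)" by (rule corner_decomposition[OF e(1,2)])
    show "finite (carrier (corner e))" "finite (carrier (corner ?f))"
      using fin e(1) fR by (simp_all only: corner_simps finite_PIdl)
    show "2 \<le> card (carrier (corner e))" "2 \<le> card (carrier (corner ?f))"
      using two e fR f0 by auto
  qed
qed

text \<open>The ideal generated by \<open>\<one> \<oplus> \<one>\<close> contains the Sylow subgroup
  of order 3, on which doubling is invertible, and is proper because an element of additive order 2
  is annihilated by the generator. So its order is a proper divisor of 6 and at least 3.\<close>

lemma order_6_ideal:
  assumes c: "card (carrier R) = 6"
  obtains z where "z \<in> nonunits R" "card (PIdl z) = 3"
proof -
  have fin: "finite (carrier R)" using c by (intro card_ge_0_finite) simp
  have gr: "group (add_monoid R)" by (rule add.is_group)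
  have ord: "Coset.order (add_monoid R) = 2 ^ 1 * 3" "Coset.order (add_monoid R) = 3 ^ 1 * 2"
    using c by (simp_all add: Coset.order_def)
  obtain H where H: "subgroup H (add_monoid R)" "card H = 3"
    using sylow_thm[OF _ gr ord(2)] fin by auto
  obtain K where K: "subgroup K (add_monoid R)" "card K = 2"
    using sylow_thm[OF _ gr ord(1)] fin by auto
  interpret H: subgroup H "add_monoid R" by fact
  interpret K: subgroup K "add_monoid R" by fact
  have Hs: "H \<subseteq> carrier R" and Ks: "K \<subseteq> carrier R" using H.subset K.subset by simp_all
  have torsion: "add_pow R (card L) x = \<zero>" if L: "subgroup L (add_monoid R)" "x \<in> L" for L x
  proof -
    interpret L: group "add_monoid R \<lparr>carrier := L\<rparr>" by (rule subgroup.subgroup_is_group[OF L(1) gr])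
    show ?thesis
      using L.pow_order_eq_1[of x] L(2) monoid.nat_pow_consistent[OF group.is_monoid[OF gr], of x "card
        L" L]
      by (simp add: Coset.order_def add_pow_def)
  qed
  define z where "z = \<one> \<oplus> \<one>"
  have zR: "z \<in> carrier R" by (simp add: z_def)
  have zx: "x \<otimes> z = x \<oplus> x" if "x \<in> carrier R" for x using that by (simp add: z_def r_distr)
  have "H \<subseteq> PIdl z"
  proof
    fix h assume h: "h \<in> H"
    then have hR: "h \<in> carrier R" using Hs by blast
    have "h \<oplus> h \<oplus> h = \<zero>" using torsion[OF H(1) h] hR unfolding H(2) by (simp add: numeral_3_eq_3)
    then have "\<ominus> h = h \<oplus> h" using hR by (metis add.m_closed minus_equality)
    \<comment> \<open>Since \<open>h\<close> has additive order dividing 3, doubling and negation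
      agree on it.\<close>
    then have "h = \<ominus> h \<otimes> z" using hR by (simp add: zx l_minus) (metis minus_add minus_minus)
    then show "h \<in> PIdl z" unfolding cgenideal_def using hR by auto
  qed
  moreover have finP: "finite (PIdl z)" using fin PIdl_subset_carrier[OF zR] finite_subset by blast
  ultimately have ge: "3 \<le> card (PIdl z)" using H(2) card_mono by metis
  have "K \<noteq> {\<zero>}" using K(2) by auto
  then obtain k where k: "k \<in> K" "k \<noteq> \<zero>" using K.one_closed by auto
  then have kR: "k \<in> carrier R" using Ks by blast
  have kk: "k \<otimes> z = \<zero>" using torsion[OF K(1) k(1)] kR zx[OF kR] unfolding K(2) by (simp add: numeral_2_eq_2)
  have "z \<notin> Units R"
  proof
    assume u: "z \<in> Units R"
    have "(k \<otimes> z) \<otimes> inv z = k" using u kR zR by (simp add: m_assoc)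
    then show False using kk u k(2) by simp
  qed
  then have zN: "z \<in> nonunits R" using zR by (simp add: nonunits_def)
  have "card (PIdl z) \<noteq> 6"
  proof
    assume "card (PIdl z) = 6"
    then have "PIdl z = carrier R" using card_subset_eq[OF fin PIdl_subset_carrier[OF zR]] c by simp
    then show False using PIdl_eq_carrier_imp_Unit[OF zR] \<open>z \<notin> Units R\<close> by blast
  qed
  moreover have "card (PIdl z) dvd 6" using card_PIdl_dvd[OF zR] c by simp
  moreover have "d = 3" if "3 \<le> d" "d dvd 6" "d \<noteq> 6" for d :: nat
  proof -
    have "d \<le> 6" using dvd_imp_le[OF that(2)] by simp
    then have "d = 3 \<or> d = 4 \<or> d = 5" using that by linarith
    then show ?thesis using that(2) by auto
  qed
  ultimately have "card (PIdl z) = 3" using ge by blast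
  then show thesis using that zN by blast
qed

end

section \<open>Products of two rings\<close>

context two_crings
begin

text \<open>The obstruction on the sphere needs a vertex outside the \<open>K\<^sub>5\<close>; it is
  either \<open>w\<close> itself or, when \<open>w\<close> lies in \<open>K\<close>, is left over
  from a clique of at least six.\<close>

lemma extra_vertex_not_planar:
  assumes B: "complete_edges K \<subseteq> edges \<Gamma>" "5 \<le> card K" "K \<subseteq> nonunits (RDirProd A B)"
    and w: "w \<in> nonunits (RDirProd A B)" "w \<notin> K \<or> 6 \<le> card K"
  shows "\<not> embeds_in \<Gamma> (orientable_surface 0)"
proof -
  have "\<exists>L w. L \<subseteq> K \<and> card L = 5 \<and> w \<in> nonunits (RDirProd A B) \<and> w \<notin> L"
  proof (cases "w \<in> K")
    case False
    then show ?thesis using w(1) obtain_subset_with_card_n[OF B(2)] by (metis subsetD)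
  next
    case True
    then have "5 \<le> card (K - {w})" using w(2) by simp
    then obtain L where "L \<subseteq> K - {w}" "card L = 5" by (meson obtain_subset_with_card_n)
    then show ?thesis using w(1) by blast
  qed
  then obtain L w where L: "L \<subseteq> K" "card L = 5" "w \<in> nonunits (RDirProd A B)" "w \<notin> L" by blast
  show ?thesis
    unfolding AB.embeds_upper_graph_iff
    by (rule K5_not_embeds_in_sphere[of L _ _ w]) (use complete_edges_mono[OF L(1)] B L in auto)
qed

text \<open>The cliques \<open>{zA} \<times> carrier B\<close> and
  \<open>carrier A \<times> {zB}\<close> share one vertex and have at most 7 and 4 elements, so they
  fit into the cliques on 0 to 6 and on 0, 7, 8, 9. The first has at least 5 elements, and
  (\<open>uA\<close>, \<open>zB\<close>) lies outside it.\<close>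

lemma genus_1_fields:
  assumes N: "nonunits A = {zA}" "nonunits B = {zB}"
    and c: "2 \<le> card (carrier A)" "card (carrier A) \<le> 4" "5 \<le> card (carrier B)" "card (carrier B) \<le> 7"
  shows "graph_genus \<Gamma> = 1"
  unfolding graph_genus_eq_1_iff
proof
  have fin: "finite (carrier A)" "finite (carrier B)" using c by (auto intro: card_ge_0_finite)
  show "embeds_in \<Gamma> (orientable_surface 1)"
    by (rule embeds_two_cliques[OF torus_graph_embeds fin _ _ torus_cliques(1,2)]) (use N c in auto)
  have "carrier A \<noteq> {uA}" using c by auto
  then have "uA \<noteq> zA" using A.one_zeroD by metis
  moreover have "complete_edges ({zA} \<times> carrier B) \<subseteq> edges \<Gamma>"
    using clique_left[of "zA"] N A.PIdl_zero by auto
  ultimately show "\<not> embeds_in \<Gamma> (orientable_surface 0)"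
    using N c by (intro extra_vertex_not_planar[of "{zA} \<times> carrier B" "(uA, zB)"])
      (auto simp: nonunits_RDirProd card_cartesian_product)
qed

text \<open>The six-element clique \<open>carrier A \<times> {zB, b}\<close> goes into the
  \<open>K\<^sub>7\<close> and the \<open>K\<^sub>4\<close> on
  \<open>{zA} \<times> carrier B\<close> onto 0, 1, 7, 8; their two common vertices become 0 and
  1.\<close>

lemma genus_1_local:
  assumes N: "nonunits A = {zA}" "nonunits B = {zB, b}" "b \<noteq> zB"
    and c: "card (carrier A) = 3" "card (carrier B) = 4"
  shows "graph_genus \<Gamma> = 1"
  unfolding graph_genus_eq_1_iff
proof
  have fin: "finite (carrier A)" "finite (carrier B)" using c by (auto intro: card_ge_0_finite)
  show "embeds_in \<Gamma> (orientable_surface 1)"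
    by (rule embeds_two_cliques[OF torus_graph_embeds fin _ _ torus_cliques(3,1)]) (use N c in auto)
  have "complete_edges (carrier A \<times> {zB, b}) \<subseteq> edges \<Gamma>"
    using clique_right[of b] N B.PIdl_order_4[OF c(2), of b] by auto
  then show "\<not> embeds_in \<Gamma> (orientable_surface 0)"
    using N c by (intro extra_vertex_not_planar[of "carrier A \<times> {zB, b}" "(zA, b)"])
      (auto simp: nonunits_RDirProd card_cartesian_product)
qed

lemma planar_fields:
  assumes N: "nonunits A = {zA}" "nonunits B = {zB}"
    and c: "card (carrier A) \<le> 4" "card (carrier B) \<le> 4" and fin: "finite (carrier A)" "finite (carrier B)"
  shows "embeds_in \<Gamma> (orientable_surface 0)"
  by (rule embeds_two_cliques[OF plane_graph_embeds fin _ _ plane_cliques(1,2)]) (use N c in auto)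

lemma planar_local:
  assumes N: "nonunits A = {zA}" "nonunits B = {zB, b}" "b \<noteq> zB"
    and c: "card (carrier A) = 2" "card (carrier B) = 4"
  shows "embeds_in \<Gamma> (orientable_surface 0)"
proof -
  have fin: "finite (carrier A)" "finite (carrier B)" using c by (auto intro: card_ge_0_finite)
  show ?thesis
    by (rule embeds_two_cliques[OF plane_graph_embeds fin _ _ plane_cliques(3,4)]) (use N c in auto)
qed

text \<open>Here \<open>B\<close> has two different ideals of order 2, and treating
  \<open>carrier A \<times> nonunits B\<close> as a clique would create a \<open>K\<^sub>6\<close>.
  The true edges form three copies of \<open>K\<^sub>4\<close> that share one vertex and meet
  pairwise in an edge, which are the three stacked faces of the plane drawing.\<close>

lemma planar_split:
  assumes N: "nonunits A = {zA}" "nonunits B = {zB, b, b'}" "b \<noteq> zB" "b' \<noteq> zB" "b \<noteq> b'"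
    and c: "card (carrier A) = 2" "card (carrier B) = 4"
  shows "embeds_in \<Gamma> (orientable_surface 0)"
proof -
  have fin: "finite (carrier A)" "finite (carrier B)" using c by (auto intro: card_ge_0_finite)
  have A1: "uA \<noteq> zA" using A.one_neq_zero c by simp
  then have carA: "carrier A = {zA, uA}" using c fin by (intro card_seteq[symmetric]) auto
  have B1: "uB \<notin> {zB, b, b'}" using B.one_not_nonunit N by blast
  have "b \<in> carrier B" "b' \<in> carrier B" using N B.nonunits_carrier by auto
  then have carB: "carrier B = {zB, b, b', uB}" using c fin N B1 by (intro card_seteq[symmetric]) auto
  let ?V = "nonunits (RDirProd A B)"
  have V: "?V = {zA} \<times> {zB, b, b', uB} \<union> {zA, uA} \<times> {zB, b, b'}"
    unfolding nonunits_RDirProd N carA carB by auto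
  have P: "IA zA = {zA}" "IB zB = {zB}" "IB b = {zB, b}" "IB b' = {zB, b'}"
    using A.PIdl_zero B.PIdl_zero B.PIdl_order_4[OF c(2)] N by auto
  define h :: "'a \<times> 'b \<Rightarrow> nat" where "h x = (if fst x = zA
      then if snd x = zB then 0 else if snd x = b then 1 else if snd x = b' then 2 else 4
      else if snd x = zB then 3 else if snd x = b then 5 else 6)" for x
  have hv: "h (zA, zB) = 0" "h (zA, b) = 1" "h (zA, b') = 2" "h (zA, uB) = 4"
    "h (uA, zB) = 3" "h (uA, b) = 5" "h (uA, b') = 6"
    using N(3-5) A1 B1 by (auto simp: h_def)
  have inj: "inj_on h ?V" unfolding V inj_on_def by (auto simp: hv)
  let ?S = "\<lambda>Q. complete_edges Q \<subseteq> segment_edges plane_segments"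
  have cl: "?S {0, 1, 2, 4}" "?S {0, 1, 3, 5}" "?S {0, 2, 3, 6}"
    by (rule complete_edges_segments; elim insertE emptyE; simp add: plane_edges doubleton_eq_iff)+
  have emb: "embeds_in (?V, edges \<Gamma>) (orientable_surface 0)"
  proof (rule embeds_in_subgraph[OF plane_graph_embeds _ inj])
    show "e \<subseteq> ?V" if "e \<in> edges \<Gamma>" for e using edge_wf[OF that] by blast
    show "h ` ?V \<subseteq> {..<10}" unfolding V by (auto simp: hv)
    fix e assume e: "e \<in> edges \<Gamma>"
    then obtain x y z w where xy: "e = {x, y}" "x \<noteq> y" "(z, w) \<in> ?V" "x \<in> (IA z) \<times> (IB w)" "y \<in> (IA z) \<times>
      (IB w)"
      unfolding AB.upper_graph_edges by (auto simp: PIdl_RDirProd)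
    have sub: "IA z \<subseteq> {zA, uA}" "IB w \<subseteq> {zB, b, b', uB}"
      using xy(3) AB.nonunits_carrier A.PIdl_subset_carrier[of z] B.PIdl_subset_carrier[of w] carA carB
        by auto
    have "(IA z) \<times> (IB w) \<subseteq> {zA} \<times> {zB, b, b', uB} \<or>
        (IA z) \<times> (IB w) \<subseteq> {zA, uA} \<times> {zB, b} \<or>
        (IA z) \<times> (IB w) \<subseteq> {zA, uA} \<times> {zB, b'}"
    proof -
      have "z = zA \<or> w = zB \<or> w = b \<or> w = b'" using xy(3) unfolding V by blast
      then show ?thesis
      proof (elim disjE)
        assume "z = zA"
        then show ?thesis using sub(2) P(1) by (intro disjI1 Sigma_mono) simp_all
      next
        assume "w = zB"
        then show ?thesis using sub(1) P(2) by (intro disjI2 disjI1 Sigma_mono) simp_all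
      next
        assume "w = b"
        then show ?thesis using sub(1) P(3) by (intro disjI2 disjI1 Sigma_mono) simp_all
      next
        assume "w = b'"
        then show ?thesis using sub(1) P(4) by (intro disjI2 Sigma_mono) simp_all
      qed
    qed
    then have e3: "e \<subseteq> {zA} \<times> {zB, b, b', uB} \<or> e \<subseteq> {zA, uA} \<times> {zB, b} \<or> e \<subseteq> {zA, uA} \<times> {zB, b'}"
      using xy by blast
    have he: "h ` e \<subseteq> {0, 1, 2, 4} \<or> h ` e \<subseteq> {0, 1, 3, 5} \<or> h ` e \<subseteq> {0, 2, 3, 6}"
    proof -
      have "h ` ({zA} \<times> {zB, b, b', uB}) \<subseteq> {0, 1, 2, 4}"
        "h ` ({zA, uA} \<times> {zB, b}) \<subseteq> {0, 1, 3, 5}"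
        "h ` ({zA, uA} \<times> {zB, b'}) \<subseteq> {0, 2, 3, 6}"
        using hv by auto
      then show ?thesis using e3 by (meson image_mono order_trans)
    qed
    have "h x \<noteq> h y" using xy(1,2) edge_wf[OF e] inj by (auto dest: inj_onD)
    then have "h ` e \<in> complete_edges Q" if "h ` e \<subseteq> Q" for Q
      using that unfolding complete_edges_def xy(1) by auto
    then show "h ` e \<in> segment_edges plane_segments" using he cl by blast
  qed
  then show ?thesis unfolding AB.embeds_upper_graph_iff .
qed

lemma not_toroidal_K8_right:
  assumes "b \<in> nonunits B" "8 \<le> card (carrier A) * card (IB b)"
  shows "\<not> embeds_in \<Gamma> (orientable_surface 1)"
  unfolding AB.embeds_upper_graph_iff
  by (rule not_toroidal_K8[OF edge_wf clique_right[OF assms(1)]]) (use assms(2) in \<open>simp_all add: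
    card_cartesian_product\<close>)

lemma not_toroidal_K8_left:
  assumes "a \<in> nonunits A" "8 \<le> card (IA a) * card (carrier B)"
  shows "\<not> embeds_in \<Gamma> (orientable_surface 1)"
  unfolding AB.embeds_upper_graph_iff
  by (rule not_toroidal_K8[OF edge_wf clique_left[OF assms(1)]]) (use assms(2) in \<open>simp_all add:
    card_cartesian_product\<close>)

lemma not_toroidal_large:
  assumes "uA \<noteq> zA" "uB \<noteq> zB" "5 \<le> card (carrier A)" "5 \<le> card (carrier B)"
  shows "\<not> embeds_in \<Gamma> (orientable_surface 1)"
proof -
  have z: "zA \<in> nonunits A" "zB \<in> nonunits B" using assms A.zero_nonunit_iff B.zero_nonunit_iff by auto
  show ?thesis
    unfolding AB.embeds_upper_graph_iff
    by (rule not_toroidal_K5_wedge_K5[OF edge_wf clique_left[OF z(1)] clique_right[OF z(2)], of "(zA, zB)"])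
      (use assms in \<open>auto simp: A.PIdl_zero B.PIdl_zero card_cartesian_product\<close>)
qed

text \<open>With the ideal of order 3 in \<open>B\<close>, the two cliques
  \<open>{zA} \<times> carrier B\<close> and \<open>carrier A \<times> (IB b)\<close> both have six
  elements and share the three of \<open>{zA} \<times> (IB b)\<close>.\<close>

lemma not_toroidal_order_2_6:
  assumes c: "card (carrier A) = 2" "card (carrier B) = 6"
  shows "\<not> embeds_in \<Gamma> (orientable_surface 1)"
proof -
  have fin: "finite (carrier A)" "finite (carrier B)" using c by (auto intro: card_ge_0_finite)
  have z: "zA \<in> nonunits A" using A.one_neq_zero c A.zero_nonunit_iff by simp
  obtain b where b: "b \<in> nonunits B" "card (IB b) = 3" using B.order_6_ideal c(2) by blast
  have sub: "IB b \<subseteq> carrier B" using b B.nonunits_carrier B.PIdl_subset_carrier by blast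
  have finb: "finite (IB b)" using b(2) by (intro card_ge_0_finite) simp
  let ?K = "{zA} \<times> carrier B" and ?L = "carrier A \<times> (IB b)"
  have i: "?K \<inter> ?L = {zA} \<times> (IB b)" "?K - ?L = {zA} \<times> (carrier B - IB b)"
    "?L - ?K = (carrier A - {zA}) \<times> (IB b)" using sub by auto
  show ?thesis
    unfolding AB.embeds_upper_graph_iff
  proof (rule not_toroidal_K6_K6[OF edge_wf])
    show "complete_edges ?K \<subseteq> edges \<Gamma>" using clique_left[OF z] by (simp add: A.PIdl_zero)
    show "complete_edges ?L \<subseteq> edges \<Gamma>" by (rule clique_right[OF b(1)])
  qed (use b c fin finb sub in \<open>simp_all add: i card_cartesian_product card_Diff_subset\<close>)
qed

text \<open>The ideals of \<open>b\<close> and \<open>b'\<close> give two cliques of six elements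
  that share \<open>carrier A \<times> {zB}\<close>.\<close>

lemma not_toroidal_order_3_split:
  assumes N: "b \<in> nonunits B" "b' \<in> nonunits B" "b \<noteq> zB" "b' \<noteq> zB" "b \<noteq> b'"
    and c: "card (carrier A) = 3" "card (carrier B) = 4"
  shows "\<not> embeds_in \<Gamma> (orientable_surface 1)"
proof -
  let ?K = "carrier A \<times> {zB, b}" and ?L = "carrier A \<times> {zB, b'}"
  have i: "?K \<inter> ?L = carrier A \<times> {zB}" "?K - ?L = carrier A \<times> {b}" "?L - ?K = carrier A \<times> {b'}"
    using N by auto
  show ?thesis
    unfolding AB.embeds_upper_graph_iff
  proof (rule not_toroidal_K6_K6[OF edge_wf])
    show "complete_edges ?K \<subseteq> edges \<Gamma>" "complete_edges ?L \<subseteq> edges \<Gamma>"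
      using clique_right[OF N(1)] clique_right[OF N(2)] B.PIdl_order_4[OF c(2)] N by simp_all
  qed (use c in \<open>simp_all add: i card_cartesian_product\<close>)
qed

end

section \<open>Invariance under isomorphism and the classification\<close>

lemma RDirProd_iso_cong: "A \<simeq> A' \<Longrightarrow> B \<simeq> B' \<Longrightarrow> RDirProd A B \<simeq> RDirProd A' B'"
  unfolding is_ring_iso_def using RDirProd_iso6 by blast

lemma RDirProd_iso_swap: "RDirProd A B \<simeq> RDirProd B A"
  unfolding is_ring_iso_def using RDirProd_iso1 by blast

lemma ring_iso_genus:
  assumes "cring R" "cring S" "R \<simeq> S"
  shows "graph_genus (upper_ideal_relation_graph R) = 1 \<longleftrightarrow> graph_genus (upper_ideal_relation_graph S) = 1"
proof -
  interpret R: cring R by fact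
  have "S \<simeq> R" using ring_iso_sym[OF R.ring_axioms assms(3)] .
  then show ?thesis
    unfolding graph_genus_eq_1_iff
    using ring_iso_upper_graph_embeds[OF assms] ring_iso_upper_graph_embeds[OF assms(2,1)] by blast
qed

lemma Zmod_prime:
  assumes "prime p"
  shows "cring (Zmod (int p))" "card (carrier (Zmod (int p))) = p" "nonunits (Zmod (int p)) = {\<zero>\<^bsub>Zmod
    (int p)\<^esub>}"
proof -
  interpret Z: residues_prime p "Zmod (int p)" by unfold_locales (rule assms)
  show c: "cring (Zmod (int p))" by (rule Z.cring)
  show card: "card (carrier (Zmod (int p))) = p" by (simp add: Z.res_carrier_eq)
  show "nonunits (Zmod (int p)) = {\<zero>\<^bsub>Zmod (int p)\<^esub>}"
    by (rule cring.nonunits_prime_order[OF c]) (simp add: card assms)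
qed

lemma is_GF_nonunits:
  assumes "is_GF q F" shows "cring F" "card (carrier F) = q" "nonunits F = {\<zero>\<^bsub>F\<^esub>}"
proof -
  interpret F: field F using assms by (simp add: is_GF_def)
  show "cring F" by unfold_locales
  show "card (carrier F) = q" using assms by (simp add: is_GF_def)
  show "nonunits F = {\<zero>\<^bsub>F\<^esub>}" unfolding nonunits_def F.field_Units by auto
qed

lemma field_order_iso_GF:
  fixes A :: "('a, 'b) ring_scheme"
  assumes A: "cring A" "nonunits A = {\<zero>\<^bsub>A\<^esub>}" "card (carrier A) = q" "0 < q"
  obtains F where "is_GF q F" "A \<simeq> F"
proof -
  interpret A: cring A by fact
  have fin: "finite (carrier A)" using A by (auto intro: card_ge_0_finite)
  have one: "\<one>\<^bsub>A\<^esub> \<noteq> \<zero>\<^bsub>A\<^esub>" using A.zero_nonunit_iff A(2) by blast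
  have U: "Units A = carrier A - {\<zero>\<^bsub>A\<^esub>}" using A(2) A.Units_closed unfolding nonunits_def by auto
  have fA: "field A" using A.cring_fieldI[OF U] .
  interpret fA: field A by fact
  obtain f :: "'a \<Rightarrow> nat" where f: "inj_on f (carrier A)" using finite_imp_inj_to_nat_seg[OF fin] by blast
  let ?F = "image_ring f A"
  have iso: "f \<in> ring_iso A ?F" using inj_imp_image_ring_iso[OF f] .
  have "field ?F" using fA.inj_imp_image_ring_is_field[OF f] .
  moreover have "bij_betw f (carrier A) (carrier ?F)" using iso by (auto simp: ring_iso_def)
  ultimately have "is_GF q ?F" unfolding is_GF_def using A(3) fin bij_betw_same_card bij_betw_finite by
    metis
  moreover have "A \<simeq> ?F" using iso unfolding is_ring_iso_def by blast
  ultimately show thesis by (rule that)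
qed

text \<open>The cliques over the zeros bound the orders, to \<open>?b < 8\<close> by
  \<open>K\<^sub>8\<close> and to \<open>?a < 5\<close> by two \<open>K\<^sub>5\<close> sharing a
  vertex. Of the orders left for \<open>B\<close>, 2 and 3 give planar graphs and 5 and 7 belong to
  the list; 4 and 6 depend on the ideals of \<open>B\<close>.\<close>

lemma product_genus_1_cases:
  fixes A :: "('a, 'c) ring_scheme" and B :: "('b, 'd) ring_scheme"
  assumes "cring A" "cring B" and fin: "finite (carrier A)" "finite (carrier B)"
    and card: "2 \<le> card (carrier A)" "card (carrier A) \<le> card (carrier B)"
    and genus: "graph_genus (upper_ideal_relation_graph (RDirProd A B)) = 1"
  shows "nonunits A = {\<zero>\<^bsub>A\<^esub>} \<and> card (carrier A) \<in> {2, 3, 4} \<and> card (carrier B) \<in> {5, 7} \<or>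
    card (carrier A) = 3 \<and> card (carrier B) = 4 \<and> (\<exists>b. nonunits B = {\<zero>\<^bsub>B\<^esub>, b} \<and> b \<noteq> \<zero>\<^bsub>B\<^esub>)"
proof -
  interpret two_crings A B using assms by (simp add: two_crings_def)
  let ?a = "card (carrier A)" and ?b = "card (carrier B)"
  have tor: "embeds_in \<Gamma> (orientable_surface 1)" and npl: "\<not> embeds_in \<Gamma> (orientable_surface 0)"
    using genus unfolding graph_genus_eq_1_iff by auto
  have one: "uA \<noteq> zA" "uB \<noteq> zB" using A.one_neq_zero B.one_neq_zero card by auto
  have zA: "zA \<in> nonunits A" and zB: "zB \<in> nonunits B"
    using one A.zero_nonunit_iff B.zero_nonunit_iff by auto
  have b8: "?b < 8" using not_toroidal_K8_left[OF zA] tor by (fastforce simp: A.PIdl_zero)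
  have a5: "?a < 5" using not_toroidal_large[OF one] tor card by force
  have KA: "card (IA a) * ?b < 8" if "a \<in> nonunits A" for a
    using not_toroidal_K8_left[OF that] tor by (metis not_le)
  have KB: "?a * card (IB b) < 8" if "b \<in> nonunits B" for b
    using not_toroidal_K8_right[OF that] tor by (metis not_le)
  have fieldA: "nonunits A = {zA}" if "?a \<noteq> 4 \<or> 4 \<le> ?b"
  proof (cases "?a = 4")
    case False
    then have "?a = 2 \<or> ?a = 3" using card a5 by linarith
    then have "prime ?a" by auto
    then show ?thesis by (rule A.nonunits_prime_order)
  next
    case True
    \<comment> \<open>A nonzero nonunit would generate an ideal of order 2 and, together with at
      least four elements of \<open>B\<close>, a clique of at least eight vertices.\<close>
    have "a = zA" if a: "a \<in> nonunits A" for a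
    proof (rule ccontr)
      assume "a \<noteq> zA"
      then have "card (IA a) = 2" using A.PIdl_order_4[OF True a] by simp
      then show False using KA[OF a] True card by simp
    qed
    then show ?thesis using zA by blast
  qed
  have primeB: "nonunits B = {zB}" if "?b \<in> {2, 3, 5, 7}"
  proof -
    have "prime ?b" using that by auto
    then show ?thesis by (rule B.nonunits_prime_order)
  qed
  have fA: "nonunits A = {zA}" using fieldA card by (cases "?a = 4") auto
  have "?b \<in> {2, 3} \<or> ?b = 4 \<or> ?b = 6 \<or> ?b \<in> {5, 7}" using card b8 by auto
  then consider "?b \<in> {2, 3}" | "?b = 4" | "?b = 6" | "?b \<in> {5, 7}" by blast
  then show ?thesis
  proof cases
    case 1
    then have "embeds_in \<Gamma> (orientable_surface 0)"
      using fA primeB card fin by (intro planar_fields) auto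
    then show ?thesis using npl by blast
  next
    case 2
    have a4: "?a \<le> 4" using a5 by simp
    have "\<exists>b\<in>nonunits B. b \<noteq> zB"
    proof (rule ccontr)
      assume "\<not> ?thesis"
      then have "nonunits B = {zB}" using zB by blast
      then show False using planar_fields[OF fA _ a4] npl 2 fin by simp
    qed
    then obtain b where b: "b \<in> nonunits B" "b \<noteq> zB" by blast
    have "card (IB b) = 2" using B.PIdl_order_4[OF 2 b(1)] b(2) by simp
    then have a23: "?a = 2 \<or> ?a = 3" using KB[OF b(1)] card a4 by auto
    show ?thesis
    proof (cases "nonunits B = {zB, b}")
      case True
      then have "?a \<noteq> 2" using planar_local[OF fA True b(2) _ 2] npl by blast
      then show ?thesis using a23 2 True b(2) by blast
    next
      case False
      then obtain b' where b': "b' \<in> nonunits B" "b' \<noteq> zB" "b' \<noteq> b" using b zB by blast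
      have "nonunits B = {zB, b, b'}"
      proof (rule card_seteq[symmetric])
        show "finite (nonunits B)" using fin B.nonunits_carrier finite_subset by blast
        show "{zB, b, b'} \<subseteq> nonunits B" using b b' zB by blast
        \<comment> \<open>The unity is no nonunit, so at most three of the four elements
          are.\<close>
        have "card (nonunits B) < ?b"
          using fin B.nonunits_carrier B.one_not_nonunit by (intro psubset_card_mono) auto
        then show "card (nonunits B) \<le> card {zB, b, b'}" using b b' 2 by auto
      qed
      then have "?a \<noteq> 2" using planar_split[OF fA _ b(2) b'(2) b'(3)[symmetric] _ 2] npl by blast
      moreover have "?a \<noteq> 3" using not_toroidal_order_3_split[OF b(1) b'(1) b(2) b'(2) b'(3)[symmetric]
        _ 2] tor by blast
      ultimately show ?thesis using a23 by blast
    qed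
  next
    case 3
    obtain z where z: "z \<in> nonunits B" "card (IB z) = 3" using B.order_6_ideal[OF 3] by blast
    then have "?a = 2" using KB[OF z(1)] card by auto
    then show ?thesis using not_toroidal_order_2_6 3 tor by blast
  next
    case 4
    then show ?thesis using fA card a5 by auto
  qed
qed

theorem theorem4p6:
  fixes R :: "('a, 'b) ring_scheme"
  assumes "cring R" and "finite (carrier R)" and "\<not> local_ring R"
  shows "graph_genus (upper_ideal_relation_graph R) = 1 \<longleftrightarrow>
      R \<simeq> RDirProd (Zmod 2) (Zmod 7) \<or>
      R \<simeq> RDirProd (Zmod 3) (Zmod 7) \<or>
      (\<exists>F. is_GF 4 F \<and> R \<simeq> RDirProd F (Zmod 7)) \<or>
      R \<simeq> RDirProd (Zmod 2) (Zmod 5) \<or>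
      R \<simeq> RDirProd (Zmod 3) (Zmod 5) \<or>
      (\<exists>F. is_GF 4 F \<and> R \<simeq> RDirProd F (Zmod 5)) \<or>
      R \<simeq> RDirProd (Zmod 3) (Zmod 4) \<or>
      R \<simeq> RDirProd (Zmod 3) Z2_dual_numbers"
    (is "?genus \<longleftrightarrow> ?list")
proof
  interpret R: cring R by fact
  have fields: ?genus
    if iso: "R \<simeq> RDirProd A B" and A: "cring A" "nonunits A = {\<zero>\<^bsub>A\<^esub>}" "card (carrier A) \<in> {2, 3, 4}"
      and B: "cring B" "nonunits B = {\<zero>\<^bsub>B\<^esub>}" "card (carrier B) \<in> {5, 7}"
    for A :: "'c ring" and B :: "int ring"
  proof -
    interpret two_crings A B using A B by (simp add: two_crings_def)
    show ?thesis using genus_1_fields A B ring_iso_genus[OF assms(1) AB.cring_axioms iso] by auto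
  qed
  note Z = Zmod_prime[of 2, simplified] Zmod_prime[of 3, simplified] Zmod_prime[of 5, simplified]
    Zmod_prime[of 7, simplified]
  have local: ?genus
    if iso: "R \<simeq> RDirProd (Zmod 3) B" and B: "cring B" "card (carrier B) = 4" "nonunits B = {\<zero>\<^bsub>B\<^esub>, b}"
      "b \<noteq> \<zero>\<^bsub>B\<^esub>"
    for B :: "'c ring" and b
  proof -
    interpret two_crings "Zmod 3" B using Z B by (simp add: two_crings_def)
    show ?thesis using genus_1_local Z B ring_iso_genus[OF assms(1) AB.cring_axioms iso] by auto
  qed
  note F = is_GF_nonunits[of 4]
  have dual: ?genus if "R \<simeq> RDirProd (Zmod 3) Z2_dual_numbers"
    using Z2_dual_numbers(3) local[OF that Z2_dual_numbers(1,2)] by blast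
  assume ?list
  then show ?genus
  proof (elim disjE exE conjE)
    assume "R \<simeq> RDirProd (Zmod 2) (Zmod 7)"
    then show ?thesis by (rule fields) (simp_all add: Z)
  next
    assume "R \<simeq> RDirProd (Zmod 3) (Zmod 7)"
    then show ?thesis by (rule fields) (simp_all add: Z)
  next
    fix F assume "is_GF 4 F" "R \<simeq> RDirProd F (Zmod 7)"
    then show ?thesis by (intro fields[of F "Zmod 7"]) (simp_all add: Z F)
  next
    assume "R \<simeq> RDirProd (Zmod 2) (Zmod 5)"
    then show ?thesis by (rule fields) (simp_all add: Z)
  next
    assume "R \<simeq> RDirProd (Zmod 3) (Zmod 5)"
    then show ?thesis by (rule fields) (simp_all add: Z)
  next
    fix F assume "is_GF 4 F" "R \<simeq> RDirProd F (Zmod 5)"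
    then show ?thesis by (intro fields[of F "Zmod 5"]) (simp_all add: Z F)
  next
    assume "R \<simeq> RDirProd (Zmod 3) (Zmod 4)"
    then show ?thesis by (rule local) (rule Zmod_4)+
  qed (rule dual)
next
  interpret R: cring R by fact
  assume g: ?genus
  \<comment> \<open>The zero ring has no maximal ideal and therefore counts as not local. Its graph
    is empty, so its genus is not 1.\<close>
  have one: "\<one>\<^bsub>R\<^esub> \<noteq> \<zero>\<^bsub>R\<^esub>"
  proof
    assume "\<one>\<^bsub>R\<^esub> = \<zero>\<^bsub>R\<^esub>"
    then have "carrier R = {\<one>\<^bsub>R\<^esub>}" using R.one_zeroD by simp
    then have "nonunits R = {}" using R.Units_one_closed unfolding nonunits_def by auto
    moreover have "edges (upper_ideal_relation_graph R) = {}"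
      using R.upper_graph_edge \<open>nonunits R = {}\<close> by fastforce
    ultimately have "embeds_in (upper_ideal_relation_graph R) (orientable_surface 0)"
      unfolding R.embeds_upper_graph_iff by (simp add: embeds_in_def)
    then show False using g unfolding graph_genus_eq_1_iff by blast
  qed
  obtain A' B' :: "'a ring" where A'B': "cring A'" "cring B'" "R \<simeq> RDirProd A' B'"
    "finite (carrier A')" "finite (carrier B')" "2 \<le> card (carrier A')" "2 \<le> card (carrier B')"
    using R.nonlocal_decomposition[OF assms(2) one assms(3)] by metis
  obtain A B :: "'a ring" where AB: "cring A" "cring B" "R \<simeq> RDirProd A B"
    "finite (carrier A)" "finite (carrier B)" "2 \<le> card (carrier A)" "card (carrier A) \<le> card (carrier B)"
  proof (cases "card (carrier A') \<le> card (carrier B')")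
    case True
    then show ?thesis using that A'B' by blast
  next
    case False
    then show ?thesis using that[of B' A'] A'B' ring_iso_trans[OF A'B'(3) RDirProd_iso_swap] by simp
  qed
  have "graph_genus (upper_ideal_relation_graph (RDirProd A B)) = 1"
    using g ring_iso_genus[OF assms(1) RDirProd_cring[OF AB(1,2)] AB(3)] by blast
  note cases = product_genus_1_cases[OF AB(1,2,4-7) this]
  interpret A: cring A by fact
  interpret B: cring B by fact
  have to: "R \<simeq> RDirProd C D" if "A \<simeq> C" "B \<simeq> D" for C :: "'c ring" and D :: "'d ring"
    using ring_iso_trans[OF AB(3) RDirProd_iso_cong[OF that]] .
  have toF: "\<exists>F. is_GF 4 F \<and> R \<simeq> RDirProd F D" if "nonunits A = {\<zero>\<^bsub>A\<^esub>}" "card (carrier A) = 4" "B \<simeq> D"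
    for D :: "int ring"
    using field_order_iso_GF[OF AB(1) that(1,2)] ring_iso_trans[OF AB(3) RDirProd_iso_cong[OF _ that(3)]]
    by (metis zero_less_numeral)
  have pA: "A \<simeq> Zmod (int p)" if "card (carrier A) = p" "prime p" for p using A.prime_order_iso that by auto
  have pB: "B \<simeq> Zmod (int p)" if "card (carrier B) = p" "prime p" for p using B.prime_order_iso that by auto
  note isoA = pA[of 2, simplified] pA[of 3, simplified]
  note isoB = pB[of 5, simplified] pB[of 7, simplified]
  show ?list
    using cases
  proof (elim disjE conjE exE)
    fix b assume c: "card (carrier A) = 3" "card (carrier B) = 4" "nonunits B = {\<zero>\<^bsub>B\<^esub>, b}" "b \<noteq> \<zero>\<^bsub>B\<^esub>"
    show ?list
    \<comment> \<open>The value of \<open>\<one> \<oplus> \<one>\<close> is the only datum that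
      distinguishes the two local rings of order 4 that are not fields.\<close>
    proof (cases "\<one>\<^bsub>B\<^esub> \<oplus>\<^bsub>B\<^esub> \<one>\<^bsub>B\<^esub> = \<zero>\<^bsub>B\<^esub>")
      case True
      obtain x where "nonunits Z2_dual_numbers = {\<zero>\<^bsub>Z2_dual_numbers\<^esub>, x}" "x \<noteq> \<zero>\<^bsub>Z2_dual_numbers\<^esub>"
        using Z2_dual_numbers(3) by blast
      then have "B \<simeq> Z2_dual_numbers"
        using local_order_4_iso[OF AB(2) c(2-4) Z2_dual_numbers(1,2)] True Z2_dual_numbers(4) by blast
      then show ?thesis using to[OF isoA(2)[OF c(1)]] by blast
    next
      case False
      then have "B \<simeq> Zmod 4" using local_order_4_iso[OF AB(2) c(2-4) Zmod_4(1-4)] Zmod_4(5) by blast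
      then show ?thesis using to[OF isoA(2)[OF c(1)]] by blast
    qed
  next
    assume c: "nonunits A = {\<zero>\<^bsub>A\<^esub>}" "card (carrier A) \<in> {2, 3, 4}" "card (carrier B) \<in> {5, 7}"
    then consider "A \<simeq> Zmod 2" | "A \<simeq> Zmod 3" | "card (carrier A) = 4" using isoA by blast
    moreover have "B \<simeq> Zmod 5 \<or> B \<simeq> Zmod 7" using c(3) isoB by blast
    ultimately show ?list using to toF[OF c(1)] by cases blast+
  qed
qed

end
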